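(* Let $(R,[\ ,\ ,\ ])$ be a nonzero $R$-semiprime triple Lie system. Then $P(R)$ is a triple Lie system of quotients of $R$; $P(R)$ embeds into $Q_m(R)$ identically on $R$; $$O(P(R))\subseteq Q_m(P(R))=O(Q_m(P(R)));$$ and $Q_m(P(R))_B$ is a triple Lie system of quotients of $O(P(R))_B$ for any ultrafilter $B$ in $B(R)$.
   Context: $F$ is an associative commutative ring with $1$. A triple Lie system over $F$ is an $F$-module $R$ with trilinear $[\ ,\ ,\ ]:R^3\to R$ satisfying $[x,x,y]=0$, $[x,y,z]+[y,z,x]+[z,x,y]=0$, $[x,y,[a,b,c]]=[[x,y,a],b,c]+[a,[x,y,b],c]+[a,b,[x,y,c]]$. An ideal is a submodule $I$ with $[I,R,R]\subseteq I$ (equivalently $[I,R,R]+[R,I,R]+[R,R,I]\subseteq I$). $R$ is $R$-semiprime if $[I,I,R]+[I,R,I]+[R,I,I]\ne\{0\}$ for every nonzero ideal $I$. $M(R)$ is the associative subalgebra of $\mathrm{End}_F(R)$ generated by all operators $[x,y,\cdot],[x,\cdot,y],[\cdot,x,y]$, and $M(R)'=F\,\mathrm{Id}_R+M(R)$, acting on the right. For nonzero $R$-semiprime $R$: $I(R)$ is an injective hull of the right $M(R)'$-module $R$; $P(R)=\mathrm{End}(I(R))_{M(R)'}R$; $\mathrm{CM}(R)=\mathrm{End}(P(R))_{M(R)'}$ (commutative, von Neumann regular). $P(R)=\mathrm{CM}(R)R$ is regarded as a triple system over $\mathrm{CM}(R)$, composition extended from $R$ by $\mathrm{CM}(R)$-linearity;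 $M(P(R))'=\mathrm{CM}(R)\mathrm{Id}+M(P(R))$; $I(P(R))$ is an injective hull of the right $M(P(R))'$-module $P(R)$. $B(R)$ is the set of idempotents of $\mathrm{CM}(R)$, a Boolean ring with multiplication of $\mathrm{CM}(R)$, addition $\alpha\oplus\beta=(\alpha-\beta)^2$, order $\alpha\le\beta$ iff $\alpha\beta=\alpha$. A subset of $B(R)$ is dense if its annihilator in $B(R)$ is zero, orthogonal if distinct elements have zero product. $S\subseteq I(P(R))$ is orthogonally complete if for every dense orthogonal $\{\xi_a\}_{a\in I}\subseteq B(R)$ and $\{x_a\}_{a\in I}\subseteq S$ there is $x\in S$ (unique, denoted $\sum^\perp_{a\in I}\xi_ax_a$) with $\xi_ax=\xi_ax_a$ for all $a$; $O(S)$ is the intersection of all orthogonally complete subsets of $I(P(R))$ containing $S$ (it is the set of all $\sum^\perp\xi_ax_a$, $x_a\in S$). The operations of $P(R)$ extend to $O(P(R))$ componentwise, e.g. $[\sum^\perp\xi_ax_a,\sum^\perp\chi_by_b,\sum^\perp\eta_cz_c]=\sum^\perp\xi_a\chi_b\eta_c[x_a,y_b,z_c]$. An ultrafilter in $B(R)$ is $B\subseteq B(R)\setminus\{0\}$ closed under products, upward closed for $\le$, and such that for each $\alpha\in B(R)$ either $\alpha\in B$ or $\mathrm{Id}-\alpha\in B$. With $P=B(R)\setminus B$, $PS=\{\alpha x\mid\alpha\in P,x\in S\}$, $S_B=S/(S\cap PS)$. A triple Lie system $Q$ is a (triple) Lie system of quotients of $R$ if $R$ is a subsystem of $Q$ and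 for every $0\ne q\in Q$ there is an ideal $I$ of $R$ with $\mathrm{Ann}_RI=\{x\in R\mid[x,I,R]=[x,R,I]=\{0\}\}=\{0\}$ and $\{0\}\ne[q,I,R]+[q,R,I]\subseteq R$. For $R$-semiprime $R$, $Q_m(R)$ is the maximal system of quotients: the one into which every system of quotients of $R$ embeds identically on $R$ (known to exist and be unique up to an isomorphism identical on $R$; realized as the degree $1$ component of the maximal $\mathbb Z_2$-graded algebra of quotients of the standard Lie enveloping algebra $\mathcal L(R)=R\oplus[R,R]$ with $\mathcal L(R)_1=R$). $Q_m(P(R))$ is formed for $P(R)$ as a system over $\mathrm{CM}(R)$; it is identified, by an embedding identical on $P(R)$, with an $M(P(R))'$-submodule of $I(P(R))$, $P(R)$ being essential in it. *)

theory Defs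
  imports "HOL-Algebra.Module" "HOL-Algebra.AbelCoset" "HOL-Algebra.Generated_Groups" "HOL-Library.FuncSet"
begin

section \<open>Triple Lie systems\<close>

record ('a, 'b) triple_system = "('a, 'b) module" +
  triple :: "['b, 'b, 'b] \<Rightarrow> 'b" (\<open>\<lblot>_,_,_\<rblot>\<index>\<close>)

definition trilinear :: "('a, 'm) ring_scheme \<Rightarrow> ('a, 'b, 'n) module_scheme \<Rightarrow> (['b, 'b, 'b] \<Rightarrow> 'b) \<Rightarrow> bool"
  where "trilinear K M t \<longleftrightarrow>
    (\<forall>x\<in>carrier M. \<forall>y\<in>carrier M. \<forall>z\<in>carrier M. t x y z \<in> carrier M) \<and>
    (\<forall>x\<in>carrier M. \<forall>x'\<in>carrier M. \<forall>y\<in>carrier M. \<forall>z\<in>carrier M.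
       t (x \<oplus>\<^bsub>M\<^esub> x') y z = t x y z \<oplus>\<^bsub>M\<^esub> t x' y z \<and>
       t y (x \<oplus>\<^bsub>M\<^esub> x') z = t y x z \<oplus>\<^bsub>M\<^esub> t y x' z \<and>
       t y z (x \<oplus>\<^bsub>M\<^esub> x') = t y z x \<oplus>\<^bsub>M\<^esub> t y z x') \<and>
    (\<forall>c\<in>carrier K. \<forall>x\<in>carrier M. \<forall>y\<in>carrier M. \<forall>z\<in>carrier M.
       t (c \<odot>\<^bsub>M\<^esub> x) y z = c \<odot>\<^bsub>M\<^esub> t x y z \<and>
       t x (c \<odot>\<^bsub>M\<^esub> y) z = c \<odot>\<^bsub>M\<^esub> t x y z \<and>
       t x y (c \<odot>\<^bsub>M\<^esub> z) = c \<odot>\<^bsub>M\<^esub> t x y z)"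

locale triple_lie_system = module K T
  for K :: "('a, 'm) ring_scheme" and T :: "('a, 'b, 'n) triple_system_scheme" (structure) +
  assumes trilinear: "trilinear K T (triple T)"
    and alternating: "\<lbrakk>x \<in> carrier T; y \<in> carrier T\<rbrakk> \<Longrightarrow> \<lblot>x,x,y\<rblot> = \<zero>"
    and cyclic: "\<lbrakk>x \<in> carrier T; y \<in> carrier T; z \<in> carrier T\<rbrakk> \<Longrightarrow>
      \<lblot>x,y,z\<rblot> \<oplus> \<lblot>y,z,x\<rblot> \<oplus> \<lblot>z,x,y\<rblot> = \<zero>"
    and derivation: "\<lbrakk>x \<in> carrier T; y \<in> carrier T; a \<in> carrier T; b \<in> carrier T; c \<in> carrier T\<rbrakk> \<Longrightarrow>
      \<lblot>x,y,\<lblot>a,b,c\<rblot>\<rblot> = \<lblot>\<lblot>x,y,a\<rblot>,b,c\<rblot> \<oplus> \<lblot>a,\<lblot>x,y,b\<rblot>,c\<rblot> \<oplus> \<lblot>a,b,\<lblot>x,y,c\<rblot>\<rblot>"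

definition triple_ideal :: "('a, 'm) ring_scheme \<Rightarrow> ('a, 'b, 'n) triple_system_scheme \<Rightarrow> 'b set \<Rightarrow> bool"
  where "triple_ideal K T I \<longleftrightarrow>
    submodule I K T \<and> (\<forall>x\<in>I. \<forall>y\<in>carrier T. \<forall>z\<in>carrier T. \<lblot>x,y,z\<rblot>\<^bsub>T\<^esub> \<in> I)"

text \<open>\<open>[A, B, C]\<close> is the additive subgroup generated by the products; it is a submodule as soon
  as one of the three sets is one.\<close>

definition triple_prod :: "('a, 'b, 'n) triple_system_scheme \<Rightarrow> 'b set \<Rightarrow> 'b set \<Rightarrow> 'b set \<Rightarrow> 'b set"
  where "triple_prod T A B C = generate (add_monoid T) {\<lblot>a,b,c\<rblot>\<^bsub>T\<^esub> | a b c. a \<in> A \<and> b \<in> B \<and> c \<in> C}"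

definition triple_semiprime :: "('a, 'm) ring_scheme \<Rightarrow> ('a, 'b, 'n) triple_system_scheme \<Rightarrow> bool"
  where "triple_semiprime K T \<longleftrightarrow> (\<forall>I. triple_ideal K T I \<and> I \<noteq> {\<zero>\<^bsub>T\<^esub>} \<longrightarrow>
    triple_prod T I I (carrier T) <+>\<^bsub>T\<^esub> triple_prod T I (carrier T) I <+>\<^bsub>T\<^esub> triple_prod T (carrier T) I I
      \<noteq> {\<zero>\<^bsub>T\<^esub>})"

definition triple_embedding ::
  "('a, 'm) ring_scheme \<Rightarrow> ('a, 'b, 'n) triple_system_scheme \<Rightarrow> ('a, 'c, 'p) triple_system_scheme \<Rightarrow> ('b \<Rightarrow> 'c) \<Rightarrow> bool"
  where "triple_embedding K T Q f \<longleftrightarrow>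
    triple_lie_system K T \<and> triple_lie_system K Q \<and>
    f \<in> carrier T \<rightarrow> carrier Q \<and> inj_on f (carrier T) \<and>
    (\<forall>x\<in>carrier T. \<forall>y\<in>carrier T. f (x \<oplus>\<^bsub>T\<^esub> y) = f x \<oplus>\<^bsub>Q\<^esub> f y) \<and>
    (\<forall>c\<in>carrier K. \<forall>x\<in>carrier T. f (c \<odot>\<^bsub>T\<^esub> x) = c \<odot>\<^bsub>Q\<^esub> f x) \<and>
    (\<forall>x\<in>carrier T. \<forall>y\<in>carrier T. \<forall>z\<in>carrier T. f \<lblot>x,y,z\<rblot>\<^bsub>T\<^esub> = \<lblot>f x,f y,f z\<rblot>\<^bsub>Q\<^esub>)"

abbreviation triple_subsystem ::
  "('a, 'm) ring_scheme \<Rightarrow> ('a, 'b, 'n) triple_system_scheme \<Rightarrow> ('a, 'b, 'p) triple_system_scheme \<Rightarrow> bool"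
  where "triple_subsystem K T Q \<equiv> triple_embedding K T Q (\<lambda>x. x)"


section \<open>Systems of quotients\<close>

definition triple_ann :: "('a, 'b, 'n) triple_system_scheme \<Rightarrow> 'b set \<Rightarrow> 'b set"
  where "triple_ann T I =
    {x \<in> carrier T. \<forall>a\<in>I. \<forall>y\<in>carrier T. \<lblot>x,a,y\<rblot>\<^bsub>T\<^esub> = \<zero>\<^bsub>T\<^esub> \<and> \<lblot>x,y,a\<rblot>\<^bsub>T\<^esub> = \<zero>\<^bsub>T\<^esub>}"

text \<open>The inclusion of \<open>T\<close> in \<open>Q\<close> is given by an embedding \<open>i\<close>, so that the two systems may live
  on different types.\<close>

definition quotient_system ::
  "('a, 'm) ring_scheme \<Rightarrow> ('a, 'b, 'n) triple_system_scheme \<Rightarrow> ('a, 'c, 'p) triple_system_scheme \<Rightarrow> ('b \<Rightarrow> 'c) \<Rightarrow> bool"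
  where "quotient_system K T Q i \<longleftrightarrow> triple_embedding K T Q i \<and>
    (\<forall>q\<in>carrier Q. q \<noteq> \<zero>\<^bsub>Q\<^esub> \<longrightarrow>
      (\<exists>I. triple_ideal K T I \<and> triple_ann T I = {\<zero>\<^bsub>T\<^esub>} \<and>
        triple_prod Q {q} (i ` I) (i ` carrier T) <+>\<^bsub>Q\<^esub> triple_prod Q {q} (i ` carrier T) (i ` I)
          \<noteq> {\<zero>\<^bsub>Q\<^esub>} \<and>
        triple_prod Q {q} (i ` I) (i ` carrier T) <+>\<^bsub>Q\<^esub> triple_prod Q {q} (i ` carrier T) (i ` I)
          \<subseteq> i ` carrier T))"

text \<open>HOL cannot quantify over systems of quotients on all types.  It suffices to consider those
  on the type \<open>'b set \<times> ('b \<Rightarrow> 'b \<Rightarrow> 'b) \<times> ('b \<Rightarrow> 'b \<Rightarrow> 'b)\<close>, since every system of quotients is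
  isomorphic to one on this type: an element \<open>q\<close> is determined by an ideal \<open>I\<close> with zero annihilator
  and \<open>[q, I, T] + [q, T, I] \<subseteq> T\<close>, together with the restrictions of \<open>(x, y) \<mapsto> [q, x, y]\<close> to
  \<open>I \<times> T\<close> and to \<open>T \<times> I\<close>.\<close>

definition maximal_quotient_system ::
  "('a, 'm) ring_scheme \<Rightarrow> ('a, 'b, 'n) triple_system_scheme \<Rightarrow> ('a, 'c, 'p) triple_system_scheme \<Rightarrow> ('b \<Rightarrow> 'c) \<Rightarrow> bool"
  where "maximal_quotient_system K T Q i \<longleftrightarrow> quotient_system K T Q i \<and>
    (\<forall>(Q' :: ('a, 'b set \<times> ('b \<Rightarrow> 'b \<Rightarrow> 'b) \<times> ('b \<Rightarrow> 'b \<Rightarrow> 'b)) triple_system) i'.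
      quotient_system K T Q' i' \<longrightarrow>
      (\<exists>f. triple_embedding K Q' Q f \<and> (\<forall>x\<in>carrier T. f (i' x) = i x)))"


section \<open>Right modules and injective hulls\<close>

text \<open>A right module over a possibly noncommutative ring \<open>S\<close> is stored in a \<^typ>\<open>('a, 'b) module\<close>
  record; \<open>a \<odot> x\<close> stands for \<open>x a\<close>, whence the order of the factors in \<open>act_assoc\<close>.
  The fields \<open>mult\<close> and \<open>one\<close> of a module record are never used.\<close>

locale right_module = S?: ring S + M?: abelian_group M
  for S :: "('s, 'm) ring_scheme" and M :: "('s, 'b, 'n) module_scheme" (structure) +
  assumes act_closed: "\<lbrakk>a \<in> carrier S; x \<in> carrier M\<rbrakk> \<Longrightarrow> a \<odot> x \<in> carrier M"
    and act_l_distr: "\<lbrakk>a \<in> carrier S; b \<in> carrier S; x \<in> carrier M\<rbrakk> \<Longrightarrow>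
      (a \<oplus>\<^bsub>S\<^esub> b) \<odot> x = a \<odot> x \<oplus> b \<odot> x"
    and act_r_distr: "\<lbrakk>a \<in> carrier S; x \<in> carrier M; y \<in> carrier M\<rbrakk> \<Longrightarrow>
      a \<odot> (x \<oplus> y) = a \<odot> x \<oplus> a \<odot> y"
    and act_assoc: "\<lbrakk>a \<in> carrier S; b \<in> carrier S; x \<in> carrier M\<rbrakk> \<Longrightarrow>
      (a \<otimes>\<^bsub>S\<^esub> b) \<odot> x = b \<odot> (a \<odot> x)"
    and act_one: "x \<in> carrier M \<Longrightarrow> \<one>\<^bsub>S\<^esub> \<odot> x = x"

definition rmod_hom ::
  "('s, 'm) ring_scheme \<Rightarrow> ('s, 'b, 'n) module_scheme \<Rightarrow> ('s, 'c, 'p) module_scheme \<Rightarrow> ('b \<Rightarrow> 'c) set"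
  where "rmod_hom S M N = {f \<in> carrier M \<rightarrow> carrier N.
    (\<forall>x\<in>carrier M. \<forall>y\<in>carrier M. f (x \<oplus>\<^bsub>M\<^esub> y) = f x \<oplus>\<^bsub>N\<^esub> f y) \<and>
    (\<forall>a\<in>carrier S. \<forall>x\<in>carrier M. f (a \<odot>\<^bsub>M\<^esub> x) = a \<odot>\<^bsub>N\<^esub> f x)}"

text \<open>Endomorphisms are normalised to be undefined off the carrier, and act on the left.\<close>

definition rmod_End :: "('s, 'm) ring_scheme \<Rightarrow> ('s, 'b, 'n) module_scheme \<Rightarrow> ('b \<Rightarrow> 'b) ring"
  where "rmod_End S M = \<lparr>carrier = rmod_hom S M M \<inter> extensional (carrier M),
    monoid.mult = (\<lambda>f g. compose (carrier M) f g), one = (\<lambda>x\<in>carrier M. x),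
    ring.zero = (\<lambda>x\<in>carrier M. \<zero>\<^bsub>M\<^esub>), ring.add = (\<lambda>f g. \<lambda>x\<in>carrier M. f x \<oplus>\<^bsub>M\<^esub> g x)\<rparr>"

text \<open>The test modules live on \<open>'s + 'b\<close>, as HOL cannot quantify over all types.  This type contains
  a copy of \<open>S\<close>, so by Baer's criterion the notion is injectivity with respect to all right modules.\<close>

definition injective_rmod :: "('s, 'm) ring_scheme \<Rightarrow> ('s, 'b, 'n) module_scheme \<Rightarrow> bool"
  where "injective_rmod S E \<longleftrightarrow> right_module S E \<and>
    (\<forall>(B :: ('s, 's + 'b) module) A f.
      right_module S B \<and> submodule A S B \<and> f \<in> rmod_hom S (B\<lparr>carrier := A\<rparr>) E \<longrightarrow>
      (\<exists>g\<in>rmod_hom S B E. \<forall>x\<in>A. g x = f x))"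

definition essential_submodule :: "('s, 'm) ring_scheme \<Rightarrow> ('s, 'b, 'n) module_scheme \<Rightarrow> 'b set \<Rightarrow> bool"
  where "essential_submodule S M N \<longleftrightarrow> submodule N S M \<and>
    (\<forall>L. submodule L S M \<and> L \<noteq> {\<zero>\<^bsub>M\<^esub>} \<longrightarrow> L \<inter> N \<noteq> {\<zero>\<^bsub>M\<^esub>})"

definition injective_hull ::
  "('s, 'm) ring_scheme \<Rightarrow> ('s, 'b, 'n) module_scheme \<Rightarrow> ('s, 'c, 'p) module_scheme \<Rightarrow> ('b \<Rightarrow> 'c) \<Rightarrow> bool"
  where "injective_hull S N E j \<longleftrightarrow> right_module S N \<and> injective_rmod S E \<and>
    j \<in> rmod_hom S N E \<and> inj_on j (carrier N) \<and> essential_submodule S E (j ` carrier N)"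


section \<open>The multiplication algebra\<close>

definition scalar_op :: "('a, 'b, 'n) module_scheme \<Rightarrow> 'a \<Rightarrow> 'b \<Rightarrow> 'b"
  where "scalar_op M c = (\<lambda>x\<in>carrier M. c \<odot>\<^bsub>M\<^esub> x)"

text \<open>The ring of \<open>K\<close>-endomorphisms acting on the right, so \<open>f \<otimes> g\<close> applies \<open>f\<close> first.\<close>

definition lin_End :: "('a, 'm) ring_scheme \<Rightarrow> ('a, 'b, 'n) module_scheme \<Rightarrow> ('b \<Rightarrow> 'b) ring"
  where "lin_End K M = \<lparr>carrier = {f \<in> extensional (carrier M) \<inter> (carrier M \<rightarrow> carrier M).
      (\<forall>x\<in>carrier M. \<forall>y\<in>carrier M. f (x \<oplus>\<^bsub>M\<^esub> y) = f x \<oplus>\<^bsub>M\<^esub> f y) \<and>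
      (\<forall>c\<in>carrier K. \<forall>x\<in>carrier M. f (c \<odot>\<^bsub>M\<^esub> x) = c \<odot>\<^bsub>M\<^esub> f x)},
    monoid.mult = (\<lambda>f g. compose (carrier M) g f), one = (\<lambda>x\<in>carrier M. x),
    ring.zero = (\<lambda>x\<in>carrier M. \<zero>\<^bsub>M\<^esub>), ring.add = (\<lambda>f g. \<lambda>x\<in>carrier M. f x \<oplus>\<^bsub>M\<^esub> g x)\<rparr>"

definition mult_op1 :: "('a, 'b, 'n) triple_system_scheme \<Rightarrow> 'b \<Rightarrow> 'b \<Rightarrow> 'b \<Rightarrow> 'b"
  where "mult_op1 T x y = (\<lambda>z\<in>carrier T. \<lblot>z,x,y\<rblot>\<^bsub>T\<^esub>)"

definition mult_op2 :: "('a, 'b, 'n) triple_system_scheme \<Rightarrow> 'b \<Rightarrow> 'b \<Rightarrow> 'b \<Rightarrow> 'b"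
  where "mult_op2 T x y = (\<lambda>z\<in>carrier T. \<lblot>x,z,y\<rblot>\<^bsub>T\<^esub>)"

definition mult_op3 :: "('a, 'b, 'n) triple_system_scheme \<Rightarrow> 'b \<Rightarrow> 'b \<Rightarrow> 'b \<Rightarrow> 'b"
  where "mult_op3 T x y = (\<lambda>z\<in>carrier T. \<lblot>x,y,z\<rblot>\<^bsub>T\<^esub>)"

text \<open>\<open>M(T)\<close>, an algebra without unit in general\<close>

definition mult_algebra :: "('a, 'm) ring_scheme \<Rightarrow> ('a, 'b, 'n) triple_system_scheme \<Rightarrow> ('b \<Rightarrow> 'b) set"
  where "mult_algebra K T = \<Inter>{V. subgroup V (add_monoid (lin_End K T)) \<and>
    (\<forall>c\<in>carrier K. \<forall>f\<in>V. scalar_op T c \<otimes>\<^bsub>lin_End K T\<^esub> f \<in> V) \<and>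
    (\<forall>f\<in>V. \<forall>g\<in>V. f \<otimes>\<^bsub>lin_End K T\<^esub> g \<in> V) \<and>
    (\<forall>x\<in>carrier T. \<forall>y\<in>carrier T. mult_op1 T x y \<in> V \<and> mult_op2 T x y \<in> V \<and> mult_op3 T x y \<in> V)}"

text \<open>\<open>M(T)' = K Id + M(T)\<close>\<close>

definition mult_ring :: "('a, 'm) ring_scheme \<Rightarrow> ('a, 'b, 'n) triple_system_scheme \<Rightarrow> ('b \<Rightarrow> 'b) ring"
  where "mult_ring K T = (lin_End K T)
    \<lparr>carrier := scalar_op T ` carrier K <+>\<^bsub>lin_End K T\<^esub> mult_algebra K T\<rparr>"

text \<open>\<open>T\<close> as a right \<open>M(T)'\<close>-module\<close>

definition op_module :: "('a, 'b, 'n) triple_system_scheme \<Rightarrow> ('b \<Rightarrow> 'b, 'b) module"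
  where "op_module T = \<lparr>carrier = carrier T, monoid.mult = monoid.mult T, one = \<one>\<^bsub>T\<^esub>,
    ring.zero = \<zero>\<^bsub>T\<^esub>, ring.add = ring.add T, module.smult = (\<lambda>f x. f x)\<rparr>"

text \<open>A right \<open>M(T)'\<close>-module viewed as a module over the ring of scalars of \<open>T\<close>\<close>

definition scalar_module ::
  "('a, 'b, 'n) triple_system_scheme \<Rightarrow> ('b \<Rightarrow> 'b, 'c, 'p) module_scheme \<Rightarrow> ('a, 'c) module"
  where "scalar_module T M = \<lparr>carrier = carrier M, monoid.mult = monoid.mult M, one = \<one>\<^bsub>M\<^esub>,
    ring.zero = \<zero>\<^bsub>M\<^esub>, ring.add = ring.add M, module.smult = (\<lambda>c x. scalar_op T c \<odot>\<^bsub>M\<^esub> x)\<rparr>"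


section \<open>\<open>P(R)\<close> and \<open>CM(R)\<close>\<close>

text \<open>Here \<open>E\<close>, with the embedding \<open>j\<close>, is an injective hull of the right \<open>M(R)'\<close>-module \<open>R\<close>.\<close>

definition P_carrier ::
  "('a, 'm) ring_scheme \<Rightarrow> ('a, 'b, 'n) triple_system_scheme \<Rightarrow> ('b \<Rightarrow> 'b, 'e) module \<Rightarrow> ('b \<Rightarrow> 'e) \<Rightarrow> 'e set"
  where "P_carrier F R E j = generate (add_monoid E)
    {f (j x) | f x. f \<in> carrier (rmod_End (mult_ring F R) E) \<and> x \<in> carrier R}"

definition CM ::
  "('a, 'm) ring_scheme \<Rightarrow> ('a, 'b, 'n) triple_system_scheme \<Rightarrow> ('b \<Rightarrow> 'b, 'e) module \<Rightarrow> ('b \<Rightarrow> 'e) \<Rightarrow> ('e \<Rightarrow> 'e) ring"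
  where "CM F R E j = rmod_End (mult_ring F R) (E\<lparr>carrier := P_carrier F R E j\<rparr>)"

definition P_module ::
  "('a, 'm) ring_scheme \<Rightarrow> ('a, 'b, 'n) triple_system_scheme \<Rightarrow> ('b \<Rightarrow> 'b, 'e) module \<Rightarrow> ('b \<Rightarrow> 'e) \<Rightarrow> ('e \<Rightarrow> 'e, 'e) module"
  where "P_module F R E j = \<lparr>carrier = P_carrier F R E j, monoid.mult = monoid.mult E, one = \<one>\<^bsub>E\<^esub>,
    ring.zero = \<zero>\<^bsub>E\<^esub>, ring.add = ring.add E, module.smult = (\<lambda>c x. c x)\<rparr>"

text \<open>The \<open>CM(R)\<close>-trilinear extension of the composition of \<open>R\<close>.  Since \<open>P(R) = CM(R) R\<close>, its
  values on \<open>P(R)\<close> are uniquely determined; only the values off \<open>P(R)\<close> depend on the choice.\<close>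

definition P_triple ::
  "('a, 'm) ring_scheme \<Rightarrow> ('a, 'b, 'n) triple_system_scheme \<Rightarrow> ('b \<Rightarrow> 'b, 'e) module \<Rightarrow> ('b \<Rightarrow> 'e) \<Rightarrow> ['e, 'e, 'e] \<Rightarrow> 'e"
  where "P_triple F R E j = (SOME t. trilinear (CM F R E j) (P_module F R E j) t \<and>
    (\<forall>x\<in>carrier R. \<forall>y\<in>carrier R. \<forall>z\<in>carrier R. t (j x) (j y) (j z) = j \<lblot>x,y,z\<rblot>\<^bsub>R\<^esub>))"

definition P_system ::
  "('a, 'm) ring_scheme \<Rightarrow> ('a, 'b, 'n) triple_system_scheme \<Rightarrow> ('b \<Rightarrow> 'b, 'e) module \<Rightarrow> ('b \<Rightarrow> 'e) \<Rightarrow> ('e \<Rightarrow> 'e, 'e) triple_system"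
  where "P_system F R E j = \<lparr>carrier = P_carrier F R E j, monoid.mult = monoid.mult E, one = \<one>\<^bsub>E\<^esub>,
    ring.zero = \<zero>\<^bsub>E\<^esub>, ring.add = ring.add E, module.smult = (\<lambda>c x. c x), triple = P_triple F R E j\<rparr>"

text \<open>\<open>P(R)\<close> is needed both over \<open>CM(R)\<close>, as above, and over \<open>F\<close>, which acts through
  \<open>F Id \<subseteq> M(R)'\<close>.\<close>

definition P_system_base ::
  "('a, 'm) ring_scheme \<Rightarrow> ('a, 'b, 'n) triple_system_scheme \<Rightarrow> ('b \<Rightarrow> 'b, 'e) module \<Rightarrow> ('b \<Rightarrow> 'e) \<Rightarrow> ('a, 'e) triple_system"
  where "P_system_base F R E j = \<lparr>carrier = P_carrier F R E j, monoid.mult = monoid.mult E, one = \<one>\<^bsub>E\<^esub>,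
    ring.zero = \<zero>\<^bsub>E\<^esub>, ring.add = ring.add E, module.smult = module.smult (scalar_module R E), triple = P_triple F R E j\<rparr>"


section \<open>Orthogonal completion\<close>

definition idempotents :: "('a, 'm) ring_scheme \<Rightarrow> 'a set"
  where "idempotents K = {e \<in> carrier K. e \<otimes>\<^bsub>K\<^esub> e = e}"

definition dense_orthogonal :: "('a, 'm) ring_scheme \<Rightarrow> 'a set \<Rightarrow> bool"
  where "dense_orthogonal K D \<longleftrightarrow> D \<subseteq> idempotents K \<and>
    {b \<in> idempotents K. \<forall>d\<in>D. b \<otimes>\<^bsub>K\<^esub> d = \<zero>\<^bsub>K\<^esub>} = {\<zero>\<^bsub>K\<^esub>} \<and>
    (\<forall>d\<in>D. \<forall>e\<in>D. d \<noteq> e \<longrightarrow> d \<otimes>\<^bsub>K\<^esub> e = \<zero>\<^bsub>K\<^esub>)"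

text \<open>\<open>x\<close> is the orthogonal sum of the \<open>e x\<^sub>e\<close>, where the family is indexed by the dense orthogonal
  set \<open>D\<close> itself.\<close>

definition orth_sum :: "('a, 'm) ring_scheme \<Rightarrow> ('a, 'b, 'n) module_scheme \<Rightarrow> 'a set \<Rightarrow> ('a \<Rightarrow> 'b) \<Rightarrow> 'b \<Rightarrow> bool"
  where "orth_sum K M D f x \<longleftrightarrow> dense_orthogonal K D \<and> (\<forall>e\<in>D. e \<odot>\<^bsub>M\<^esub> x = e \<odot>\<^bsub>M\<^esub> f e)"

definition orth_complete :: "('a, 'm) ring_scheme \<Rightarrow> ('a, 'b, 'n) module_scheme \<Rightarrow> 'b set \<Rightarrow> bool"
  where "orth_complete K M S \<longleftrightarrow> S \<subseteq> carrier M \<and>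
    (\<forall>D f. dense_orthogonal K D \<and> f \<in> D \<rightarrow> S \<longrightarrow> (\<exists>x\<in>S. orth_sum K M D f x))"

definition orth_completion :: "('a, 'm) ring_scheme \<Rightarrow> ('a, 'b, 'n) module_scheme \<Rightarrow> 'b set \<Rightarrow> 'b set"
  where "orth_completion K M S = \<Inter>{T. orth_complete K M T \<and> S \<subseteq> T}"

text \<open>\<open>O(P)\<close> inside the right \<open>M(P)'\<close>-module \<open>H\<close>, into which \<open>P\<close> is embedded by \<open>k\<close>,
  with the componentwise composition.\<close>

definition O_triple ::
  "('a, 'm) ring_scheme \<Rightarrow> ('a, 'b, 'n) triple_system_scheme \<Rightarrow> ('b \<Rightarrow> 'b, 'h) module \<Rightarrow> ('b \<Rightarrow> 'h) \<Rightarrow> ['h, 'h, 'h] \<Rightarrow> 'h"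
  where "O_triple K P H k x y z = (let M = scalar_module P H in
    THE w. w \<in> orth_completion K M (k ` carrier P) \<and>
      (\<exists>A a B b C c. a \<in> A \<rightarrow> carrier P \<and> b \<in> B \<rightarrow> carrier P \<and> c \<in> C \<rightarrow> carrier P \<and>
        orth_sum K M A (k \<circ> a) x \<and> orth_sum K M B (k \<circ> b) y \<and> orth_sum K M C (k \<circ> c) z \<and>
        (\<forall>d\<in>A. \<forall>e\<in>B. \<forall>g\<in>C.
          (d \<otimes>\<^bsub>K\<^esub> e \<otimes>\<^bsub>K\<^esub> g) \<odot>\<^bsub>M\<^esub> w = (d \<otimes>\<^bsub>K\<^esub> e \<otimes>\<^bsub>K\<^esub> g) \<odot>\<^bsub>M\<^esub> k \<lblot>a d,b e,c g\<rblot>\<^bsub>P\<^esub>)))"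

definition O_system ::
  "('a, 'm) ring_scheme \<Rightarrow> ('a, 'b, 'n) triple_system_scheme \<Rightarrow> ('b \<Rightarrow> 'b, 'h) module \<Rightarrow> ('b \<Rightarrow> 'h) \<Rightarrow> ('a, 'h) triple_system"
  where "O_system K P H k = \<lparr>carrier = orth_completion K (scalar_module P H) (k ` carrier P),
    monoid.mult = monoid.mult H, one = \<one>\<^bsub>H\<^esub>, ring.zero = \<zero>\<^bsub>H\<^esub>, ring.add = ring.add H, module.smult = module.smult (scalar_module P H),
    triple = O_triple K P H k\<rparr>"

text \<open>\<open>Q\<close> is the maximal system of quotients of \<open>P\<close>, identified with an \<open>M(P)'\<close>-submodule of \<open>H\<close>
  by an embedding that is the identity on \<open>P\<close>.\<close>

definition maximal_quotient_system_in ::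
  "('a, 'm) ring_scheme \<Rightarrow> ('a, 'b, 'n) triple_system_scheme \<Rightarrow> ('b \<Rightarrow> 'b, 'h) module \<Rightarrow> ('b \<Rightarrow> 'h) \<Rightarrow>
    ('a, 'h) triple_system \<Rightarrow> bool"
  where "maximal_quotient_system_in K P H k Q \<longleftrightarrow>
    maximal_quotient_system K P Q k \<and>
    submodule (carrier Q) (mult_ring K P) H \<and>
    (\<forall>p\<in>carrier Q. \<forall>q\<in>carrier Q. p \<oplus>\<^bsub>Q\<^esub> q = p \<oplus>\<^bsub>H\<^esub> q) \<and>
    (\<forall>c\<in>carrier K. \<forall>q\<in>carrier Q. c \<odot>\<^bsub>Q\<^esub> q = scalar_op P c \<odot>\<^bsub>H\<^esub> q) \<and>
    (\<forall>x\<in>carrier P. \<forall>y\<in>carrier P. \<forall>q\<in>carrier Q.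
      \<lblot>q,k x,k y\<rblot>\<^bsub>Q\<^esub> = mult_op1 P x y \<odot>\<^bsub>H\<^esub> q \<and>
      \<lblot>k x,q,k y\<rblot>\<^bsub>Q\<^esub> = mult_op2 P x y \<odot>\<^bsub>H\<^esub> q \<and>
      \<lblot>k x,k y,q\<rblot>\<^bsub>Q\<^esub> = mult_op3 P x y \<odot>\<^bsub>H\<^esub> q) \<and>
    essential_submodule (mult_ring K P) (H\<lparr>carrier := carrier Q\<rparr>) (k ` carrier P)"


section \<open>Localisation at ultrafilters\<close>

definition idem_ultrafilter :: "('a, 'm) ring_scheme \<Rightarrow> 'a set \<Rightarrow> bool"
  where "idem_ultrafilter K U \<longleftrightarrow> U \<subseteq> idempotents K - {\<zero>\<^bsub>K\<^esub>} \<and>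
    (\<forall>a\<in>U. \<forall>b\<in>U. a \<otimes>\<^bsub>K\<^esub> b \<in> U) \<and>
    (\<forall>a\<in>U. \<forall>b\<in>idempotents K. a \<otimes>\<^bsub>K\<^esub> b = a \<longrightarrow> b \<in> U) \<and>
    (\<forall>a\<in>idempotents K. a \<in> U \<or> \<one>\<^bsub>K\<^esub> \<ominus>\<^bsub>K\<^esub> a \<in> U)"

definition null_part :: "('a, 'm) ring_scheme \<Rightarrow> ('a, 'b, 'n) triple_system_scheme \<Rightarrow> 'a set \<Rightarrow> 'b set"
  where "null_part K T U =
    carrier T \<inter> {a \<odot>\<^bsub>T\<^esub> x | a x. a \<in> idempotents K - U \<and> x \<in> carrier T}"

text \<open>The quotient \<open>T\<^sub>U\<close> of \<open>T\<close> by \<^const>\<open>null_part\<close>, as a system of cosets over the same ring\<close>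

definition localised_system ::
  "('a, 'm) ring_scheme \<Rightarrow> ('a, 'b, 'n) triple_system_scheme \<Rightarrow> 'a set \<Rightarrow> ('a, 'b set) triple_system"
  where "localised_system K T U = (let N = null_part K T U in
    \<lparr>carrier = a_rcosets\<^bsub>T\<^esub> N, monoid.mult = undefined, one = undefined,
     ring.zero = N, ring.add = set_add T,
     module.smult = (\<lambda>a A. \<Union>x\<in>A. N +>\<^bsub>T\<^esub> (a \<odot>\<^bsub>T\<^esub> x)),
     triple = (\<lambda>A B C. \<Union>x\<in>A. \<Union>y\<in>B. \<Union>z\<in>C. N +>\<^bsub>T\<^esub> \<lblot>x,y,z\<rblot>\<^bsub>T\<^esub>)\<rparr>)"

text \<open>For a subsystem \<open>T\<close> of \<open>Q\<close>, the map \<open>x + null_part T \<mapsto> x + null_part Q\<close>\<close>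

definition localised_inclusion ::
  "('a, 'm) ring_scheme \<Rightarrow> ('a, 'b, 'n) triple_system_scheme \<Rightarrow> 'a set \<Rightarrow> 'b set \<Rightarrow> 'b set"
  where "localised_inclusion K Q U A = A <+>\<^bsub>Q\<^esub> null_part K Q U"

end

(*
The multiplication operators satisfy the derivation identities inside End(R), so the annihilator of an ideal
is an ideal; for semiprime R an ideal has zero annihilator iff it is essential. Two endomorphisms f, g of the hull E
commute on [x,a,z] for x, a in the essential ideal of common denominators, because fg and gf both give [f x, g a, z];
hence they commute on R and CM(R) is the commutative ring of restrictions of End(E) to P(R). The composition extends
one argument at a time, p being replaced by the operator it defines.

Everything about P(R) over CM(R) follows from semiprimeness, faithfulness and the fact that an endomorphism of an
ideal V of P(R) is multiplication by an element of CM(R): projecting V = L + Ann L onto L produces the support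
idempotent of L. A dense orthogonal family then kills no nonzero element of a system of quotients. The system of all
families (e q_e), e in D, is again a system of quotients of P(R), hence embeds into the maximal one; this is its
orthogonal completeness. The statement at an ultrafilter follows by choosing, along a maximal orthogonal family,
products [q,a,y] or [q,y,a] which detect q, and gluing the chosen a and y.
*)
theory Submission
  imports Defs
begin

section \<open>Triple Lie systems\<close>

text \<open>Three obstacles shape the development. An element of P(R) has no unique expression as a
  sum of scalars times elements of R, so a formula for the extended composition would first have to
  be shown well defined; each argument is therefore extended through operators that are determined
  by their values on R. An orthogonal sum of elements of P(R) need not lie in P(R), so the
  denominator ideal of an infinite family consists of elements with only finitely many nonzero
  components, and completeness comes from maximality and not from a construction in the hull. At an
  ultrafilter the idempotent that witnesses the vanishing of [q,a,y] depends on a and y, so the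
  vanishing of all products gives no common witness for q; a single glued pair has to stand for all
  of them. The idempotent arguments see P(R) only through the properties collected in
  \<open>closed_system\<close>, so the hull of R does not appear in them.\<close>

context triple_lie_system
begin

lemma triple_closed [simp, intro]:
  "\<lbrakk>x \<in> carrier T; y \<in> carrier T; z \<in> carrier T\<rbrakk> \<Longrightarrow> \<lblot>x,y,z\<rblot> \<in> carrier T"
  using trilinear unfolding trilinear_def by blast

lemma triple_add:
  assumes "x \<in> carrier T" "x' \<in> carrier T" "y \<in> carrier T" "z \<in> carrier T"
  shows "\<lblot>x \<oplus> x',y,z\<rblot> = \<lblot>x,y,z\<rblot> \<oplus> \<lblot>x',y,z\<rblot>"
    and "\<lblot>y,x \<oplus> x',z\<rblot> = \<lblot>y,x,z\<rblot> \<oplus> \<lblot>y,x',z\<rblot>"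
    and "\<lblot>y,z,x \<oplus> x'\<rblot> = \<lblot>y,z,x\<rblot> \<oplus> \<lblot>y,z,x'\<rblot>"
  using trilinear assms unfolding trilinear_def by blast+

lemma triple_smult:
  assumes "c \<in> carrier K" "x \<in> carrier T" "y \<in> carrier T" "z \<in> carrier T"
  shows "\<lblot>c \<odot> x,y,z\<rblot> = c \<odot> \<lblot>x,y,z\<rblot>"
    and "\<lblot>x,c \<odot> y,z\<rblot> = c \<odot> \<lblot>x,y,z\<rblot>"
    and "\<lblot>x,y,c \<odot> z\<rblot> = c \<odot> \<lblot>x,y,z\<rblot>"
  using trilinear assms unfolding trilinear_def by blast+

lemma triple_zero [simp]:
  assumes "y \<in> carrier T" "z \<in> carrier T"
  shows "\<lblot>\<zero>,y,z\<rblot> = \<zero>" "\<lblot>y,\<zero>,z\<rblot> = \<zero>" "\<lblot>y,z,\<zero>\<rblot> = \<zero>"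
  using triple_smult[of "\<zero>\<^bsub>K\<^esub>" \<zero> y z] triple_smult[of "\<zero>\<^bsub>K\<^esub>" y \<zero> z] triple_smult[of "\<zero>\<^bsub>K\<^esub>" y z \<zero>] assms
  by auto

lemma triple_minus:
  assumes "x \<in> carrier T" "y \<in> carrier T" "z \<in> carrier T"
  shows "\<lblot>\<ominus> x,y,z\<rblot> = \<ominus> \<lblot>x,y,z\<rblot>"
    and "\<lblot>x,\<ominus> y,z\<rblot> = \<ominus> \<lblot>x,y,z\<rblot>"
    and "\<lblot>x,y,\<ominus> z\<rblot> = \<ominus> \<lblot>x,y,z\<rblot>"
  using triple_smult[of "\<ominus>\<^bsub>K\<^esub> \<one>\<^bsub>K\<^esub>" x y z] assms by (auto simp: smult_l_minus)

text \<open>Polarisation of the alternating law in the first two arguments.\<close>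

lemma triple_swap:
  assumes "x \<in> carrier T" "y \<in> carrier T" "z \<in> carrier T"
  shows "\<lblot>y,x,z\<rblot> = \<ominus> \<lblot>x,y,z\<rblot>"
proof -
  have "\<lblot>x \<oplus> y,x \<oplus> y,z\<rblot> = \<lblot>x,x,z\<rblot> \<oplus> \<lblot>y,x,z\<rblot> \<oplus> (\<lblot>x,y,z\<rblot> \<oplus> \<lblot>y,y,z\<rblot>)"
    using assms by (simp add: triple_add)
  then have "\<zero> = \<lblot>x,y,z\<rblot> \<oplus> \<lblot>y,x,z\<rblot>" using assms by (simp add: alternating M.a_comm)
  then show ?thesis using assms by (metis M.add.inv_equality M.a_comm triple_closed)
qed

lemma triple_rotate:
  assumes "x \<in> carrier T" "y \<in> carrier T" "z \<in> carrier T"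
  shows "\<lblot>z,x,y\<rblot> = \<ominus> (\<lblot>x,y,z\<rblot> \<oplus> \<lblot>y,z,x\<rblot>)"
  using cyclic[OF assms] assms by (metis M.add.inv_equality M.a_comm M.a_closed triple_closed)

lemma minus_zero_module [simp]: "\<ominus> \<zero> = \<zero>"
  using M.r_neg[of \<zero>] by simp

lemma triple_ideal_subset: "triple_ideal K T I \<Longrightarrow> I \<subseteq> carrier T"
  using submoduleE(1) unfolding triple_ideal_def by blast

lemma triple_ideal_mem:
  assumes "triple_ideal K T I"
  shows "\<zero> \<in> I"
    and "x \<in> I \<Longrightarrow> y \<in> I \<Longrightarrow> x \<oplus> y \<in> I"
    and "x \<in> I \<Longrightarrow> \<ominus> x \<in> I"
    and "c \<in> carrier K \<Longrightarrow> x \<in> I \<Longrightarrow> c \<odot> x \<in> I"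
proof -
  have I: "submodule I K T" using assms by (simp add: triple_ideal_def)
  show "\<zero> \<in> I" using subgroup.one_closed[OF submodule.axioms(1)[OF I]] by simp
qed (use assms submoduleE[of I] in \<open>auto simp: triple_ideal_def\<close>)

text \<open>An ideal is defined by its first argument only: skew-symmetry moves it to the middle,
  and the cyclic law then moves it to the end.\<close>

lemma triple_ideal_triple:
  assumes "triple_ideal K T I" "x \<in> I" "y \<in> carrier T" "z \<in> carrier T"
  shows "\<lblot>x,y,z\<rblot> \<in> I" "\<lblot>y,x,z\<rblot> \<in> I" "\<lblot>y,z,x\<rblot> \<in> I"
proof -
  have x: "x \<in> carrier T" using assms triple_ideal_subset by blast
  have 1: "\<lblot>x,y,z\<rblot> \<in> I" if "y \<in> carrier T" "z \<in> carrier T" for y z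
    using assms(1,2) that unfolding triple_ideal_def by blast
  have 2: "\<lblot>y,x,z\<rblot> \<in> I" if "y \<in> carrier T" "z \<in> carrier T" for y z
    using triple_swap[of x y z] x that 1 triple_ideal_mem[OF assms(1)] by simp
  show "\<lblot>x,y,z\<rblot> \<in> I" "\<lblot>y,x,z\<rblot> \<in> I" using 1 2 assms(3,4) by auto
  show "\<lblot>y,z,x\<rblot> \<in> I"
    using triple_rotate[of z x y] x assms(3,4) 1 2 triple_ideal_mem[OF assms(1)]
    by simp
qed

lemma triple_idealI:
  assumes "I \<subseteq> carrier T" "\<zero> \<in> I"
    and "\<And>x y. \<lbrakk>x \<in> I; y \<in> I\<rbrakk> \<Longrightarrow> x \<oplus> y \<in> I"
    and c: "\<And>c x. \<lbrakk>c \<in> carrier K; x \<in> I\<rbrakk> \<Longrightarrow> c \<odot> x \<in> I"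
    and "\<And>x y z. \<lbrakk>x \<in> I; y \<in> carrier T; z \<in> carrier T\<rbrakk> \<Longrightarrow> \<lblot>x,y,z\<rblot> \<in> I"
  shows "triple_ideal K T I"
  unfolding triple_ideal_def
proof (intro conjI submoduleI ballI)
  fix x assume "x \<in> I"
  then show "\<ominus> x \<in> I" using c[of "\<ominus>\<^bsub>K\<^esub> \<one>\<^bsub>K\<^esub>" x] assms(1) by (auto simp: smult_l_minus subset_iff)
qed (use assms in auto)

lemma triple_ideal_carrier: "triple_ideal K T (carrier T)"
  by (rule triple_idealI) auto

lemma triple_ideal_Int:
  assumes "triple_ideal K T I" "triple_ideal K T J"
  shows "triple_ideal K T (I \<inter> J)"
  using triple_ideal_mem[OF assms(1)] triple_ideal_mem[OF assms(2)] triple_ideal_triple[OF assms(1)]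
    triple_ideal_triple[OF assms(2)] triple_ideal_subset[OF assms(1)]
  by (intro triple_idealI) auto

end

section \<open>Annihilators of ideals, taken inside a larger system\<close>

definition centralizer :: "('a, 'b, 'n) triple_system_scheme \<Rightarrow> 'b set \<Rightarrow> 'b set \<Rightarrow> 'b set"
  where "centralizer T A I =
    {q \<in> carrier T. \<forall>a\<in>I. \<forall>y\<in>A. \<lblot>q,a,y\<rblot>\<^bsub>T\<^esub> = \<zero>\<^bsub>T\<^esub> \<and> \<lblot>q,y,a\<rblot>\<^bsub>T\<^esub> = \<zero>\<^bsub>T\<^esub>}"

lemma triple_ann_eq_centralizer: "triple_ann T I = centralizer T (carrier T) I"
  by (simp add: triple_ann_def centralizer_def)

context triple_lie_system
begin

text \<open>The two defining positions force the other four: skew-symmetry brings \<open>q\<close>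
  to the middle, the cyclic law brings it to the end.\<close>

lemma centralizerD:
  assumes "q \<in> centralizer T A I" "a \<in> I" "y \<in> A" "I \<subseteq> carrier T" "A \<subseteq> carrier T"
  shows "\<lblot>q,a,y\<rblot> = \<zero>" "\<lblot>q,y,a\<rblot> = \<zero>" "\<lblot>a,q,y\<rblot> = \<zero>" "\<lblot>y,q,a\<rblot> = \<zero>" "\<lblot>a,y,q\<rblot> = \<zero>" "\<lblot>y,a,q\<rblot> = \<zero>"
proof -
  have c: "q \<in> carrier T" "a \<in> carrier T" "y \<in> carrier T" using assms by (auto simp: centralizer_def)
  show 1: "\<lblot>q,a,y\<rblot> = \<zero>" "\<lblot>q,y,a\<rblot> = \<zero>" using assms by (auto simp: centralizer_def)
  show 2: "\<lblot>a,q,y\<rblot> = \<zero>" "\<lblot>y,q,a\<rblot> = \<zero>" using 1 c triple_swap[of q a y] triple_swap[of q y a] by simp_all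
  show 3: "\<lblot>a,y,q\<rblot> = \<zero>" using triple_rotate[of y q a] 1 2 c by simp
  show "\<lblot>y,a,q\<rblot> = \<zero>" using triple_swap[of a y q] 3 c by simp
qed

lemma centralizer_add:
  assumes "p \<in> centralizer T A I" "q \<in> centralizer T A I" "I \<subseteq> carrier T" "A \<subseteq> carrier T"
  shows "p \<oplus> q \<in> centralizer T A I"
  using assms by (auto simp: centralizer_def triple_add subset_iff)

lemma centralizer_smult:
  assumes "c \<in> carrier K" "q \<in> centralizer T A I" "I \<subseteq> carrier T" "A \<subseteq> carrier T"
  shows "c \<odot> q \<in> centralizer T A I"
  using assms by (auto simp: centralizer_def triple_smult subset_iff)

lemma centralizer_minus:
  assumes "q \<in> centralizer T A I" "I \<subseteq> carrier T" "A \<subseteq> carrier T"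
  shows "\<ominus> q \<in> centralizer T A I"
  using assms by (auto simp: centralizer_def triple_minus subset_iff)

text \<open>The relative form is needed because \<open>q\<close> will be an element of a system of
  quotients while \<open>A\<close> and \<open>I\<close> are the images of the subsystem and of one
  of its ideals. The proof uses the derivation law twice, once for the operator [z,a,-] with a in I
  and once for [q,y,-].\<close>

lemma centralizer_triple:
  assumes A: "A \<subseteq> carrier T" and I: "I \<subseteq> A"
    and AA: "\<And>a y z. \<lbrakk>a \<in> A; y \<in> A; z \<in> A\<rbrakk> \<Longrightarrow> \<lblot>a,y,z\<rblot> \<in> A"
    and IA: "\<And>a y z. \<lbrakk>a \<in> I; y \<in> A; z \<in> A\<rbrakk> \<Longrightarrow> \<lblot>y,a,z\<rblot> \<in> I"
    and q: "q \<in> centralizer T A I" and y: "y \<in> A" and z: "z \<in> A"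
  shows "\<lblot>q,y,z\<rblot> \<in> centralizer T A I" "\<lblot>y,q,z\<rblot> \<in> centralizer T A I" "\<lblot>y,z,q\<rblot> \<in> centralizer T A I"
proof -
  have Ic: "I \<subseteq> carrier T" using A I by blast
  note D = centralizerD[OF q _ _ Ic A]
  have qc: "q \<in> carrier T" using q by (simp add: centralizer_def)
  \<comment> \<open>The derivation [z,a,-] kills \<open>q\<close> and maps y and w into
    \<open>I\<close>, so each of its three terms on [q,y,w] is zero.\<close>
  have h: "\<lblot>z,a,\<lblot>q,y,w\<rblot>\<rblot> = \<zero>" if "a \<in> I" "y \<in> A" "z \<in> A" "w \<in> A" for a y z w
  proof -
    have c: "a \<in> carrier T" "y \<in> carrier T" "z \<in> carrier T" "w \<in> carrier T" using that A Ic by auto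
    show ?thesis
      using derivation[of z a q y w] D[of a z] D[of "\<lblot>z,a,y\<rblot>" w] D[of "\<lblot>z,a,w\<rblot>" y] IA[of a z y] IA[of a z w] that c qc
      by simp
  qed
  have g: "\<lblot>q,y,z\<rblot> \<in> centralizer T A I" if y: "y \<in> A" and z: "z \<in> A" for y z
  proof -
    have c: "y \<in> carrier T" "z \<in> carrier T" using that A by auto
    \<comment> \<open>In the expansion of [q,y,[z,a,w]] the left side vanishes because [z,a,w] lies
      in \<open>I\<close>, the middle term because [q,y,a] = 0, and the last one by
      \<open>h\<close>; only the wanted term remains.\<close>
    have 1: "\<lblot>\<lblot>q,y,z\<rblot>,a,w\<rblot> = \<zero>" if "a \<in> I" "w \<in> A" for a w
    proof -
      have c': "a \<in> carrier T" "w \<in> carrier T" using that A Ic by auto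
      show ?thesis
        using derivation[of q y z a w] D[of "\<lblot>z,a,w\<rblot>" y] D[of a y] h[of a y z w] IA[of a z w] that c c' qc y z
        by simp
    qed
    have "\<lblot>\<lblot>q,y,z\<rblot>,w,a\<rblot> = \<zero>" if "a \<in> I" "w \<in> A" for a w
    proof -
      have c': "a \<in> carrier T" "w \<in> carrier T" using that A Ic by auto
      show ?thesis
        using triple_rotate[of w a "\<lblot>q,y,z\<rblot>"] h[of a y w z] triple_swap[of "\<lblot>q,y,z\<rblot>" a w] 1[OF that] c c' qc that y z
        by simp
    qed
    with 1 show ?thesis using c qc by (auto simp: centralizer_def)
  qed
  have c: "y \<in> carrier T" "z \<in> carrier T" using y z A by auto
  show "\<lblot>q,y,z\<rblot> \<in> centralizer T A I" using g y z .
  have s: "\<lblot>y,q,z\<rblot> \<in> centralizer T A I" if y: "y \<in> A" and z: "z \<in> A" for y z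
    using triple_swap[of q y z] g[OF y z] centralizer_minus[OF _ Ic A] qc subsetD[OF A y] subsetD[OF A z] by auto
  then show "\<lblot>y,q,z\<rblot> \<in> centralizer T A I" using y z .
  show "\<lblot>y,z,q\<rblot> \<in> centralizer T A I"
    using triple_rotate[of z q y] g[OF y z] s[OF z y] centralizer_minus[OF _ Ic A] centralizer_add[OF _ _ Ic A] qc c by simp
qed

lemma triple_ideal_ann:
  assumes "triple_ideal K T I"
  shows "triple_ideal K T (triple_ann T I)"
proof -
  note I = triple_ideal_subset[OF assms]
  show ?thesis
    unfolding triple_ann_eq_centralizer
    using I centralizer_add[OF _ _ I subset_refl] centralizer_smult[OF _ _ I subset_refl]
      centralizer_triple(1)[OF subset_refl I _ triple_ideal_triple(2)[OF assms]]
    by (intro triple_idealI) (auto simp: centralizer_def subset_iff)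
qed

end

section \<open>Semiprimeness and ideals with zero annihilator\<close>

lemma generate_zero:
  assumes "group G" "H \<subseteq> {\<one>\<^bsub>G\<^esub>}"
  shows "generate G H = {\<one>\<^bsub>G\<^esub>}"
  using group.generate_subgroup_incl[OF assms group.triv_subgroup[OF assms(1)]] generate.one[of G H] by blast

text \<open>Semiprimeness in terms of single products: a sum of generated subgroups is zero exactly
  when the generators are. The products [z,a,b] are covered by [a,z,b], which differ from them by a
  sign.\<close>

locale semiprime_system = triple_lie_system +
  assumes semiprime: "\<lbrakk>triple_ideal K T I; \<And>a b z. \<lbrakk>a \<in> I; b \<in> I; z \<in> carrier T\<rbrakk> \<Longrightarrow> \<lblot>a,b,z\<rblot> = \<zero> \<and> \<lblot>a,z,b\<rblot> = \<zero>\<rbrakk>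
    \<Longrightarrow> I \<subseteq> {\<zero>}"

lemma (in triple_lie_system) semiprime_systemI:
  assumes "triple_semiprime K T"
  shows "semiprime_system K T"
proof
  fix I assume I: "triple_ideal K T I"
    and z: "\<And>a b z. \<lbrakk>a \<in> I; b \<in> I; z \<in> carrier T\<rbrakk> \<Longrightarrow> \<lblot>a,b,z\<rblot> = \<zero> \<and> \<lblot>a,z,b\<rblot> = \<zero>"
  note Ic = triple_ideal_subset[OF I]
  have g: "group (add_monoid T)" using M.a_group .
  have z3: "\<lblot>z,a,b\<rblot> = \<zero>" if "a \<in> I" "b \<in> I" "z \<in> carrier T" for a b z
    using z[of a b z] triple_swap[of a z b] subsetD[OF Ic] that by auto
  have "triple_prod T I I (carrier T) = {\<zero>}" "triple_prod T I (carrier T) I = {\<zero>}"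
    "triple_prod T (carrier T) I I = {\<zero>}"
    unfolding triple_prod_def using z z3 by (auto intro!: generate_zero[OF g, simplified])
  moreover have "{\<zero>} <+> {\<zero>} = {\<zero>}" by (simp add: set_add_def set_mult_def)
  ultimately show "I \<subseteq> {\<zero>}" using assms I unfolding triple_semiprime_def by auto
qed

context semiprime_system
begin

text \<open>The ideal obtained by intersecting \<open>I\<close> with its annihilator has only zero
  products, so semiprimeness makes it zero.\<close>

lemma ann_inter:
  assumes I: "triple_ideal K T I" and "x \<in> triple_ann T I" "x \<in> I"
  shows "x = \<zero>"
proof -
  have "triple_ann T I \<inter> I \<subseteq> {\<zero>}"
    using semiprime[OF triple_ideal_Int[OF triple_ideal_ann[OF I] I]] by (auto simp: triple_ann_def)
  then show ?thesis using assms by blast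
qed

text \<open>For x in J and a in I the products [x,a,y] and [x,y,a] lie in both ideals, so every
  element of J annihilates I.\<close>

lemma ann_zero_inter:
  assumes I: "triple_ideal K T I" "triple_ann T I = {\<zero>}" and J: "triple_ideal K T J" and "I \<inter> J \<subseteq> {\<zero>}"
  shows "J \<subseteq> {\<zero>}"
proof
  fix x assume x: "x \<in> J"
  have "\<lblot>x,a,y\<rblot> = \<zero> \<and> \<lblot>x,y,a\<rblot> = \<zero>" if "a \<in> I" "y \<in> carrier T" for a y
  proof -
    have "\<lblot>x,a,y\<rblot> \<in> I \<inter> J" "\<lblot>x,y,a\<rblot> \<in> I \<inter> J"
      using triple_ideal_triple[OF I(1) that(1)] triple_ideal_triple[OF J x] that x
        triple_ideal_subset[OF I(1)] triple_ideal_subset[OF J] by auto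
    then show ?thesis using assms(4) by blast
  qed
  then have "x \<in> triple_ann T I" using x triple_ideal_subset[OF J] by (auto simp: triple_ann_def)
  then show "x \<in> {\<zero>}" using I(2) by simp
qed

text \<open>The annihilator of \<open>I\<close> is itself an ideal meeting \<open>I\<close> in zero,
  so it is the ideal to be tested. This is the direction that uses semiprimeness.\<close>

lemma ann_zeroI:
  assumes I: "triple_ideal K T I"
    and "\<And>J. \<lbrakk>triple_ideal K T J; I \<inter> J \<subseteq> {\<zero>}\<rbrakk> \<Longrightarrow> J \<subseteq> {\<zero>}"
  shows "triple_ann T I = {\<zero>}"
  using assms(2)[OF triple_ideal_ann[OF I]] ann_inter[OF I] triple_ideal_mem(1)[OF triple_ideal_ann[OF I]] by blast

lemma ann_Int_zero:
  assumes I: "triple_ideal K T I" "triple_ann T I = {\<zero>}" and J: "triple_ideal K T J" "triple_ann T J = {\<zero>}"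
  shows "triple_ann T (I \<inter> J) = {\<zero>}"
proof (rule ann_zeroI[OF triple_ideal_Int[OF I(1) J(1)]])
  fix L assume L: "triple_ideal K T L" "I \<inter> J \<inter> L \<subseteq> {\<zero>}"
  have "J \<inter> L \<subseteq> {\<zero>}" using ann_zero_inter[OF I triple_ideal_Int[OF J(1) L(1)]] L(2) by blast
  then show "L \<subseteq> {\<zero>}" using ann_zero_inter[OF J L(1)] by blast
qed

lemma ann_carrier: "triple_ann T (carrier T) = {\<zero>}"
  by (rule ann_zeroI[OF triple_ideal_carrier]) (use triple_ideal_subset in blast)

end

section \<open>Embeddings and systems of quotients\<close>

text \<open>The map \<open>h\<close> is not assumed injective: the lemma serves both for isomorphic
  copies on another type and for passing to cosets.\<close>

lemma triple_lie_image:
  fixes K :: "('a, 'm) ring_scheme" and T :: "('a, 'b, 'n) triple_system_scheme"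
    and T' :: "('a, 'c, 'p) triple_system_scheme"
  assumes "triple_lie_system K T"
    and surj: "carrier T' = h ` carrier T"
    and add: "\<And>x y. \<lbrakk>x \<in> carrier T; y \<in> carrier T\<rbrakk> \<Longrightarrow> h x \<oplus>\<^bsub>T'\<^esub> h y = h (x \<oplus>\<^bsub>T\<^esub> y)"
    and zero: "\<zero>\<^bsub>T'\<^esub> = h \<zero>\<^bsub>T\<^esub>"
    and smult: "\<And>c x. \<lbrakk>c \<in> carrier K; x \<in> carrier T\<rbrakk> \<Longrightarrow> c \<odot>\<^bsub>T'\<^esub> h x = h (c \<odot>\<^bsub>T\<^esub> x)"
    and triple: "\<And>x y z. \<lbrakk>x \<in> carrier T; y \<in> carrier T; z \<in> carrier T\<rbrakk> \<Longrightarrow>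
      \<lblot>h x,h y,h z\<rblot>\<^bsub>T'\<^esub> = h \<lblot>x,y,z\<rblot>\<^bsub>T\<^esub>"
  shows "triple_lie_system K T'"
proof -
  interpret T: triple_lie_system K T by fact
  have "abelian_group T'"
  proof (rule abelian_groupI)
    fix x assume "x \<in> carrier T'"
    then obtain u where "u \<in> carrier T" "x = h u" using surj by auto
    then show "\<exists>y\<in>carrier T'. y \<oplus>\<^bsub>T'\<^esub> x = \<zero>\<^bsub>T'\<^esub>"
      using surj add zero T.M.l_neg by (intro bexI[of _ "h (\<ominus>\<^bsub>T\<^esub> u)"]) auto
  qed (auto simp: surj add zero T.M.a_ac)
  then have "module K T'"
    by (intro moduleI T.R.cring_axioms)
      (auto simp: surj add smult T.smult_l_distr T.smult_r_distr T.smult_assoc1)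
  then interpret T': module K T' .
  show ?thesis
  proof
    show "trilinear K T' (triple T')"
      by (auto simp: trilinear_def surj add smult triple T.triple_add T.triple_smult)
  next
    fix x y assume "x \<in> carrier T'" "y \<in> carrier T'"
    then show "\<lblot>x,x,y\<rblot>\<^bsub>T'\<^esub> = \<zero>\<^bsub>T'\<^esub>" by (auto simp: surj triple zero T.alternating)
  next
    fix x y z assume "x \<in> carrier T'" "y \<in> carrier T'" "z \<in> carrier T'"
    then show "\<lblot>x,y,z\<rblot>\<^bsub>T'\<^esub> \<oplus>\<^bsub>T'\<^esub> \<lblot>y,z,x\<rblot>\<^bsub>T'\<^esub> \<oplus>\<^bsub>T'\<^esub> \<lblot>z,x,y\<rblot>\<^bsub>T'\<^esub> = \<zero>\<^bsub>T'\<^esub>"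
      by (auto simp: surj triple zero add T.cyclic)
  next
    fix x y a b c
    assume "x \<in> carrier T'" "y \<in> carrier T'" "a \<in> carrier T'" "b \<in> carrier T'" "c \<in> carrier T'"
    then obtain x' y' a' b' c' where
      *: "x' \<in> carrier T" "y' \<in> carrier T" "a' \<in> carrier T" "b' \<in> carrier T" "c' \<in> carrier T"
      and "x = h x'" "y = h y'" "a = h a'" "b = h b'" "c = h c'"
      using surj by auto
    then show "\<lblot>x,y,\<lblot>a,b,c\<rblot>\<^bsub>T'\<^esub>\<rblot>\<^bsub>T'\<^esub> =
      \<lblot>\<lblot>x,y,a\<rblot>\<^bsub>T'\<^esub>,b,c\<rblot>\<^bsub>T'\<^esub> \<oplus>\<^bsub>T'\<^esub> \<lblot>a,\<lblot>x,y,b\<rblot>\<^bsub>T'\<^esub>,c\<rblot>\<^bsub>T'\<^esub> \<oplus>\<^bsub>T'\<^esub> \<lblot>a,b,\<lblot>x,y,c\<rblot>\<^bsub>T'\<^esub>\<rblot>\<^bsub>T'\<^esub>"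
      using T.derivation[OF *] by (simp add: triple add)
  qed
qed

locale embedded_system = T: triple_lie_system K T + Q: triple_lie_system K Q
  for K :: "('a, 'm) ring_scheme" and T :: "('a, 'b, 'n) triple_system_scheme"
    and Q :: "('a, 'c, 'p) triple_system_scheme" and i :: "'b \<Rightarrow> 'c" +
  assumes embedding: "triple_embedding K T Q i"

lemma embedded_systemI:
  "triple_embedding K T Q i \<Longrightarrow> embedded_system K T Q i"
  by (simp add: embedded_system_def embedded_system_axioms_def triple_embedding_def)

context embedded_system
begin

lemma emb_closed [simp, intro]: "x \<in> carrier T \<Longrightarrow> i x \<in> carrier Q"
  using embedding by (auto simp: triple_embedding_def)

lemma emb_add [simp]: "\<lbrakk>x \<in> carrier T; y \<in> carrier T\<rbrakk> \<Longrightarrow> i (x \<oplus>\<^bsub>T\<^esub> y) = i x \<oplus>\<^bsub>Q\<^esub> i y"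
  using embedding by (auto simp: triple_embedding_def)

lemma emb_smult [simp]: "\<lbrakk>c \<in> carrier K; x \<in> carrier T\<rbrakk> \<Longrightarrow> i (c \<odot>\<^bsub>T\<^esub> x) = c \<odot>\<^bsub>Q\<^esub> i x"
  using embedding by (auto simp: triple_embedding_def)

lemma emb_triple [simp]:
  "\<lbrakk>x \<in> carrier T; y \<in> carrier T; z \<in> carrier T\<rbrakk> \<Longrightarrow> i \<lblot>x,y,z\<rblot>\<^bsub>T\<^esub> = \<lblot>i x,i y,i z\<rblot>\<^bsub>Q\<^esub>"
  using embedding by (auto simp: triple_embedding_def)

lemma emb_eq_iff [simp]: "\<lbrakk>x \<in> carrier T; y \<in> carrier T\<rbrakk> \<Longrightarrow> i x = i y \<longleftrightarrow> x = y"
  using embedding by (auto simp: triple_embedding_def inj_on_def)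

lemma emb_zero [simp]: "i \<zero>\<^bsub>T\<^esub> = \<zero>\<^bsub>Q\<^esub>"
  using emb_smult[of "\<zero>\<^bsub>K\<^esub>" "\<zero>\<^bsub>T\<^esub>"] by simp

lemma emb_minus [simp]: "x \<in> carrier T \<Longrightarrow> i (\<ominus>\<^bsub>T\<^esub> x) = \<ominus>\<^bsub>Q\<^esub> i x"
  using emb_smult[of "\<ominus>\<^bsub>K\<^esub> \<one>\<^bsub>K\<^esub>" x] by (simp add: T.smult_l_minus Q.smult_l_minus)

lemma emb_image_subgroup: "subgroup (i ` carrier T) (add_monoid Q)"
proof (rule Q.M.add.subgroupI, goal_cases)
  case 3
  then show ?case by (metis (no_types, lifting) T.M.a_inv_closed emb_minus imageE image_eqI)
next
  case (4 a b)
  then show ?case using emb_add by (metis (no_types, lifting) T.M.a_closed imageE image_eqI)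
qed auto

end

text \<open>Meant for W = {0} and for W the image of the subsystem: it turns the two conditions on
  sums of generated subgroups in the definition of a system of quotients into conditions on single
  products.\<close>

lemma (in triple_lie_system) triple_prod_subset_iff:
  assumes "subgroup W (add_monoid T)" "A \<subseteq> carrier T" "B \<subseteq> carrier T" "C \<subseteq> carrier T"
    "A' \<subseteq> carrier T" "B' \<subseteq> carrier T" "C' \<subseteq> carrier T"
  shows "triple_prod T A B C <+> triple_prod T A' B' C' \<subseteq> W \<longleftrightarrow>
    (\<forall>a\<in>A. \<forall>b\<in>B. \<forall>c\<in>C. \<lblot>a,b,c\<rblot> \<in> W) \<and> (\<forall>a\<in>A'. \<forall>b\<in>B'. \<forall>c\<in>C'. \<lblot>a,b,c\<rblot> \<in> W)" (is "?L \<longleftrightarrow> ?R")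
proof -
  have g: "group (add_monoid T)" using M.a_group .
  have sub: "triple_prod T X Y Z \<subseteq> carrier T" if "X \<subseteq> carrier T" "Y \<subseteq> carrier T" "Z \<subseteq> carrier T" for X Y Z
  proof -
    have "{\<lblot>a,b,c\<rblot> |a b c. a \<in> X \<and> b \<in> Y \<and> c \<in> Z} \<subseteq> carrier T" using that by auto
    then show ?thesis unfolding triple_prod_def using group.generate_incl[OF g] by simp
  qed
  have zero: "\<zero> \<in> triple_prod T X Y Z" for X Y Z
    unfolding triple_prod_def using generate.one[of "add_monoid T"] by simp
  have incl: "\<lblot>a,b,c\<rblot> \<in> triple_prod T X Y Z" if "a \<in> X" "b \<in> Y" "c \<in> Z" for a b c X Y Z
    unfolding triple_prod_def using that by (intro generate.incl) blast
  have ?R if L: ?L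
  proof -
    have "x \<in> W" if "x \<in> triple_prod T A B C \<union> triple_prod T A' B' C'" for x
    proof -
      have x: "x \<in> carrier T" using that sub assms by blast
      have "x = x \<oplus> \<zero>" "x = \<zero> \<oplus> x" using x by auto
      then have "x \<in> triple_prod T A B C <+> triple_prod T A' B' C'"
        using that zero[of A B C] zero[of A' B' C'] unfolding set_add_def' by blast
      then show ?thesis using L by blast
    qed
    then show ?R using incl by blast
  qed
  moreover have ?L if R: ?R
  proof -
    have "triple_prod T A B C \<subseteq> W" "triple_prod T A' B' C' \<subseteq> W"
      unfolding triple_prod_def using R by (auto intro!: group.generate_subgroup_incl[OF g _ assms(1)])
    then show ?L using subgroup.m_closed[OF assms(1), simplified] unfolding set_add_def' by blast
  qed
  ultimately show ?thesis by blast
qed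

section \<open>Denominator ideals and nonsingularity\<close>

definition denominator_ideal ::
  "('a, 'm) ring_scheme \<Rightarrow> ('a, 'b, 'n) triple_system_scheme \<Rightarrow> ('a, 'c, 'p) triple_system_scheme \<Rightarrow> ('b \<Rightarrow> 'c) \<Rightarrow>
    'c \<Rightarrow> 'b set \<Rightarrow> bool"
  where "denominator_ideal K T Q i q I \<longleftrightarrow> triple_ideal K T I \<and> triple_ann T I = {\<zero>\<^bsub>T\<^esub>} \<and>
    (\<forall>a\<in>I. \<forall>y\<in>carrier T. \<lblot>q,i a,i y\<rblot>\<^bsub>Q\<^esub> \<in> i ` carrier T \<and> \<lblot>q,i y,i a\<rblot>\<^bsub>Q\<^esub> \<in> i ` carrier T)"

definition kills :: "('a, 'b, 'n) triple_system_scheme \<Rightarrow> ('a, 'c, 'p) triple_system_scheme \<Rightarrow> ('b \<Rightarrow> 'c) \<Rightarrow> 'c \<Rightarrow> 'b set \<Rightarrow> bool"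
  where "kills T Q i q I \<longleftrightarrow>
    (\<forall>a\<in>I. \<forall>y\<in>carrier T. \<lblot>q,i a,i y\<rblot>\<^bsub>Q\<^esub> = \<zero>\<^bsub>Q\<^esub> \<and> \<lblot>q,i y,i a\<rblot>\<^bsub>Q\<^esub> = \<zero>\<^bsub>Q\<^esub>)"

context embedded_system
begin

abbreviation denom where "denom \<equiv> denominator_ideal K T Q i"

lemma denomD:
  assumes "denom q I"
  shows "triple_ideal K T I" "triple_ann T I = {\<zero>\<^bsub>T\<^esub>}"
    "\<lbrakk>a \<in> I; y \<in> carrier T\<rbrakk> \<Longrightarrow> \<lblot>q,i a,i y\<rblot>\<^bsub>Q\<^esub> \<in> i ` carrier T"
    "\<lbrakk>a \<in> I; y \<in> carrier T\<rbrakk> \<Longrightarrow> \<lblot>q,i y,i a\<rblot>\<^bsub>Q\<^esub> \<in> i ` carrier T"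
    "a \<in> I \<Longrightarrow> a \<in> carrier T"
  using assms T.triple_ideal_subset[of I] by (auto simp: denominator_ideal_def)

lemma quotient_system_iff:
  "quotient_system K T Q i \<longleftrightarrow> (\<forall>q\<in>carrier Q. q \<noteq> \<zero>\<^bsub>Q\<^esub> \<longrightarrow> (\<exists>I. denom q I \<and> \<not> kills T Q i q I))"
proof -
  let ?S = "\<lambda>q I. triple_prod Q {q} (i ` I) (i ` carrier T) <+>\<^bsub>Q\<^esub> triple_prod Q {q} (i ` carrier T) (i ` I)"
  have eq: "triple_ideal K T I \<and> triple_ann T I = {\<zero>\<^bsub>T\<^esub>} \<and> ?S q I \<noteq> {\<zero>\<^bsub>Q\<^esub>} \<and> ?S q I \<subseteq> i ` carrier T \<longleftrightarrow>
      denom q I \<and> \<not> kills T Q i q I" if q: "q \<in> carrier Q" for q I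
  proof (cases "triple_ideal K T I")
    case I: True
    have s: "{q} \<subseteq> carrier Q" "i ` I \<subseteq> carrier Q" "i ` carrier T \<subseteq> carrier Q"
      using q T.triple_ideal_subset[OF I] by auto
    have "\<zero>\<^bsub>Q\<^esub> \<in> ?S q I"
    proof -
      have "\<zero>\<^bsub>Q\<^esub> = \<zero>\<^bsub>Q\<^esub> \<oplus>\<^bsub>Q\<^esub> \<zero>\<^bsub>Q\<^esub>" by simp
      moreover have "\<zero>\<^bsub>Q\<^esub> \<in> triple_prod Q X Y Z" for X Y Z
        unfolding triple_prod_def using generate.one[of "add_monoid Q"] by simp
      ultimately show ?thesis unfolding set_add_def' by blast
    qed
    then have ne: "?S q I \<noteq> {\<zero>\<^bsub>Q\<^esub>} \<longleftrightarrow> \<not> ?S q I \<subseteq> {\<zero>\<^bsub>Q\<^esub>}" by blast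
    have "subgroup {\<zero>\<^bsub>Q\<^esub>} (add_monoid Q)" using Q.M.add.triv_subgroup by simp
    note zero = Q.triple_prod_subset_iff[OF this s(1,2,3) s(1,3,2)]
    note sub = Q.triple_prod_subset_iff[OF emb_image_subgroup s(1,2,3) s(1,3,2)]
    have "\<not> ((\<forall>a\<in>I. \<forall>y\<in>C. P a y) \<and> (\<forall>y\<in>C. \<forall>a\<in>I. P' y a)) \<and>
        ((\<forall>a\<in>I. \<forall>y\<in>C. V a y) \<and> (\<forall>y\<in>C. \<forall>a\<in>I. V' y a)) \<longleftrightarrow>
        (\<forall>a\<in>I. \<forall>y\<in>C. V a y \<and> V' y a) \<and> \<not> (\<forall>a\<in>I. \<forall>y\<in>C. P a y \<and> P' y a)"
      for P P' V V' and C :: "'b set"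
      by blast
    then have "?S q I \<noteq> {\<zero>\<^bsub>Q\<^esub>} \<and> ?S q I \<subseteq> i ` carrier T \<longleftrightarrow>
        (\<forall>a\<in>I. \<forall>y\<in>carrier T. \<lblot>q,i a,i y\<rblot>\<^bsub>Q\<^esub> \<in> i ` carrier T \<and> \<lblot>q,i y,i a\<rblot>\<^bsub>Q\<^esub> \<in> i ` carrier T) \<and> \<not> kills T Q i q I"
      unfolding kills_def ne zero sub ball_simps(9) ball_simps(5,7) singleton_iff simp_thms .
    then show ?thesis unfolding denominator_ideal_def by blast
  qed (simp add: denominator_ideal_def)
  have "(\<exists>I. triple_ideal K T I \<and> triple_ann T I = {\<zero>\<^bsub>T\<^esub>} \<and> ?S q I \<noteq> {\<zero>\<^bsub>Q\<^esub>} \<and> ?S q I \<subseteq> i ` carrier T) \<longleftrightarrow>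
      (\<exists>I. denom q I \<and> \<not> kills T Q i q I)" if "q \<in> carrier Q" for q
    by (rule ex_cong1) (rule eq[OF that])
  then have "(\<forall>q\<in>carrier Q. q \<noteq> \<zero>\<^bsub>Q\<^esub> \<longrightarrow>
        (\<exists>I. triple_ideal K T I \<and> triple_ann T I = {\<zero>\<^bsub>T\<^esub>} \<and> ?S q I \<noteq> {\<zero>\<^bsub>Q\<^esub>} \<and> ?S q I \<subseteq> i ` carrier T)) \<longleftrightarrow>
      (\<forall>q\<in>carrier Q. q \<noteq> \<zero>\<^bsub>Q\<^esub> \<longrightarrow> (\<exists>I. denom q I \<and> \<not> kills T Q i q I))"
    by (intro ball_cong imp_cong refl)
  then show ?thesis unfolding quotient_system_def using embedding by blast
qed

text \<open>The elements of \<open>Q\<close> killed by \<open>I\<close> form a set \<open>Z\<close>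
  stable under multiplication by \<open>T\<close>. If it contained a nonzero element, it would
  contain a nonzero element of \<open>T\<close>, which would then annihilate \<open>I\<close> in
  \<open>T\<close>. Essentiality is stated as the hypothesis \<open>meets\<close>, so that the lemma
  applies to systems of quotients and also to P(R), where essentiality comes from the hull.\<close>

lemma essential_nonsingular:
  assumes I: "triple_ideal K T I" "triple_ann T I = {\<zero>\<^bsub>T\<^esub>}" and q: "q \<in> carrier Q" "kills T Q i q I"
    and meets: "\<And>Z. \<lbrakk>Z \<subseteq> carrier Q; \<zero>\<^bsub>Q\<^esub> \<in> Z; \<And>u v. \<lbrakk>u \<in> Z; v \<in> Z\<rbrakk> \<Longrightarrow> u \<oplus>\<^bsub>Q\<^esub> v \<in> Z;
      \<And>c u. \<lbrakk>c \<in> carrier K; u \<in> Z\<rbrakk> \<Longrightarrow> c \<odot>\<^bsub>Q\<^esub> u \<in> Z;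
      \<And>u y z. \<lbrakk>u \<in> Z; y \<in> carrier T; z \<in> carrier T\<rbrakk> \<Longrightarrow>
        \<lblot>u,i y,i z\<rblot>\<^bsub>Q\<^esub> \<in> Z \<and> \<lblot>i y,u,i z\<rblot>\<^bsub>Q\<^esub> \<in> Z \<and> \<lblot>i y,i z,u\<rblot>\<^bsub>Q\<^esub> \<in> Z; q \<in> Z; q \<noteq> \<zero>\<^bsub>Q\<^esub>\<rbrakk> \<Longrightarrow>
      \<exists>x\<in>carrier T. x \<noteq> \<zero>\<^bsub>T\<^esub> \<and> i x \<in> Z"
  shows "q = \<zero>\<^bsub>Q\<^esub>"
proof (rule ccontr)
  assume q0: "q \<noteq> \<zero>\<^bsub>Q\<^esub>"
  define Z where "Z = centralizer Q (i ` carrier T) (i ` I)"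
  note Ic = T.triple_ideal_subset[OF I(1)]
  have sub: "i ` I \<subseteq> carrier Q" "i ` carrier T \<subseteq> carrier Q" "i ` I \<subseteq> i ` carrier T" using Ic by auto
  have TT: "\<lblot>a,y,z\<rblot>\<^bsub>Q\<^esub> \<in> i ` carrier T" if "a \<in> i ` carrier T" "y \<in> i ` carrier T" "z \<in> i ` carrier T" for a y z
    using that by (auto simp del: emb_triple simp: emb_triple[symmetric])
  have IT: "\<lblot>y,a,z\<rblot>\<^bsub>Q\<^esub> \<in> i ` I" if "a \<in> i ` I" "y \<in> i ` carrier T" "z \<in> i ` carrier T" for a y z
    using that T.triple_ideal_triple(2)[OF I(1)] Ic
    by (auto simp del: emb_triple simp: emb_triple[symmetric] subset_iff)
  note ct = Q.centralizer_triple[where A = "i ` carrier T" and I = "i ` I", folded Z_def]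
  have "\<exists>x\<in>carrier T. x \<noteq> \<zero>\<^bsub>T\<^esub> \<and> i x \<in> Z"
  proof (rule meets[OF _ _ _ _ _ _ q0])
    show "Z \<subseteq> carrier Q" by (auto simp: Z_def centralizer_def)
    show "\<zero>\<^bsub>Q\<^esub> \<in> Z" using sub by (auto simp: Z_def centralizer_def)
    show "q \<in> Z" using q by (auto simp: Z_def centralizer_def kills_def)
    show "u \<oplus>\<^bsub>Q\<^esub> v \<in> Z" if "u \<in> Z" "v \<in> Z" for u v
      using that Q.centralizer_add[OF _ _ sub(1,2)] by (simp add: Z_def)
    show "c \<odot>\<^bsub>Q\<^esub> u \<in> Z" if "c \<in> carrier K" "u \<in> Z" for c u
      using that Q.centralizer_smult[OF _ _ sub(1,2)] by (simp add: Z_def)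
    show "\<lblot>u,i y,i z\<rblot>\<^bsub>Q\<^esub> \<in> Z \<and> \<lblot>i y,u,i z\<rblot>\<^bsub>Q\<^esub> \<in> Z \<and> \<lblot>i y,i z,u\<rblot>\<^bsub>Q\<^esub> \<in> Z"
      if "u \<in> Z" "y \<in> carrier T" "z \<in> carrier T" for u y z
    proof -
      note yz = imageI[OF that(2), of i] imageI[OF that(3), of i]
      have "\<lblot>u,i y,i z\<rblot>\<^bsub>Q\<^esub> \<in> Z" by (rule ct(1)) (fact sub that(1) yz | rule TT IT; assumption)+
      moreover have "\<lblot>i y,u,i z\<rblot>\<^bsub>Q\<^esub> \<in> Z" by (rule ct(2)) (fact sub that(1) yz | rule TT IT; assumption)+
      moreover have "\<lblot>i y,i z,u\<rblot>\<^bsub>Q\<^esub> \<in> Z" by (rule ct(3)) (fact sub that(1) yz | rule TT IT; assumption)+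
      ultimately show ?thesis by blast
    qed
  qed
  then obtain x where x: "x \<in> carrier T" "x \<noteq> \<zero>\<^bsub>T\<^esub>" "i x \<in> Z" by blast
  have "\<lblot>x,a,y\<rblot>\<^bsub>T\<^esub> = \<zero>\<^bsub>T\<^esub> \<and> \<lblot>x,y,a\<rblot>\<^bsub>T\<^esub> = \<zero>\<^bsub>T\<^esub>" if a: "a \<in> I" "y \<in> carrier T" for a y
  proof -
    have ac: "a \<in> carrier T" using a Ic by auto
    then have "i \<lblot>x,a,y\<rblot>\<^bsub>T\<^esub> = i \<zero>\<^bsub>T\<^esub>" "i \<lblot>x,y,a\<rblot>\<^bsub>T\<^esub> = i \<zero>\<^bsub>T\<^esub>"
      using x a by (auto simp: Z_def centralizer_def)
    then show ?thesis using ac x a by (simp only: emb_eq_iff T.triple_closed T.M.zero_closed)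
  qed
  then have "x \<in> triple_ann T I" using x by (auto simp: triple_ann_def)
  then show False using I x by auto
qed

end

locale quotient_embedding = embedded_system +
  assumes quotient: "quotient_system K T Q i"

lemma quotient_embeddingI: "quotient_system K T Q i \<Longrightarrow> quotient_embedding K T Q i"
  unfolding quotient_embedding_def quotient_embedding_axioms_def
  using embedded_systemI[of K T Q i] by (auto simp: quotient_system_def[of K T Q i])

context quotient_embedding
begin

lemma quotient_ideal:
  assumes "q \<in> carrier Q" "q \<noteq> \<zero>\<^bsub>Q\<^esub>"
  obtains I where "denom q I" "\<not> kills T Q i q I"
  using quotient assms unfolding quotient_system_iff by blast

text \<open>The ideal \<open>J\<close> which the definition attaches to \<open>q\<close> need not be
  \<open>I\<close>. It yields a nonzero product of \<open>q\<close> lying in \<open>T\<close>, and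
  this product stays in every set stable under multiplication by \<open>T\<close> that contains
  \<open>q\<close>.\<close>

lemma quotient_nonsingular:
  assumes I: "triple_ideal K T I" "triple_ann T I = {\<zero>\<^bsub>T\<^esub>}" and q: "q \<in> carrier Q" "kills T Q i q I"
  shows "q = \<zero>\<^bsub>Q\<^esub>"
proof (rule essential_nonsingular[OF I q])
  fix Z assume Zt: "\<And>u y z. \<lbrakk>u \<in> Z; y \<in> carrier T; z \<in> carrier T\<rbrakk> \<Longrightarrow>
        \<lblot>u,i y,i z\<rblot>\<^bsub>Q\<^esub> \<in> Z \<and> \<lblot>i y,u,i z\<rblot>\<^bsub>Q\<^esub> \<in> Z \<and> \<lblot>i y,i z,u\<rblot>\<^bsub>Q\<^esub> \<in> Z"
    and qZ: "q \<in> Z" and q0: "q \<noteq> \<zero>\<^bsub>Q\<^esub>"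
  obtain J where J: "denom q J" "\<not> kills T Q i q J" by (rule quotient_ideal[OF q(1) q0])
  then obtain a y where a: "a \<in> J" "y \<in> carrier T"
    and ne: "\<lblot>q,i a,i y\<rblot>\<^bsub>Q\<^esub> \<noteq> \<zero>\<^bsub>Q\<^esub> \<or> \<lblot>q,i y,i a\<rblot>\<^bsub>Q\<^esub> \<noteq> \<zero>\<^bsub>Q\<^esub>"
    unfolding kills_def by auto
  note ac = denomD(5)[OF J(1) a(1)]
  have "\<exists>x\<in>carrier T. x \<noteq> \<zero>\<^bsub>T\<^esub> \<and> i x \<in> Z" if u: "u \<in> i ` carrier T" "u \<in> Z" "u \<noteq> \<zero>\<^bsub>Q\<^esub>" for u
  proof -
    obtain x where "x \<in> carrier T" "u = i x" using u(1) by blast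
    then show ?thesis using u by (intro bexI[of _ x]) auto
  qed
  then show "\<exists>x\<in>carrier T. x \<noteq> \<zero>\<^bsub>T\<^esub> \<and> i x \<in> Z"
    using ne denomD(3,4)[OF J(1) a] Zt[OF qZ ac a(2)] Zt[OF qZ a(2) ac] by metis
qed

text \<open>The difference of the two elements is killed by \<open>I\<close>. This is how elements
  of a system of quotients are identified from here on.\<close>

lemma quotient_eqI:
  assumes I: "triple_ideal K T I" "triple_ann T I = {\<zero>\<^bsub>T\<^esub>}" and q: "p \<in> carrier Q" "q \<in> carrier Q"
    and eq: "\<And>a y. \<lbrakk>a \<in> I; y \<in> carrier T\<rbrakk> \<Longrightarrow> \<lblot>p,i a,i y\<rblot>\<^bsub>Q\<^esub> = \<lblot>q,i a,i y\<rblot>\<^bsub>Q\<^esub>"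
      "\<And>a y. \<lbrakk>a \<in> I; y \<in> carrier T\<rbrakk> \<Longrightarrow> \<lblot>p,i y,i a\<rblot>\<^bsub>Q\<^esub> = \<lblot>q,i y,i a\<rblot>\<^bsub>Q\<^esub>"
  shows "p = q"
proof -
  have "p \<oplus>\<^bsub>Q\<^esub> \<ominus>\<^bsub>Q\<^esub> q = \<zero>\<^bsub>Q\<^esub>"
  proof (rule quotient_nonsingular[OF I], goal_cases)
    case 2
    show ?case
      unfolding kills_def
    proof (intro ballI conjI)
      fix a y assume ay: "a \<in> I" "y \<in> carrier T"
      then have c: "i a \<in> carrier Q" "i y \<in> carrier Q" using T.triple_ideal_subset[OF I(1)] by auto
      show "\<lblot>p \<oplus>\<^bsub>Q\<^esub> \<ominus>\<^bsub>Q\<^esub> q,i a,i y\<rblot>\<^bsub>Q\<^esub> = \<zero>\<^bsub>Q\<^esub>"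
        "\<lblot>p \<oplus>\<^bsub>Q\<^esub> \<ominus>\<^bsub>Q\<^esub> q,i y,i a\<rblot>\<^bsub>Q\<^esub> = \<zero>\<^bsub>Q\<^esub>"
        using q c eq[OF ay] by (simp_all add: Q.triple_add Q.triple_minus Q.M.r_neg)
    qed
  qed (use q in simp)
  then show ?thesis using Q.M.minus_equality[of p "\<ominus>\<^bsub>Q\<^esub> q"] q by simp
qed

end

section \<open>Transport of structure, and maximality freed from the choice of a type\<close>

definition image_system :: "('b \<Rightarrow> 'c) \<Rightarrow> ('a, 'b, 'n) triple_system_scheme \<Rightarrow> ('a, 'c) triple_system"
  where "image_system h T = (let g = the_inv_into (carrier T) h in
    \<lparr>carrier = h ` carrier T, monoid.mult = undefined, one = undefined, ring.zero = h \<zero>\<^bsub>T\<^esub>,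
     ring.add = (\<lambda>x y. h (g x \<oplus>\<^bsub>T\<^esub> g y)), module.smult = (\<lambda>c x. h (c \<odot>\<^bsub>T\<^esub> g x)),
     triple = (\<lambda>x y z. h \<lblot>g x,g y,g z\<rblot>\<^bsub>T\<^esub>)\<rparr>)"

lemma image_system_embedding:
  assumes "triple_lie_system K T" "inj_on h (carrier T)"
  shows "triple_embedding K T (image_system h T) h"
    and "triple_embedding K (image_system h T) T (the_inv_into (carrier T) h)"
proof -
  interpret T: triple_lie_system K T by fact
  have inv: "the_inv_into (carrier T) h (h x) = x" if "x \<in> carrier T" for x
    using the_inv_into_f_f[OF assms(2) that] .
  have l: "triple_lie_system K (image_system h T)"
    by (rule triple_lie_image[OF assms(1), of _ h]) (auto simp: image_system_def Let_def inv)
  show "triple_embedding K T (image_system h T) h"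
    using l assms by (auto simp: triple_embedding_def image_system_def Let_def inv)
  show "triple_embedding K (image_system h T) T (the_inv_into (carrier T) h)"
    using l assms by (auto simp: triple_embedding_def image_system_def Let_def inv inj_on_def)
qed

lemma triple_embedding_comp:
  assumes "triple_embedding K T Q f" "triple_embedding K Q Q' g"
  shows "triple_embedding K T Q' (g \<circ> f)"
proof -
  interpret f: embedded_system K T Q f by (rule embedded_systemI) fact
  interpret g: embedded_system K Q Q' g by (rule embedded_systemI) fact
  show ?thesis
    using f.T.triple_lie_system_axioms g.Q.triple_lie_system_axioms by (auto simp: triple_embedding_def inj_on_def)
qed

lemma quotient_system_isomorphic:
  assumes "quotient_system K T Q i" "triple_embedding K Q Q' h" "h ` carrier Q = carrier Q'"
  shows "quotient_system K T Q' (h \<circ> i)"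
proof -
  interpret i: quotient_embedding K T Q i by (rule quotient_embeddingI) fact
  interpret h: embedded_system K Q Q' h by (rule embedded_systemI) fact
  interpret hi: embedded_system K T Q' "h \<circ> i"
    by (rule embedded_systemI) (rule triple_embedding_comp[OF i.embedding h.embedding])
  show ?thesis unfolding hi.quotient_system_iff
  proof (intro ballI impI)
    fix q assume "q \<in> carrier Q'" "q \<noteq> \<zero>\<^bsub>Q'\<^esub>"
    then obtain p where p: "p \<in> carrier Q" "q = h p" "p \<noteq> \<zero>\<^bsub>Q\<^esub>"
      using assms(3) h.emb_zero by (metis imageE)
    obtain I where I: "i.denom p I" "\<not> kills T Q i p I" by (rule i.quotient_ideal[OF p(1,3)])
    note c = i.denomD(5)[OF I(1)]
    have q: "\<lblot>q,(h \<circ> i) x,(h \<circ> i) y\<rblot>\<^bsub>Q'\<^esub> = h \<lblot>p,i x,i y\<rblot>\<^bsub>Q\<^esub>" if "x \<in> carrier T" "y \<in> carrier T" for x y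
      using that p by simp
    have q0: "h u = \<zero>\<^bsub>Q'\<^esub> \<longleftrightarrow> u = \<zero>\<^bsub>Q\<^esub>" if "u \<in> carrier Q" for u
      using h.emb_eq_iff[OF that i.Q.M.zero_closed] by simp
    have "hi.denom q I"
      unfolding denominator_ideal_def
    proof (intro conjI ballI i.denomD(1,2)[OF I(1)])
      fix a y assume "a \<in> I" "y \<in> carrier T"
      then show "\<lblot>q,(h \<circ> i) a,(h \<circ> i) y\<rblot>\<^bsub>Q'\<^esub> \<in> (h \<circ> i) ` carrier T"
        "\<lblot>q,(h \<circ> i) y,(h \<circ> i) a\<rblot>\<^bsub>Q'\<^esub> \<in> (h \<circ> i) ` carrier T"
        using i.denomD(3,4)[OF I(1)] c[of a] unfolding image_comp[symmetric] by (simp_all only: q) blast+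
    qed
    moreover have "\<not> kills T Q' (h \<circ> i) q I"
    proof
      assume "kills T Q' (h \<circ> i) q I"
      then have "kills T Q i p I"
        using c p(1) q0 unfolding kills_def by (simp del: o_apply h.emb_triple add: q)
      then show False using I(2) by simp
    qed
    ultimately show "\<exists>I. hi.denom q I \<and> \<not> kills T Q' (h \<circ> i) q I" by blast
  qed
qed

text \<open>Maximality is tested only on systems carried by one particular type, so \<open>Q\<close>
  is copied there by sending q to a denominator ideal together with the products of q on it. The
  copy is faithful because no nonzero element is killed by an ideal with zero annihilator.\<close>

lemma maximal_quotient_system_embeds:
  fixes Q :: "('a, 'c, 'p) triple_system_scheme" and T :: "('a, 'b, 'n) triple_system_scheme"
  assumes max: "maximal_quotient_system K T Qm im" and "quotient_system K T Q i"
  shows "\<exists>f. triple_embedding K Q Qm f \<and> (\<forall>x\<in>carrier T. f (i x) = im x)"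
proof -
  interpret quotient_embedding K T Q i by (rule quotient_embeddingI) fact
  \<comment> \<open>The definition of a system of quotients supplies ideals for nonzero elements
    only. Zero is coded by the empty set, which is no ideal, so it cannot share its code with
    another element.\<close>
  define J where "J q = (if q = \<zero>\<^bsub>Q\<^esub> then {} else SOME I. denom q I)" for q
  define g where "g = the_inv_into (carrier T) i"
  define h where "h q = (J q, \<lambda>a y. if a \<in> J q \<and> y \<in> carrier T then g \<lblot>q,i a,i y\<rblot>\<^bsub>Q\<^esub> else undefined,
    \<lambda>a y. if a \<in> J q \<and> y \<in> carrier T then g \<lblot>q,i y,i a\<rblot>\<^bsub>Q\<^esub> else undefined)" for q
  have J: "denom q (J q)" if "q \<in> carrier Q" "q \<noteq> \<zero>\<^bsub>Q\<^esub>" for q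
  proof -
    have "\<exists>I. denom q I" by (rule quotient_ideal[OF that]) blast
    then show ?thesis using that by (simp add: J_def someI_ex)
  qed
  have J0: "q = \<zero>\<^bsub>Q\<^esub> \<longleftrightarrow> J q = {}" if "q \<in> carrier Q" for q
  proof -
    have "\<not> denom q {}" using T.triple_ideal_mem(1) by (auto simp: denominator_ideal_def)
    then show ?thesis using J[OF that] by (metis J_def)
  qed
  have ig: "i (g u) = u" if "u \<in> i ` carrier T" for u
    unfolding g_def by (rule f_the_inv_into_f) (use that in \<open>auto simp: inj_on_def\<close>)
  have inj: "inj_on h (carrier Q)"
  proof (rule inj_onI)
    fix p q assume p: "p \<in> carrier Q" and q: "q \<in> carrier Q" and eq: "h p = h q"
    have Jeq: "J p = J q" using eq by (simp add: h_def)
    show "p = q"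
    proof (cases "p = \<zero>\<^bsub>Q\<^esub>")
      case True
      then show ?thesis using Jeq J0[OF p] J0[OF q] by simp
    next
      case False
      then have "q \<noteq> \<zero>\<^bsub>Q\<^esub>" using Jeq J0[OF p] J0[OF q] by simp
      note good = denomD[OF J[OF p False]] denomD[OF J[OF q this]]
      have "\<lblot>p,i a,i y\<rblot>\<^bsub>Q\<^esub> = \<lblot>q,i a,i y\<rblot>\<^bsub>Q\<^esub> \<and> \<lblot>p,i y,i a\<rblot>\<^bsub>Q\<^esub> = \<lblot>q,i y,i a\<rblot>\<^bsub>Q\<^esub>"
        if "a \<in> J p" "y \<in> carrier T" for a y
      proof -
        have "fst (snd (h p)) a y = fst (snd (h q)) a y" "snd (snd (h p)) a y = snd (snd (h q)) a y"
          using eq by simp_all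
        then have "g \<lblot>p,i a,i y\<rblot>\<^bsub>Q\<^esub> = g \<lblot>q,i a,i y\<rblot>\<^bsub>Q\<^esub>" "g \<lblot>p,i y,i a\<rblot>\<^bsub>Q\<^esub> = g \<lblot>q,i y,i a\<rblot>\<^bsub>Q\<^esub>"
          using that Jeq by (auto simp: h_def)
        then show ?thesis using ig good that Jeq by metis
      qed
      then show ?thesis using quotient_eqI[OF good(1,2) p q] by blast
    qed
  qed
  define Q' where "Q' = image_system h Q"
  note emb = image_system_embedding[OF Q.triple_lie_system_axioms inj, folded Q'_def]
  have "quotient_system K T Q' (h \<circ> i)"
    by (rule quotient_system_isomorphic[OF quotient emb(1)]) (simp add: Q'_def image_system_def Let_def)
  then obtain f where f: "triple_embedding K Q' Qm f" "\<forall>x\<in>carrier T. f ((h \<circ> i) x) = im x"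
    using max unfolding maximal_quotient_system_def by blast
  then show ?thesis using triple_embedding_comp[OF emb(1) f(1)] by (intro exI[of _ "f \<circ> h"]) auto
qed

section \<open>Right modules\<close>

context right_module
begin

lemma act_zero_ring [simp]: "x \<in> carrier M \<Longrightarrow> \<zero>\<^bsub>S\<^esub> \<odot> x = \<zero>"
  using act_l_distr[of "\<zero>\<^bsub>S\<^esub>" "\<zero>\<^bsub>S\<^esub>" x] act_closed[of "\<zero>\<^bsub>S\<^esub>" x]
  by (metis M.add.r_cancel_one' S.l_zero S.zero_closed)

lemma act_zero [simp]: "a \<in> carrier S \<Longrightarrow> a \<odot> \<zero> = \<zero>"
  using act_r_distr[of a \<zero> \<zero>] act_closed[of a \<zero>] by (metis M.add.r_cancel_one' M.l_zero M.zero_closed)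

lemma act_minus: "\<lbrakk>a \<in> carrier S; x \<in> carrier M\<rbrakk> \<Longrightarrow> a \<odot> \<ominus> x = \<ominus> (a \<odot> x)"
  using act_r_distr[of a "\<ominus> x" x] M.minus_equality[of "a \<odot> \<ominus> x" "a \<odot> x"] act_closed
  by (simp add: M.l_neg)

lemma submoduleI:
  assumes "A \<subseteq> carrier M" "\<zero> \<in> A" "\<And>x y. \<lbrakk>x \<in> A; y \<in> A\<rbrakk> \<Longrightarrow> x \<oplus> y \<in> A"
    and act: "\<And>a x. \<lbrakk>a \<in> carrier S; x \<in> A\<rbrakk> \<Longrightarrow> a \<odot> x \<in> A"
  shows "submodule A S M"
proof -
  have "\<ominus> x \<in> A" if "x \<in> A" for x
  proof -
    have x: "x \<in> carrier M" using that assms(1) by blast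
    have "(\<ominus>\<^bsub>S\<^esub> \<one>\<^bsub>S\<^esub>) \<odot> x \<oplus> x = \<zero>"
      using act_l_distr[of "\<ominus>\<^bsub>S\<^esub> \<one>\<^bsub>S\<^esub>" "\<one>\<^bsub>S\<^esub>" x] x by (simp add: act_one S.l_neg)
    then have "\<ominus> x = (\<ominus>\<^bsub>S\<^esub> \<one>\<^bsub>S\<^esub>) \<odot> x" using M.minus_equality act_closed x by auto
    then show ?thesis using act[of "\<ominus>\<^bsub>S\<^esub> \<one>\<^bsub>S\<^esub>" x] that by simp
  qed
  then show ?thesis
    using assms by (auto intro!: submodule.intro M.add.subgroupI submodule_axioms.intro simp: a_inv_def)
qed

lemma submoduleD:
  assumes "submodule A S M"
  shows "x \<in> A \<Longrightarrow> x \<in> carrier M" "\<zero> \<in> A" "\<lbrakk>x \<in> A; y \<in> A\<rbrakk> \<Longrightarrow> x \<oplus> y \<in> A" "x \<in> A \<Longrightarrow> \<ominus> x \<in> A"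
    "\<lbrakk>a \<in> carrier S; x \<in> A\<rbrakk> \<Longrightarrow> a \<odot> x \<in> A"
  using subgroup.subset[OF submodule.axioms(1)[OF assms]] subgroup.one_closed[OF submodule.axioms(1)[OF assms]]
    subgroup.m_closed[OF submodule.axioms(1)[OF assms]] subgroup.m_inv_closed[OF submodule.axioms(1)[OF assms]]
    submodule.smult_closed[OF assms]
  by (auto simp: a_inv_def)

lemma right_module_submodule:
  assumes "submodule A S M"
  shows "right_module S (M\<lparr>carrier := A\<rparr>)"
proof -
  note A = submoduleD[OF assms]
  have "abelian_group (M\<lparr>carrier := A\<rparr>)"
  proof (rule abelian_groupI)
    show "\<exists>y\<in>carrier (M\<lparr>carrier := A\<rparr>). y \<oplus>\<^bsub>M\<lparr>carrier := A\<rparr>\<^esub> x = \<zero>\<^bsub>M\<lparr>carrier := A\<rparr>\<^esub>"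
      if "x \<in> carrier (M\<lparr>carrier := A\<rparr>)" for x
      using that A by (intro bexI[of _ "\<ominus> x"]) (auto simp: M.l_neg)
  qed (use A in \<open>auto simp: M.a_ac\<close>)
  then show ?thesis
    by (intro right_module.intro right_module_axioms.intro S.ring_axioms)
      (use A in \<open>auto simp: act_l_distr act_r_distr act_assoc act_one\<close>)
qed

lemma rmod_hom_zero:
  assumes "f \<in> rmod_hom S M N" "abelian_group N"
  shows "f \<zero> = \<zero>\<^bsub>N\<^esub>"
proof -
  interpret N: abelian_group N by fact
  have "f \<zero> \<oplus>\<^bsub>N\<^esub> f \<zero> = f \<zero>" "f \<zero> \<in> carrier N"
    using assms(1) unfolding rmod_hom_def by (force simp: Pi_iff)+
  then show ?thesis by (metis N.add.r_cancel_one')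
qed

lemma rmod_End_ring: "ring (rmod_End S M)"
proof -
  have c: "carrier (rmod_End S M) = rmod_hom S M M \<inter> extensional (carrier M)" by (simp add: rmod_End_def)
  have neg: "(\<lambda>x\<in>carrier M. \<ominus> f x) \<in> carrier (rmod_End S M)" if "f \<in> carrier (rmod_End S M)" for f
    using that unfolding c rmod_hom_def by (auto simp: Pi_iff M.minus_add act_closed act_minus)
  have "abelian_group (rmod_End S M)"
  proof (rule abelian_groupI)
    fix f assume f: "f \<in> carrier (rmod_End S M)"
    then show "\<exists>g\<in>carrier (rmod_End S M). g \<oplus>\<^bsub>rmod_End S M\<^esub> f = \<zero>\<^bsub>rmod_End S M\<^esub>"
      using neg[OF f] by (intro bexI[of _ "\<lambda>x\<in>carrier M. \<ominus> f x"])
        (auto simp: rmod_End_def rmod_hom_def fun_eq_iff restrict_def Pi_iff M.l_neg)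
    show "\<zero>\<^bsub>rmod_End S M\<^esub> \<oplus>\<^bsub>rmod_End S M\<^esub> f = f"
      using f by (auto simp: rmod_End_def rmod_hom_def fun_eq_iff restrict_def Pi_iff extensional_def)
  next
    fix f g assume "f \<in> carrier (rmod_End S M)" "g \<in> carrier (rmod_End S M)"
    then show "f \<oplus>\<^bsub>rmod_End S M\<^esub> g \<in> carrier (rmod_End S M)" "f \<oplus>\<^bsub>rmod_End S M\<^esub> g = g \<oplus>\<^bsub>rmod_End S M\<^esub> f"
      by (auto simp: rmod_End_def rmod_hom_def fun_eq_iff restrict_def Pi_iff extensional_def M.a_ac act_r_distr act_closed)
  qed (auto simp: rmod_End_def rmod_hom_def fun_eq_iff restrict_def Pi_iff extensional_def M.a_assoc act_closed)
  moreover have "monoid (rmod_End S M)"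
    by (rule monoidI)
      (auto simp: rmod_End_def rmod_hom_def compose_def fun_eq_iff restrict_def Pi_iff extensional_def act_closed)
  ultimately show ?thesis
    by (rule ringI)
      (auto simp: rmod_End_def rmod_hom_def compose_def fun_eq_iff restrict_def Pi_iff)
qed

text \<open>The test modules of \<^const>\<open>injective_rmod\<close> live on a sum type, so \<open>M\<close> is copied there.\<close>

lemma injective_extend:
  assumes inj: "injective_rmod S M" and A: "submodule A S M" and f: "f \<in> rmod_hom S (M\<lparr>carrier := A\<rparr>) M"
  obtains g where "g \<in> rmod_hom S M M" "\<And>x. x \<in> A \<Longrightarrow> g x = f x"
proof -
  define B :: "('s, 's + 'b) module" where
    "B = \<lparr>carrier = Inr ` carrier M, monoid.mult = undefined, one = undefined, ring.zero = Inr \<zero>,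
      ring.add = (\<lambda>x y. Inr (projr x \<oplus> projr y)), module.smult = (\<lambda>a x. Inr (a \<odot> projr x))\<rparr>"
  note sub = submoduleD[OF A]
  have "abelian_group B"
  proof (rule abelian_groupI)
    fix x assume "x \<in> carrier B"
    then show "\<exists>y\<in>carrier B. y \<oplus>\<^bsub>B\<^esub> x = \<zero>\<^bsub>B\<^esub>"
      by (intro bexI[of _ "Inr (\<ominus> (projr x))"]) (auto simp: B_def M.l_neg)
  qed (auto simp: B_def M.a_ac)
  then have B: "right_module S B"
    by (intro right_module.intro right_module_axioms.intro S.ring_axioms)
      (auto simp: B_def act_l_distr act_r_distr act_assoc act_one act_closed)
  then interpret B: right_module S B .
  have "submodule (Inr ` A) S B" by (rule B.submoduleI) (use sub in \<open>auto simp: B_def\<close>)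
  moreover have "f \<circ> projr \<in> rmod_hom S (B\<lparr>carrier := Inr ` A\<rparr>) M"
    using f by (auto simp: rmod_hom_def B_def)
  ultimately obtain g where g: "g \<in> rmod_hom S B M" "\<forall>x\<in>Inr ` A. g x = (f \<circ> projr) x"
    using inj B unfolding injective_rmod_def by blast
  show thesis
  proof (rule that[of "g \<circ> Inr"])
    show "g \<circ> Inr \<in> rmod_hom S M M" using g(1) by (auto simp: rmod_hom_def B_def)
  qed (use g(2) in auto)
qed

end

section \<open>The multiplication ring\<close>

context triple_lie_system
begin

lemma lin_End_group: "group (add_monoid (lin_End K T))"
proof (rule groupI)
  fix f assume f: "f \<in> carrier (add_monoid (lin_End K T))"
  then show "\<exists>g\<in>carrier (add_monoid (lin_End K T)).
      g \<otimes>\<^bsub>add_monoid (lin_End K T)\<^esub> f = \<one>\<^bsub>add_monoid (lin_End K T)\<^esub>"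
    by (intro bexI[of _ "\<lambda>x\<in>carrier T. \<ominus> f x"])
      (auto simp: lin_End_def Pi_iff fun_eq_iff M.l_neg M.minus_add smult_r_minus)
  show "\<one>\<^bsub>add_monoid (lin_End K T)\<^esub> \<otimes>\<^bsub>add_monoid (lin_End K T)\<^esub> f = f"
    using f by (auto simp: lin_End_def fun_eq_iff Pi_iff extensional_def)
qed (auto simp: lin_End_def Pi_iff fun_eq_iff M.a_ac smult_r_distr)

lemma scalar_op_lin_End: "c \<in> carrier K \<Longrightarrow> scalar_op T c \<in> carrier (lin_End K T)"
  using smult_assoc1 R.m_comm by (auto simp: scalar_op_def lin_End_def smult_r_distr) metis

lemma mult_op_lin_End:
  assumes "x \<in> carrier T" "y \<in> carrier T"
  shows "mult_op1 T x y \<in> carrier (lin_End K T)" "mult_op2 T x y \<in> carrier (lin_End K T)"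
    "mult_op3 T x y \<in> carrier (lin_End K T)"
  using assms
  by (auto simp: mult_op1_def mult_op2_def mult_op3_def lin_End_def triple_add triple_smult)

lemma lin_End_mult:
  "\<lbrakk>f \<in> carrier (lin_End K T); g \<in> carrier (lin_End K T)\<rbrakk> \<Longrightarrow> f \<otimes>\<^bsub>lin_End K T\<^esub> g \<in> carrier (lin_End K T)"
  by (auto simp: lin_End_def compose_def Pi_iff)

lemma mult_algebra_closed:
  shows "subgroup (mult_algebra K T) (add_monoid (lin_End K T))"
    and "\<lbrakk>c \<in> carrier K; f \<in> mult_algebra K T\<rbrakk> \<Longrightarrow> scalar_op T c \<otimes>\<^bsub>lin_End K T\<^esub> f \<in> mult_algebra K T"
    and "\<lbrakk>f \<in> mult_algebra K T; g \<in> mult_algebra K T\<rbrakk> \<Longrightarrow> f \<otimes>\<^bsub>lin_End K T\<^esub> g \<in> mult_algebra K T"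
    and "\<lbrakk>x \<in> carrier T; y \<in> carrier T\<rbrakk> \<Longrightarrow>
      mult_op1 T x y \<in> mult_algebra K T \<and> mult_op2 T x y \<in> mult_algebra K T \<and> mult_op3 T x y \<in> mult_algebra K T"
proof -
  let ?F = "{V. subgroup V (add_monoid (lin_End K T)) \<and>
    (\<forall>c\<in>carrier K. \<forall>f\<in>V. scalar_op T c \<otimes>\<^bsub>lin_End K T\<^esub> f \<in> V) \<and>
    (\<forall>f\<in>V. \<forall>g\<in>V. f \<otimes>\<^bsub>lin_End K T\<^esub> g \<in> V) \<and>
    (\<forall>x\<in>carrier T. \<forall>y\<in>carrier T. mult_op1 T x y \<in> V \<and> mult_op2 T x y \<in> V \<and> mult_op3 T x y \<in> V)}"
  \<comment> \<open>The intersection defining M(T) runs over a nonempty family, since all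
    endomorphisms form such a subalgebra.\<close>
  have "carrier (lin_End K T) \<in> ?F"
    using group.subgroup_self[OF lin_End_group] scalar_op_lin_End mult_op_lin_End lin_End_mult by simp
  then have "?F \<noteq> {}" by blast
  then show "subgroup (mult_algebra K T) (add_monoid (lin_End K T))"
    unfolding mult_algebra_def by (intro group.subgroups_Inter[OF lin_End_group]) auto
qed (unfold mult_algebra_def, blast+)

lemma mult_algebra_subset: "mult_algebra K T \<subseteq> carrier (lin_End K T)"
  using subgroup.subset[OF mult_algebra_closed(1)] by simp

lemma mult_ring_simps [simp]:
  shows "f \<oplus>\<^bsub>mult_ring K T\<^esub> g = f \<oplus>\<^bsub>lin_End K T\<^esub> g"
    and "f \<otimes>\<^bsub>mult_ring K T\<^esub> g = f \<otimes>\<^bsub>lin_End K T\<^esub> g"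
    and "\<zero>\<^bsub>mult_ring K T\<^esub> = \<zero>\<^bsub>lin_End K T\<^esub>"
    and "\<one>\<^bsub>mult_ring K T\<^esub> = \<one>\<^bsub>lin_End K T\<^esub>"
  by (simp_all add: mult_ring_def)

lemma scalar_op_zero: "scalar_op T \<zero>\<^bsub>K\<^esub> = \<zero>\<^bsub>lin_End K T\<^esub>"
  by (auto simp: scalar_op_def lin_End_def fun_eq_iff)

lemma mult_algebra_mult_ring: "f \<in> mult_algebra K T \<Longrightarrow> f \<in> carrier (mult_ring K T)"
proof -
  assume f: "f \<in> mult_algebra K T"
  then have "f = scalar_op T \<zero>\<^bsub>K\<^esub> \<oplus>\<^bsub>lin_End K T\<^esub> f"
    using mult_algebra_subset monoid.l_one[OF group.is_monoid[OF lin_End_group], of f]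
    by (auto simp: scalar_op_zero)
  then show ?thesis using f unfolding mult_ring_def by (auto simp: set_add_def')
qed

lemma scalar_op_mult_ring: "c \<in> carrier K \<Longrightarrow> scalar_op T c \<in> carrier (mult_ring K T)"
proof -
  assume c: "c \<in> carrier K"
  have "\<zero>\<^bsub>lin_End K T\<^esub> \<in> mult_algebra K T" using subgroup.one_closed[OF mult_algebra_closed(1)] by simp
  moreover have "scalar_op T c = scalar_op T c \<oplus>\<^bsub>lin_End K T\<^esub> \<zero>\<^bsub>lin_End K T\<^esub>"
    using monoid.r_one[OF group.is_monoid[OF lin_End_group], of "scalar_op T c"] scalar_op_lin_End[OF c] by simp
  ultimately show ?thesis using c unfolding mult_ring_def by (auto simp: set_add_def')
qed

lemma mult_op_mult_ring:
  assumes "x \<in> carrier T" "y \<in> carrier T"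
  shows "mult_op1 T x y \<in> carrier (mult_ring K T)" "mult_op2 T x y \<in> carrier (mult_ring K T)"
    "mult_op3 T x y \<in> carrier (mult_ring K T)"
  using mult_algebra_closed(4)[OF assms] mult_algebra_mult_ring by auto

text \<open>The elements of M(T) with the property form one of the subalgebras intersected in the
  definition. Zero, negatives and scalar multiples need no case of their own: they arise from scalar
  operators and products with these.\<close>

lemma mult_ring_induct [consumes 1, case_names scalar op1 op2 op3 add mult]:
  assumes m: "m \<in> carrier (mult_ring K T)"
    and scalar: "\<And>c. c \<in> carrier K \<Longrightarrow> Pr (scalar_op T c)"
    and ops: "\<And>x y. \<lbrakk>x \<in> carrier T; y \<in> carrier T\<rbrakk> \<Longrightarrow> Pr (mult_op1 T x y)"
      "\<And>x y. \<lbrakk>x \<in> carrier T; y \<in> carrier T\<rbrakk> \<Longrightarrow> Pr (mult_op2 T x y)"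
      "\<And>x y. \<lbrakk>x \<in> carrier T; y \<in> carrier T\<rbrakk> \<Longrightarrow> Pr (mult_op3 T x y)"
    and add: "\<And>f g. \<lbrakk>f \<in> carrier (mult_ring K T); g \<in> carrier (mult_ring K T); Pr f; Pr g\<rbrakk> \<Longrightarrow>
      Pr (f \<oplus>\<^bsub>mult_ring K T\<^esub> g)"
    and mult: "\<And>f g. \<lbrakk>f \<in> carrier (mult_ring K T); g \<in> carrier (mult_ring K T); Pr f; Pr g\<rbrakk> \<Longrightarrow>
      Pr (f \<otimes>\<^bsub>mult_ring K T\<^esub> g)"
  shows "Pr m"
proof -
  define V where "V = {f \<in> mult_algebra K T. Pr f}"
  note A = mult_algebra_closed
  have VS: "f \<in> carrier (mult_ring K T)" "f \<in> mult_algebra K T" "Pr f" "f \<in> carrier (lin_End K T)" if "f \<in> V" for f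
    using that mult_algebra_mult_ring mult_algebra_subset by (auto simp: V_def)
  have sm: "scalar_op T c \<otimes>\<^bsub>lin_End K T\<^esub> f \<in> V" if "c \<in> carrier K" "f \<in> V" for c f
    using that(1) VS(1-3)[OF that(2)] A(2)[of c f] mult[of "scalar_op T c" f] scalar[of c] scalar_op_mult_ring[of c]
    by (simp add: V_def)
  have "subgroup V (add_monoid (lin_End K T))"
  proof (rule group.subgroupI[OF lin_End_group])
    show "V \<subseteq> carrier (add_monoid (lin_End K T))" using VS(4) by (simp add: subset_iff)
    have "\<zero>\<^bsub>lin_End K T\<^esub> \<in> mult_algebra K T" using subgroup.one_closed[OF A(1)] by simp
    then have "\<zero>\<^bsub>lin_End K T\<^esub> \<in> V" using scalar[of "\<zero>\<^bsub>K\<^esub>"] by (simp add: V_def scalar_op_zero)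
    then show "V \<noteq> {}" by blast
    fix f assume f: "f \<in> V"
    have fl: "f \<in> carrier (lin_End K T)" using VS(4) f .
    have "inv\<^bsub>add_monoid (lin_End K T)\<^esub> f = scalar_op T (\<ominus>\<^bsub>K\<^esub> \<one>\<^bsub>K\<^esub>) \<otimes>\<^bsub>lin_End K T\<^esub> f"
    proof (rule group.inv_equality[OF lin_End_group])
      show "scalar_op T (\<ominus>\<^bsub>K\<^esub> \<one>\<^bsub>K\<^esub>) \<otimes>\<^bsub>lin_End K T\<^esub> f \<otimes>\<^bsub>add_monoid (lin_End K T)\<^esub> f =
          \<one>\<^bsub>add_monoid (lin_End K T)\<^esub>"
      proof -
        have "(\<ominus>\<^bsub>K\<^esub> \<one>\<^bsub>K\<^esub>) \<odot> x \<oplus> x = \<zero>" if "x \<in> carrier T" for x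
          using that by (simp add: smult_l_minus M.l_neg)
        then show ?thesis
          using fl by (auto simp: lin_End_def scalar_op_def compose_def fun_eq_iff Pi_iff)
      qed
      show "scalar_op T (\<ominus>\<^bsub>K\<^esub> \<one>\<^bsub>K\<^esub>) \<otimes>\<^bsub>lin_End K T\<^esub> f \<in> carrier (add_monoid (lin_End K T))"
        using lin_End_mult scalar_op_lin_End fl by simp
    qed (use fl in simp)
    then show "inv\<^bsub>add_monoid (lin_End K T)\<^esub> f \<in> V" using sm f by simp
    fix g assume g: "g \<in> V"
    show "f \<otimes>\<^bsub>add_monoid (lin_End K T)\<^esub> g \<in> V"
      using subgroup.m_closed[OF A(1), of f g] add[of f g] VS(1-3)[OF f] VS(1-3)[OF g] by (simp add: V_def)
  qed
  then have "V \<in> {V. subgroup V (add_monoid (lin_End K T)) \<and>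
    (\<forall>c\<in>carrier K. \<forall>f\<in>V. scalar_op T c \<otimes>\<^bsub>lin_End K T\<^esub> f \<in> V) \<and>
    (\<forall>f\<in>V. \<forall>g\<in>V. f \<otimes>\<^bsub>lin_End K T\<^esub> g \<in> V) \<and>
    (\<forall>x\<in>carrier T. \<forall>y\<in>carrier T. mult_op1 T x y \<in> V \<and> mult_op2 T x y \<in> V \<and> mult_op3 T x y \<in> V)}"
  proof (intro CollectI conjI ballI)
    fix f g assume "f \<in> V" "g \<in> V"
    then show "f \<otimes>\<^bsub>lin_End K T\<^esub> g \<in> V"
      using A(3)[OF VS(2,2)] mult[OF VS(1,1) VS(3,3), simplified] unfolding V_def by blast
  qed (use sm A(4) ops in \<open>simp_all add: V_def\<close>)
  then have AV: "mult_algebra K T \<subseteq> V" unfolding mult_algebra_def by blast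
  obtain c f where "c \<in> carrier K" "f \<in> mult_algebra K T" "m = scalar_op T c \<oplus>\<^bsub>mult_ring K T\<^esub> f"
    using m unfolding mult_ring_def set_add_def' by (simp, blast)
  moreover from this have "f \<in> V" using AV by blast
  ultimately show ?thesis
    using add[OF scalar_op_mult_ring VS(1) scalar VS(3)] by simp
qed

lemma mult_ring_lin:
  assumes "m \<in> carrier (mult_ring K T)"
  shows "m \<in> carrier (lin_End K T)"
  using assms
proof (induction rule: mult_ring_induct)
  case (add f g)
  then show ?case using group.is_monoid[OF lin_End_group, THEN monoid.m_closed, of f g] by simp
qed (auto simp: scalar_op_lin_End mult_op_lin_End lin_End_mult)

end

section \<open>Modules over the multiplication ring\<close>

locale mult_module = triple_lie_system K T + X: right_module "mult_ring K T" X
  for K :: "('a, 'm) ring_scheme" and T :: "('a, 'b, 'n) triple_system_scheme" (structure)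
    and X :: "('b \<Rightarrow> 'b, 'c, 'p) module_scheme"
begin

lemma scalar_module_module: "module K (scalar_module T X)"
proof (rule moduleI)
  show "abelian_group (scalar_module T X)"
  proof (rule abelian_groupI)
    show "\<exists>y\<in>carrier (scalar_module T X). y \<oplus>\<^bsub>scalar_module T X\<^esub> x = \<zero>\<^bsub>scalar_module T X\<^esub>"
      if "x \<in> carrier (scalar_module T X)" for x
      using that by (intro bexI[of _ "\<ominus>\<^bsub>X\<^esub> x"]) (auto simp: scalar_module_def X.M.l_neg)
  qed (auto simp: scalar_module_def X.M.a_ac)
  fix c d x assume c: "c \<in> carrier K" "d \<in> carrier K" and x: "x \<in> carrier (scalar_module T X)"
  have "scalar_op T (c \<oplus>\<^bsub>K\<^esub> d) = scalar_op T c \<oplus>\<^bsub>mult_ring K T\<^esub> scalar_op T d"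
    using c by (auto simp: scalar_op_def lin_End_def smult_l_distr fun_eq_iff)
  then show "(c \<oplus>\<^bsub>K\<^esub> d) \<odot>\<^bsub>scalar_module T X\<^esub> x =
      c \<odot>\<^bsub>scalar_module T X\<^esub> x \<oplus>\<^bsub>scalar_module T X\<^esub> d \<odot>\<^bsub>scalar_module T X\<^esub> x"
    using X.act_l_distr[of "scalar_op T c" "scalar_op T d"] c x scalar_op_mult_ring
    by (simp add: scalar_module_def)
  \<comment> \<open>Operators act on the right, so the factor written first is applied first and the
    order of the scalars is reversed.\<close>
  have "scalar_op T (c \<otimes>\<^bsub>K\<^esub> d) = scalar_op T d \<otimes>\<^bsub>mult_ring K T\<^esub> scalar_op T c"
    using c by (auto simp: scalar_op_def lin_End_def smult_assoc1 fun_eq_iff compose_def)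
  then show "(c \<otimes>\<^bsub>K\<^esub> d) \<odot>\<^bsub>scalar_module T X\<^esub> x = c \<odot>\<^bsub>scalar_module T X\<^esub> (d \<odot>\<^bsub>scalar_module T X\<^esub> x)"
    using X.act_assoc[of "scalar_op T d" "scalar_op T c"] c x scalar_op_mult_ring
    by (simp add: scalar_module_def)
next
  fix x assume x: "x \<in> carrier (scalar_module T X)"
  have "scalar_op T \<one>\<^bsub>K\<^esub> = \<one>\<^bsub>mult_ring K T\<^esub>" by (auto simp: scalar_op_def lin_End_def fun_eq_iff)
  then show "\<one>\<^bsub>K\<^esub> \<odot>\<^bsub>scalar_module T X\<^esub> x = x" using X.act_one x by (simp add: scalar_module_def)
qed (auto simp: scalar_module_def R.cring_axioms X.act_closed X.act_r_distr scalar_op_mult_ring)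

text \<open>Operators in M(T)' are \<open>K\<close>-linear, so the scalar operators are central in
  M(T)'.\<close>

lemma act_scalar_swap:
  assumes m: "m \<in> carrier (mult_ring K T)" and c: "c \<in> carrier K" and x: "x \<in> carrier X"
  shows "m \<odot>\<^bsub>X\<^esub> (scalar_op T c \<odot>\<^bsub>X\<^esub> x) = scalar_op T c \<odot>\<^bsub>X\<^esub> (m \<odot>\<^bsub>X\<^esub> x)"
proof -
  note s = scalar_op_mult_ring[OF c]
  have "scalar_op T c \<otimes>\<^bsub>mult_ring K T\<^esub> m = m \<otimes>\<^bsub>mult_ring K T\<^esub> scalar_op T c"
    using mult_ring_lin[OF m] c by (auto simp: lin_End_def scalar_op_def compose_def fun_eq_iff)
  then show ?thesis using X.act_assoc[OF s m x] X.act_assoc[OF m s x] by simp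
qed

lemma submodule_multI:
  assumes "A \<subseteq> carrier X" "\<zero>\<^bsub>X\<^esub> \<in> A" "\<And>x y. \<lbrakk>x \<in> A; y \<in> A\<rbrakk> \<Longrightarrow> x \<oplus>\<^bsub>X\<^esub> y \<in> A"
    and "\<And>c x. \<lbrakk>c \<in> carrier K; x \<in> A\<rbrakk> \<Longrightarrow> scalar_op T c \<odot>\<^bsub>X\<^esub> x \<in> A"
    and "\<And>y z x. \<lbrakk>y \<in> carrier T; z \<in> carrier T; x \<in> A\<rbrakk> \<Longrightarrow> mult_op1 T y z \<odot>\<^bsub>X\<^esub> x \<in> A"
    and "\<And>y z x. \<lbrakk>y \<in> carrier T; z \<in> carrier T; x \<in> A\<rbrakk> \<Longrightarrow> mult_op2 T y z \<odot>\<^bsub>X\<^esub> x \<in> A"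
    and "\<And>y z x. \<lbrakk>y \<in> carrier T; z \<in> carrier T; x \<in> A\<rbrakk> \<Longrightarrow> mult_op3 T y z \<odot>\<^bsub>X\<^esub> x \<in> A"
  shows "submodule A (mult_ring K T) X"
proof (rule X.submoduleI[OF assms(1-3)])
  fix m x assume "m \<in> carrier (mult_ring K T)" "x \<in> A"
  then show "m \<odot>\<^bsub>X\<^esub> x \<in> A"
  proof (induction arbitrary: x rule: mult_ring_induct)
    case (add f g)
    then show ?case using X.act_l_distr[of f g x] assms(1,3) by auto
  next
    case (mult f g)
    then show ?case using X.act_assoc[of f g x] assms(1) by auto
  qed (use assms in auto)
qed

lemma rmod_hom_multI:
  assumes Y: "right_module (mult_ring K T) Y" and f: "f \<in> carrier X \<rightarrow> carrier Y"
    and add: "\<And>x y. \<lbrakk>x \<in> carrier X; y \<in> carrier X\<rbrakk> \<Longrightarrow> f (x \<oplus>\<^bsub>X\<^esub> y) = f x \<oplus>\<^bsub>Y\<^esub> f y"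
    and "\<And>c x. \<lbrakk>c \<in> carrier K; x \<in> carrier X\<rbrakk> \<Longrightarrow> f (scalar_op T c \<odot>\<^bsub>X\<^esub> x) = scalar_op T c \<odot>\<^bsub>Y\<^esub> f x"
    and "\<And>y z x. \<lbrakk>y \<in> carrier T; z \<in> carrier T; x \<in> carrier X\<rbrakk> \<Longrightarrow> f (mult_op1 T y z \<odot>\<^bsub>X\<^esub> x) = mult_op1 T y z \<odot>\<^bsub>Y\<^esub> f x"
    and "\<And>y z x. \<lbrakk>y \<in> carrier T; z \<in> carrier T; x \<in> carrier X\<rbrakk> \<Longrightarrow> f (mult_op2 T y z \<odot>\<^bsub>X\<^esub> x) = mult_op2 T y z \<odot>\<^bsub>Y\<^esub> f x"
    and "\<And>y z x. \<lbrakk>y \<in> carrier T; z \<in> carrier T; x \<in> carrier X\<rbrakk> \<Longrightarrow> f (mult_op3 T y z \<odot>\<^bsub>X\<^esub> x) = mult_op3 T y z \<odot>\<^bsub>Y\<^esub> f x"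
  shows "f \<in> rmod_hom (mult_ring K T) X Y"
proof -
  interpret Y: right_module "mult_ring K T" Y by fact
  have "f (m \<odot>\<^bsub>X\<^esub> x) = m \<odot>\<^bsub>Y\<^esub> f x" if "m \<in> carrier (mult_ring K T)" "x \<in> carrier X" for m x
    using that
  proof (induction arbitrary: x rule: mult_ring_induct)
    case (add f' g)
    have fx: "f x \<in> carrier Y" using f add.prems by auto
    show ?case
      using X.act_l_distr[of f' g x] Y.act_l_distr[of f' g "f x"] add assms(3)[of "f' \<odot>\<^bsub>X\<^esub> x" "g \<odot>\<^bsub>X\<^esub> x"] fx X.act_closed
      by (metis X.act_closed)
  next
    case (mult f' g)
    have fx: "f x \<in> carrier Y" using f mult.prems by auto
    show ?case
      using X.act_assoc[of f' g x] Y.act_assoc[of f' g "f x"] mult fx X.act_closed by metis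
  qed (use assms in auto)
  then show ?thesis using f add by (auto simp: rmod_hom_def)
qed

end

section \<open>The ring \<open>CM(R)\<close> and the module \<open>P(R)\<close>\<close>

context right_module
begin

lemma rmod_hom_diff:
  assumes "f \<in> rmod_hom S M M" "g \<in> rmod_hom S M M"
  shows "(\<lambda>x. f x \<oplus> \<ominus> g x) \<in> rmod_hom S M M"
  using assms by (auto simp: rmod_hom_def Pi_iff act_closed act_minus act_r_distr M.minus_add M.a_ac)

lemma rmod_hom_comp:
  assumes "f \<in> rmod_hom S M M" "g \<in> rmod_hom S M M"
  shows "(\<lambda>x. f (g x)) \<in> rmod_hom S M M"
  using assms by (auto simp: rmod_hom_def Pi_iff)

end

section \<open>Endomorphisms of the hull commute on R\<close>

locale hull_system = semiprime_system F R
  for F :: "('f, 'z) ring_scheme" and R :: "('f, 'r, 'n) triple_system_scheme" (structure) +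
  fixes E :: "('r \<Rightarrow> 'r, 'e) module" and j :: "'r \<Rightarrow> 'e"
  assumes hull: "injective_hull (mult_ring F R) (op_module R) E j"

sublocale hull_system \<subseteq> mult_module F R E
  by (intro mult_module.intro triple_lie_system_axioms)
    (use hull in \<open>simp add: injective_hull_def injective_rmod_def\<close>)

context hull_system
begin

abbreviation S where "S \<equiv> mult_ring F R"
abbreviation HE where "HE \<equiv> rmod_hom (mult_ring F R) E E"
abbreviation P where "P \<equiv> P_carrier F R E j"
abbreviation K where "K \<equiv> CM F R E j"

lemma j_hom:
  assumes "x \<in> carrier R"
  shows j_closed [simp, intro]: "j x \<in> carrier E"
    and j_add: "y \<in> carrier R \<Longrightarrow> j (x \<oplus> y) = j x \<oplus>\<^bsub>E\<^esub> j y"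
    and j_act: "a \<in> carrier S \<Longrightarrow> a \<odot>\<^bsub>E\<^esub> j x = j (a x)"
  using hull assms by (auto simp: injective_hull_def rmod_hom_def op_module_def)

lemma j_ops:
  assumes "x \<in> carrier R"
  shows "\<lbrakk>y \<in> carrier R; z \<in> carrier R\<rbrakk> \<Longrightarrow> mult_op1 R y z \<odot>\<^bsub>E\<^esub> j x = j \<lblot>x,y,z\<rblot>"
    and "\<lbrakk>y \<in> carrier R; z \<in> carrier R\<rbrakk> \<Longrightarrow> mult_op2 R y z \<odot>\<^bsub>E\<^esub> j x = j \<lblot>y,x,z\<rblot>"
    and "\<lbrakk>y \<in> carrier R; z \<in> carrier R\<rbrakk> \<Longrightarrow> mult_op3 R y z \<odot>\<^bsub>E\<^esub> j x = j \<lblot>y,z,x\<rblot>"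
    and "c \<in> carrier F \<Longrightarrow> scalar_op R c \<odot>\<^bsub>E\<^esub> j x = j (c \<odot> x)"
  using assms by (simp_all add: j_act mult_op_mult_ring scalar_op_mult_ring)
    (simp_all add: mult_op1_def mult_op2_def mult_op3_def scalar_op_def)

lemma j_eq_iff [simp]: "\<lbrakk>x \<in> carrier R; y \<in> carrier R\<rbrakk> \<Longrightarrow> j x = j y \<longleftrightarrow> x = y"
  using hull by (auto simp: injective_hull_def op_module_def inj_on_def)

lemma j_zero [simp]: "j \<zero> = \<zero>\<^bsub>E\<^esub>"
  using j_add[of \<zero> \<zero>] j_closed[of \<zero>] by (metis M.l_zero M.zero_closed X.M.add.r_cancel_one')

lemma j_minus: "x \<in> carrier R \<Longrightarrow> j (\<ominus> x) = \<ominus>\<^bsub>E\<^esub> j x"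
  using j_add[of "\<ominus> x" x] X.M.minus_equality[of "j (\<ominus> x)" "j x"] by (simp add: M.l_neg)

lemma submodule_meets:
  assumes L: "submodule L S E" and "q \<in> L" "q \<noteq> \<zero>\<^bsub>E\<^esub>"
  obtains x where "x \<in> carrier R" "x \<noteq> \<zero>" "j x \<in> L"
proof -
  have "L \<inter> j ` carrier R \<noteq> {\<zero>\<^bsub>E\<^esub>}"
    using hull assms by (auto simp: injective_hull_def essential_submodule_def op_module_def)
  moreover have "\<zero>\<^bsub>E\<^esub> \<in> L \<inter> j ` carrier R" using X.submoduleD(2)[OF L] j_zero M.zero_closed by (metis IntI imageI)
  ultimately obtain u where "u \<in> L" "u \<in> j ` carrier R" "u \<noteq> \<zero>\<^bsub>E\<^esub>" by blast
  then show thesis using that j_zero by blast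
qed

lemma preimage_ideal:
  assumes L: "submodule L S E"
  shows "triple_ideal F R {x \<in> carrier R. j x \<in> L}"
  using X.submoduleD[OF L] j_ops(1,4)[symmetric] j_add scalar_op_mult_ring mult_op_mult_ring(1)
  by (intro triple_idealI) auto

lemma image_ideal:
  assumes I: "triple_ideal F R I"
  shows "submodule (j ` I) S E"
proof -
  note c = subsetD[OF triple_ideal_subset[OF I]]
  show ?thesis
  proof (rule submodule_multI)
    show "j ` I \<subseteq> carrier E" using c by auto
    show "\<zero>\<^bsub>E\<^esub> \<in> j ` I" using triple_ideal_mem(1)[OF I] by (metis imageI j_zero)
    show "x \<oplus>\<^bsub>E\<^esub> y \<in> j ` I" if "x \<in> j ` I" "y \<in> j ` I" for x y
      using that c j_add[symmetric] triple_ideal_mem(2)[OF I] by auto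
  qed (use c in \<open>auto simp: j_ops triple_ideal_triple[OF I] triple_ideal_mem[OF I]\<close>)
qed

lemma HE_D:
  assumes "h \<in> HE" "q \<in> carrier E"
  shows "h q \<in> carrier E" "p \<in> carrier E \<Longrightarrow> h (q \<oplus>\<^bsub>E\<^esub> p) = h q \<oplus>\<^bsub>E\<^esub> h p" "a \<in> carrier S \<Longrightarrow> h (a \<odot>\<^bsub>E\<^esub> q) = a \<odot>\<^bsub>E\<^esub> h q"
  using assms by (auto simp: rmod_hom_def)

lemma HE_zero: "h \<in> HE \<Longrightarrow> h \<zero>\<^bsub>E\<^esub> = \<zero>\<^bsub>E\<^esub>"
  using X.rmod_hom_zero[OF _ X.M.abelian_group_axioms] .

text \<open>All three kinds of multiplication operators belong to M(R)', so \<open>h\<close> applied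
  to a product may be read as \<open>h\<close> applied to any one of its arguments. Reading it in
  two arguments at once gives both the commutativity and the denominator ideals below.\<close>

lemma HE_ops:
  assumes "h \<in> HE" "x \<in> carrier R" "y \<in> carrier R" "z \<in> carrier R"
  shows "h (j \<lblot>x,y,z\<rblot>) = mult_op1 R y z \<odot>\<^bsub>E\<^esub> h (j x)"
    and "h (j \<lblot>x,y,z\<rblot>) = mult_op2 R x z \<odot>\<^bsub>E\<^esub> h (j y)"
    and "h (j \<lblot>x,y,z\<rblot>) = mult_op3 R x y \<odot>\<^bsub>E\<^esub> h (j z)"
  using assms HE_D(3)[OF assms(1), symmetric] by (simp_all add: j_ops mult_op_mult_ring)

lemma image_submodule:
  assumes h: "h \<in> HE" and L: "submodule L S E"
  shows "submodule (h ` L) S E"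
proof -
  note l = X.submoduleD[OF L]
  show ?thesis
  proof (rule X.submoduleI)
    show "h ` L \<subseteq> carrier E" using l(1) HE_D(1)[OF h] by auto
    show "\<zero>\<^bsub>E\<^esub> \<in> h ` L" using l(2) HE_zero[OF h] by (metis imageI)
    show "x \<oplus>\<^bsub>E\<^esub> y \<in> h ` L" if "x \<in> h ` L" "y \<in> h ` L" for x y
      using that l(1,3) HE_D(2)[OF h, symmetric] by auto
    show "a \<odot>\<^bsub>E\<^esub> x \<in> h ` L" if "a \<in> carrier S" "x \<in> h ` L" for a x
      using that l(1,5) HE_D(3)[OF h, symmetric] by auto
  qed
qed

lemma preimage_submodule:
  assumes h: "h \<in> HE" and L: "submodule L S E"
  shows "submodule {q \<in> carrier E. h q \<in> L} S E"
proof -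
  note l = X.submoduleD[OF L]
  show ?thesis
    by (rule X.submoduleI) (use l HE_zero[OF h] HE_D[OF h] X.act_closed in auto)
qed

definition denominators :: "('e \<Rightarrow> 'e) \<Rightarrow> 'r set"
  where "denominators h = {x \<in> carrier R. h (j x) \<in> j ` carrier R}"

lemma denominators_ideal: "h \<in> HE \<Longrightarrow> triple_ideal F R (denominators h)"
  using preimage_ideal[OF preimage_submodule[OF _ image_ideal[OF triple_ideal_carrier]], of h]
  by (simp add: denominators_def cong: conj_cong)

text \<open>If \<open>h\<close> did not vanish on an ideal J, the submodule h (j J) would meet R in
  a nonzero j r = h (j y), and y would be a nonzero denominator in J. So an ideal without nonzero
  denominators is killed by \<open>h\<close>; but then all its elements are denominators.\<close>

lemma denominators_ann:
  assumes h: "h \<in> HE"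
  shows "triple_ann R (denominators h) = {\<zero>}"
proof (rule ann_zeroI[OF denominators_ideal[OF h]], rule subsetI)
  fix J x assume J: "triple_ideal F R J" "denominators h \<inter> J \<subseteq> {\<zero>}" and x: "x \<in> J"
  note c = subsetD[OF triple_ideal_subset[OF J(1)]]
  have "h (j x) = \<zero>\<^bsub>E\<^esub>"
  proof (rule ccontr)
    assume "h (j x) \<noteq> \<zero>\<^bsub>E\<^esub>"
    then obtain r where r: "r \<in> carrier R" "r \<noteq> \<zero>" "j r \<in> h ` j ` J"
      using submodule_meets[OF image_submodule[OF h image_ideal[OF J(1)]]] x by blast
    then obtain y where "y \<in> J" "j r = h (j y)" by blast
    moreover from this have "y \<in> denominators h" using c r(1) imageI[OF r(1), of j] by (simp add: denominators_def)
    ultimately have "y = \<zero>" "j r = h (j y)" using J(2) by auto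
    then show False using r HE_zero[OF h] j_eq_iff[of r \<zero>] by simp
  qed
  then have "x \<in> denominators h" using c[OF x] j_zero M.zero_closed by (auto simp: denominators_def image_iff intro!: bexI[of _ \<zero>])
  then show "x \<in> {\<zero>}" using J(2) x by blast
qed

text \<open>If h (j J) were nonzero, essentiality would give j r = h (j y) with r nonzero and y in
  J. Then j [r,a,z] = h (j [y,a,z]) = 0, and likewise for [r,z,a], so r would annihilate
  \<open>N\<close>.\<close>

lemma hom_vanish:
  assumes h: "h \<in> HE" and J: "triple_ideal F R J" and N: "triple_ann R N = {\<zero>}" "N \<subseteq> carrier R"
    and zero: "\<And>x a z. \<lbrakk>x \<in> J; a \<in> N; z \<in> carrier R\<rbrakk> \<Longrightarrow>
      h (j \<lblot>x,a,z\<rblot>) = \<zero>\<^bsub>E\<^esub> \<and> h (j \<lblot>x,z,a\<rblot>) = \<zero>\<^bsub>E\<^esub>"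
    and x: "x \<in> J"
  shows "h (j x) = \<zero>\<^bsub>E\<^esub>"
proof (rule ccontr)
  assume "h (j x) \<noteq> \<zero>\<^bsub>E\<^esub>"
  note c = subsetD[OF triple_ideal_subset[OF J]]
  obtain r where r: "r \<in> carrier R" "r \<noteq> \<zero>" "j r \<in> h ` j ` J"
    using \<open>h (j x) \<noteq> \<zero>\<^bsub>E\<^esub>\<close> submodule_meets[OF image_submodule[OF h image_ideal[OF J]]] x by blast
  then obtain y where y: "y \<in> J" "j r = h (j y)" by blast
  have "\<lblot>r,a,z\<rblot> = \<zero> \<and> \<lblot>r,z,a\<rblot> = \<zero>" if a: "a \<in> N" and z: "z \<in> carrier R" for a z
  proof -
    have ac: "a \<in> carrier R" using a N(2) by blast
    have "j \<lblot>r,a,z\<rblot> = j \<zero>" "j \<lblot>r,z,a\<rblot> = j \<zero>"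
      using zero[OF y(1) a z] HE_ops(1)[OF h c[OF y(1)]] ac z y(2) j_ops(1)[OF r(1)] by simp_all
    then show ?thesis using ac z r(1) by (simp only: j_eq_iff triple_closed M.zero_closed)
  qed
  then have "r \<in> triple_ann R N" using r by (auto simp: triple_ann_def)
  then show False using N(1) r(2) by auto
qed

lemma HE_comm:
  assumes f: "f \<in> HE" and g: "g \<in> HE" and x: "x \<in> carrier R"
  shows "f (g (j x)) = g (f (j x))"
proof -
  define h where "h = (\<lambda>q. f (g q) \<oplus>\<^bsub>E\<^esub> \<ominus>\<^bsub>E\<^esub> g (f q))"
  have h: "h \<in> HE" unfolding h_def by (rule X.rmod_hom_diff[OF X.rmod_hom_comp[OF f g] X.rmod_hom_comp[OF g f]])
  define N where "N = denominators f \<inter> denominators g"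
  have N: "triple_ideal F R N" "triple_ann R N = {\<zero>}"
    unfolding N_def using triple_ideal_Int ann_Int_zero denominators_ideal denominators_ann f g by blast+
  note Nc = triple_ideal_subset[OF N(1)]
  have h0: "h q = \<zero>\<^bsub>E\<^esub>" if "f (g q) = g (f q)" "q \<in> carrier E" for q
    using that HE_D(1)[OF f] HE_D(1)[OF g] by (simp add: h_def X.M.r_neg)
  \<comment> \<open>Here x and a are both common denominators. Reading f on x and g on a stays
    inside R, and the two orders of composition give the same product.\<close>
  have 1: "h (j x) = \<zero>\<^bsub>E\<^esub>" if x: "x \<in> N" for x
  proof (rule hom_vanish[OF h N(1,2) Nc _ x])
    fix x a z assume "x \<in> N" "a \<in> N" and z: "z \<in> carrier R"
    then obtain x' a' where c: "x' \<in> carrier R" "a' \<in> carrier R" "x \<in> carrier R" "a \<in> carrier R"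
      and e: "f (j x) = j x'" "g (j a) = j a'"
      by (auto simp: N_def denominators_def)
    have "f (g (j \<lblot>x,a,z\<rblot>)) = j \<lblot>x',a',z\<rblot>"
      using c z e HE_ops(2)[OF g, of x a z] HE_ops(1)[OF f, of x a' z] by (simp add: j_ops)
    moreover have "g (f (j \<lblot>x,a,z\<rblot>)) = j \<lblot>x',a',z\<rblot>"
      using c z e HE_ops(1)[OF f, of x a z] HE_ops(2)[OF g, of x' a z] by (simp add: j_ops)
    moreover have "f (g (j \<lblot>x,z,a\<rblot>)) = j \<lblot>x',z,a'\<rblot>"
      using c z e HE_ops(3)[OF g, of x z a] HE_ops(1)[OF f, of x z a'] by (simp add: j_ops)
    moreover have "g (f (j \<lblot>x,z,a\<rblot>)) = j \<lblot>x',z,a'\<rblot>"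
      using c z e HE_ops(1)[OF f, of x z a] HE_ops(3)[OF g, of x' z a] by (simp add: j_ops)
    ultimately show "h (j \<lblot>x,a,z\<rblot>) = \<zero>\<^bsub>E\<^esub> \<and> h (j \<lblot>x,z,a\<rblot>) = \<zero>\<^bsub>E\<^esub>"
      using c z h0 by simp
  qed
  \<comment> \<open>For arbitrary x the products with elements of \<open>N\<close> lie in
    \<open>N\<close>, where \<open>h\<close> is already known to vanish.\<close>
  have "h (j x) = \<zero>\<^bsub>E\<^esub>"
    using 1 triple_ideal_triple[OF N(1)] by (intro hom_vanish[OF h triple_ideal_carrier N(2) Nc _ x]) auto
  then have "f (g (j x)) \<oplus>\<^bsub>E\<^esub> \<ominus>\<^bsub>E\<^esub> g (f (j x)) = \<zero>\<^bsub>E\<^esub>" by (simp add: h_def)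
  then show ?thesis
    using X.M.minus_equality[of "f (g (j x))" "\<ominus>\<^bsub>E\<^esub> g (f (j x))"] HE_D(1)[OF f] HE_D(1)[OF g] x by simp
qed

section \<open>The module P(R) and its ring of scalars\<close>

lemma P_gen:
  assumes "h \<in> HE" "x \<in> carrier R"
  shows "h (j x) \<in> P"
proof -
  have "restrict h (carrier E) \<in> carrier (rmod_End S E)"
    using assms by (auto simp: rmod_End_def rmod_hom_def X.act_closed)
  moreover have "restrict h (carrier E) (j x) = h (j x)" using assms by simp
  ultimately show ?thesis unfolding P_carrier_def using assms(2) by (metis (mono_tags, lifting) generate.incl mem_Collect_eq)
qed

text \<open>The generated subgroup requires no case for inverses, because the negative of h (j x) is
  again a generator, h (j (-x)).\<close>

lemma P_gen_induct [consumes 1, case_names gen add]: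
  assumes p: "p \<in> P" and gen: "\<And>h x. \<lbrakk>h \<in> HE; x \<in> carrier R\<rbrakk> \<Longrightarrow> Pr (h (j x))"
    and add: "\<And>p q. \<lbrakk>p \<in> P; q \<in> P; Pr p; Pr q\<rbrakk> \<Longrightarrow> Pr (p \<oplus>\<^bsub>E\<^esub> q)"
  shows "Pr p"
proof -
  have id: "(\<lambda>q. q) \<in> HE" by (auto simp: rmod_hom_def)
  have sub: "f \<in> HE" if "f \<in> carrier (rmod_End S E)" for f using that by (simp add: rmod_End_def)
  show ?thesis
    using p unfolding P_carrier_def
  proof (induction rule: generate.induct)
    case one
    then show ?case using gen[OF id M.zero_closed] by simp
  next
    case (incl h)
    then show ?case using gen sub by blast
  next
    case (inv u)
    then obtain f x where f: "f \<in> HE" "x \<in> carrier R" "u = f (j x)" using sub by blast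
    have "f (j (\<ominus> x)) \<oplus>\<^bsub>E\<^esub> f (j x) = \<zero>\<^bsub>E\<^esub>"
      using HE_D(2)[OF f(1), of "j (\<ominus> x)" "j x", symmetric] f(2) HE_zero[OF f(1)] by (simp add: j_minus X.M.l_neg)
    then have "inv\<^bsub>add_monoid E\<^esub> u = f (j (\<ominus> x))"
      using X.M.minus_equality[of "f (j (\<ominus> x))" "f (j x)"] f HE_D(1)[OF f(1)] by (simp add: a_inv_def)
    then show ?case using gen f by simp
  next
    case (eng p q)
    then show ?case using add unfolding P_carrier_def by simp
  qed
qed

lemma P_add: "\<lbrakk>p \<in> P; q \<in> P\<rbrakk> \<Longrightarrow> p \<oplus>\<^bsub>E\<^esub> q \<in> P"
  unfolding P_carrier_def using generate.eng[of p "add_monoid E"] by simp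

lemma P_subset: "p \<in> P \<Longrightarrow> p \<in> carrier E"
  by (induction rule: P_gen_induct) (auto intro: HE_D)

lemma P_HE: "\<lbrakk>p \<in> P; h \<in> HE\<rbrakk> \<Longrightarrow> h p \<in> P"
proof (induction rule: P_gen_induct)
  case (gen g x)
  then show ?case using P_gen[OF X.rmod_hom_comp, of h g x] by simp
next
  case (add p q)
  then show ?case using HE_D(2)[of h p q] P_subset P_add by simp
qed

lemma j_P [simp, intro]: "x \<in> carrier R \<Longrightarrow> j x \<in> P"
  using P_gen[of "\<lambda>q. q" x] by (auto simp: rmod_hom_def)

lemma P_submodule: "submodule P S E"
proof (rule X.submoduleI)
  show "\<zero>\<^bsub>E\<^esub> \<in> P" using j_P[OF M.zero_closed] by simp
  fix a p assume a: "a \<in> carrier S" and "p \<in> P"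
  from \<open>p \<in> P\<close> show "a \<odot>\<^bsub>E\<^esub> p \<in> P"
  proof (induction rule: P_gen_induct)
    case (gen h x)
    have "a x \<in> carrier R" using mult_ring_lin[OF a] gen by (auto simp: lin_End_def)
    then show ?case using HE_D(3)[OF gen(1) _ a, of "j x", symmetric] gen a by (simp add: j_act P_gen)
  next
    case (add p q)
    then show ?case using P_subset by (simp add: X.act_r_distr a P_add)
  qed
qed (use P_subset P_add in auto)

lemmas P_closed = X.submoduleD[OF P_submodule]

lemma HE_comm_P:
  assumes f: "f \<in> HE" and g: "g \<in> HE" and p: "p \<in> P"
  shows "f (g p) = g (f p)"
  using p
proof (induction rule: P_gen_induct)
  case (gen h x)
  \<comment> \<open>The composite of f and g is one endomorphism and commutes with h on R; this
    moves h outwards and reduces the claim to R.\<close>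
  have "f (g (h (j x))) = h (f (g (j x)))" if f: "f \<in> HE" and g: "g \<in> HE" for f g
    using HE_comm[OF X.rmod_hom_comp[OF f g] gen] by simp
  then show ?case using f g HE_comm[OF f g gen(2)] by metis
next
  case (add p q)
  then show ?case using P_subset by (simp add: HE_D[OF f] HE_D[OF g])
qed

sublocale PX: right_module S "E\<lparr>carrier := P\<rparr>"
  by (rule X.right_module_submodule[OF P_submodule])

lemma K_carrier: "carrier K = rmod_hom S (E\<lparr>carrier := P\<rparr>) (E\<lparr>carrier := P\<rparr>) \<inter> extensional P"
  by (simp add: CM_def rmod_End_def)

lemma K_simps:
  "c \<oplus>\<^bsub>K\<^esub> d = (\<lambda>p\<in>P. c p \<oplus>\<^bsub>E\<^esub> d p)" "c \<otimes>\<^bsub>K\<^esub> d = compose P c d" "\<zero>\<^bsub>K\<^esub> = (\<lambda>p\<in>P. \<zero>\<^bsub>E\<^esub>)" "\<one>\<^bsub>K\<^esub> = (\<lambda>p\<in>P. p)"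
  by (simp_all add: CM_def rmod_End_def)

lemma K_restrict:
  assumes "h \<in> HE"
  shows "restrict h P \<in> carrier K"
  using assms P_HE P_subset P_closed(3,5) unfolding K_carrier by (auto simp: rmod_hom_def Pi_iff)

text \<open>Injectivity extends \<open>f\<close> to an endomorphism of the whole hull, and
  endomorphisms of the hull map P(R) into itself. This is the source of all scalars constructed
  later.\<close>

lemma K_partial:
  assumes V: "submodule V S E" and "f \<in> rmod_hom S (E\<lparr>carrier := V\<rparr>) E" "V \<subseteq> P"
  obtains c where "c \<in> carrier K" "\<And>v. v \<in> V \<Longrightarrow> c v = f v"
proof -
  have "injective_rmod S E" using hull by (simp add: injective_hull_def)
  then obtain g where "g \<in> HE" "\<And>x. x \<in> V \<Longrightarrow> g x = f x" using X.injective_extend[OF _ assms(1,2)] by blast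
  then show thesis using that[OF K_restrict, of g] assms(3) by (simp add: subset_iff)
qed

text \<open>A scalar is a map on P(R) alone; extended to the hull it becomes accessible to the
  commutation of hull endomorphisms.\<close>

lemma K_extend:
  assumes c: "c \<in> carrier K"
  obtains h where "h \<in> HE" "\<And>p. p \<in> P \<Longrightarrow> c p = h p"
proof -
  have "injective_rmod S E" using hull by (simp add: injective_hull_def)
  moreover have "c \<in> rmod_hom S (E\<lparr>carrier := P\<rparr>) E" using c P_subset unfolding K_carrier by (auto simp: rmod_hom_def Pi_iff)
  ultimately show thesis using X.injective_extend[OF _ P_submodule] that by metis
qed

lemma K_comm:
  assumes "c \<in> carrier K" "d \<in> carrier K"
  shows "c \<otimes>\<^bsub>K\<^esub> d = d \<otimes>\<^bsub>K\<^esub> c"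
proof -
  obtain f where f: "f \<in> HE" "\<And>p. p \<in> P \<Longrightarrow> c p = f p" using K_extend[OF assms(1)] by blast
  obtain g where g: "g \<in> HE" "\<And>p. p \<in> P \<Longrightarrow> d p = g p" using K_extend[OF assms(2)] by blast
  show ?thesis
    using f g P_HE HE_comm_P[OF f(1) g(1)] by (auto simp: K_simps compose_def fun_eq_iff)
qed

lemma K_cring: "cring K"
proof -
  have "ring K" unfolding CM_def using PX.rmod_End_ring by simp
  then show ?thesis
    by (intro cring.intro comm_monoid.intro) (auto intro: ring.is_monoid comm_monoid_axioms.intro K_comm)
qed

lemma K_app:
  assumes "c \<in> carrier K" "p \<in> P"
  shows "c p \<in> P" "q \<in> P \<Longrightarrow> c (p \<oplus>\<^bsub>E\<^esub> q) = c p \<oplus>\<^bsub>E\<^esub> c q" "a \<in> carrier S \<Longrightarrow> c (a \<odot>\<^bsub>E\<^esub> p) = a \<odot>\<^bsub>E\<^esub> c p"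
  using assms unfolding K_carrier by (auto simp: rmod_hom_def)

text \<open>This is P(R) = CM(R) R: a generator h (j x) is the restriction of h to P(R), which is a
  scalar, applied to j x.\<close>

lemma P_induct [consumes 1, case_names base add smult]:
  assumes p: "p \<in> P" and "\<And>x. x \<in> carrier R \<Longrightarrow> Pr (j x)"
    and "\<And>p q. \<lbrakk>p \<in> P; q \<in> P; Pr p; Pr q\<rbrakk> \<Longrightarrow> Pr (p \<oplus>\<^bsub>E\<^esub> q)"
    and "\<And>c p. \<lbrakk>c \<in> carrier K; p \<in> P; Pr p\<rbrakk> \<Longrightarrow> Pr (c p)"
  shows "Pr p"
  using p
proof (induction rule: P_gen_induct)
  case (gen h x)
  then show ?case using assms(4)[OF K_restrict[OF gen(1)], of "j x"] assms(2) by simp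
qed (use assms(3) in blast)

lemma P_abelian_group:
  assumes "carrier M = P" "ring.zero M = \<zero>\<^bsub>E\<^esub>" "ring.add M = ring.add E"
  shows "abelian_group M"
proof (rule abelian_groupI)
  show "\<exists>q\<in>carrier M. q \<oplus>\<^bsub>M\<^esub> p = \<zero>\<^bsub>M\<^esub>" if "p \<in> carrier M" for p
    using that assms P_closed(1,4) X.M.l_neg by (intro bexI[of _ "\<ominus>\<^bsub>E\<^esub> p"]) auto
qed (use assms P_closed(1-3) in \<open>auto simp: X.M.a_ac\<close>)

lemma P_module: 
  assumes "carrier M = P" "ring.zero M = \<zero>\<^bsub>E\<^esub>" "ring.add M = ring.add E" "module.smult M = (\<lambda>c x. c x)"
  shows "module K M"
  by (rule moduleI[OF K_cring P_abelian_group[OF assms(1-3)]])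
    (use assms K_app in \<open>auto simp: K_simps compose_def\<close>)

end

section \<open>The composition of \<open>P(R)\<close>\<close>

context hull_system
begin

section \<open>Extending the composition one argument at a time\<close>

definition lin :: "('e \<Rightarrow> 'e) \<Rightarrow> bool"
  where "lin f \<longleftrightarrow> f \<in> P \<rightarrow> P \<and> (\<forall>p\<in>P. \<forall>q\<in>P. f (p \<oplus>\<^bsub>E\<^esub> q) = f p \<oplus>\<^bsub>E\<^esub> f q) \<and>
    (\<forall>c\<in>carrier K. \<forall>p\<in>P. f (c p) = c (f p))"

lemma linD:
  assumes "lin f" "p \<in> P"
  shows "f p \<in> P" "q \<in> P \<Longrightarrow> f (p \<oplus>\<^bsub>E\<^esub> q) = f p \<oplus>\<^bsub>E\<^esub> f q" "c \<in> carrier K \<Longrightarrow> f (c p) = c (f p)"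
  using assms by (auto simp: lin_def)

lemma K_app_comm:
  assumes "c \<in> carrier K" "d \<in> carrier K" "p \<in> P"
  shows "c (d p) = d (c p)"
  using fun_cong[OF K_comm[OF assms(1,2)], of p] assms by (simp add: K_simps compose_def)

text \<open>R spans P(R) over CM(R). Every identity on P(R) below is obtained by checking it on R
  and moving one argument at a time from R to P(R).\<close>

lemma lin_unique:
  assumes "lin f" "lin g" "\<And>x. x \<in> carrier R \<Longrightarrow> f (j x) = g (j x)" "p \<in> P"
  shows "f p = g p"
  using assms(4) by (induction rule: P_induct) (simp_all add: assms(3) linD[OF assms(1)] linD[OF assms(2)])

lemma lin_id: "lin (\<lambda>p. p)"
  by (simp add: lin_def)

lemma lin_act: "a \<in> carrier S \<Longrightarrow> lin (\<lambda>p. a \<odot>\<^bsub>E\<^esub> p)"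
  using P_closed K_app by (simp add: lin_def X.act_r_distr)

lemma lin_add: "\<lbrakk>lin f; lin g\<rbrakk> \<Longrightarrow> lin (\<lambda>p. f p \<oplus>\<^bsub>E\<^esub> g p)"
  using P_closed K_app by (auto simp: lin_def X.M.a_ac Pi_iff)

lemma lin_zero: "lin (\<lambda>p. \<zero>\<^bsub>E\<^esub>)"
proof -
  have "\<zero>\<^bsub>E\<^esub> = c \<zero>\<^bsub>E\<^esub>" if c: "c \<in> carrier K" for c
    using K_app(3)[OF c P_closed(2), of "\<zero>\<^bsub>S\<^esub>"] K_app(1)[OF c P_closed(2)] X.S.zero_closed P_closed(1,2)
    by (metis X.act_zero_ring)
  then show ?thesis using P_closed(2) by (auto simp: lin_def dest: sym)
qed

text \<open>The commutativity of CM(R) enters the construction here: a scalar multiple of a linear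
  map is linear only because scalars commute.\<close>

lemma lin_smult: "\<lbrakk>c \<in> carrier K; lin f\<rbrakk> \<Longrightarrow> lin (\<lambda>p. c (f p))"
  using K_app K_app_comm[of c] by (auto simp: lin_def Pi_iff)

text \<open>The prescribed value on j y depends on \<open>p\<close> and not on an expression of
  \<open>p\<close> through R, so no question of well-definedness arises. Induction shows that the
  \<open>p\<close> admitting an operator contain R and are closed under sums and scalars, and
  \<open>lin_unique\<close> makes the operator unique.\<close>

lemma extension_second:
  assumes "p \<in> P" "z \<in> carrier R"
  shows "\<exists>f. lin f \<and> (\<forall>y\<in>carrier R. f (j y) = mult_op1 R y z \<odot>\<^bsub>E\<^esub> p)"
  using assms(1)
proof (induction rule: P_induct)
  case (base x)
  then show ?case
    using assms(2) by (intro exI[of _ "\<lambda>q. mult_op2 R x z \<odot>\<^bsub>E\<^esub> q"]) (simp add: lin_act mult_op_mult_ring j_ops)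
next
  case (add p q)
  then obtain f g where "lin f" "\<forall>y\<in>carrier R. f (j y) = mult_op1 R y z \<odot>\<^bsub>E\<^esub> p"
    "lin g" "\<forall>y\<in>carrier R. g (j y) = mult_op1 R y z \<odot>\<^bsub>E\<^esub> q" by blast
  then show ?case
    using add assms(2) P_closed(1)
    by (intro exI[of _ "\<lambda>u. f u \<oplus>\<^bsub>E\<^esub> g u"]) (simp add: lin_add X.act_r_distr mult_op_mult_ring)
next
  case (smult c p)
  then obtain f where "lin f" "\<forall>y\<in>carrier R. f (j y) = mult_op1 R y z \<odot>\<^bsub>E\<^esub> p" by blast
  then show ?case
    using smult assms(2) by (intro exI[of _ "\<lambda>u. c (f u)"]) (simp add: lin_smult K_app mult_op_mult_ring)
qed

text \<open>The operator [p,-,z] on P(R), with the third argument still taken from R.\<close>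

definition triple2 :: "'e \<Rightarrow> 'r \<Rightarrow> 'e \<Rightarrow> 'e"
  where "triple2 p z = (SOME f. lin f \<and> (\<forall>y\<in>carrier R. f (j y) = mult_op1 R y z \<odot>\<^bsub>E\<^esub> p))"

lemma triple2:
  assumes "p \<in> P" "z \<in> carrier R"
  shows "lin (triple2 p z)" "y \<in> carrier R \<Longrightarrow> triple2 p z (j y) = mult_op1 R y z \<odot>\<^bsub>E\<^esub> p"
  using someI_ex[OF extension_second[OF assms]] unfolding triple2_def by auto

lemma triple2_eqI:
  assumes "p \<in> P" "z \<in> carrier R" "q \<in> P" "lin f"
    and "\<And>y. y \<in> carrier R \<Longrightarrow> f (j y) = mult_op1 R y z \<odot>\<^bsub>E\<^esub> p"
  shows "triple2 p z q = f q"
  by (rule lin_unique[OF triple2(1)[OF assms(1,2)] assms(4) _ assms(3)]) (simp add: triple2 assms)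

lemma triple2_base:
  assumes "x \<in> carrier R" "z \<in> carrier R" "q \<in> P"
  shows "triple2 (j x) z q = mult_op2 R x z \<odot>\<^bsub>E\<^esub> q"
  by (rule triple2_eqI) (simp_all add: assms lin_act mult_op_mult_ring j_ops)

lemma triple2_add:
  assumes "p \<in> P" "p' \<in> P" "z \<in> carrier R" "q \<in> P"
  shows "triple2 (p \<oplus>\<^bsub>E\<^esub> p') z q = triple2 p z q \<oplus>\<^bsub>E\<^esub> triple2 p' z q"
  by (rule triple2_eqI[of _ _ _ "\<lambda>u. triple2 p z u \<oplus>\<^bsub>E\<^esub> triple2 p' z u"])
    (simp_all add: assms P_closed lin_add triple2 mult_op_mult_ring X.act_r_distr)

lemma triple2_smult:
  assumes "c \<in> carrier K" "p \<in> P" "z \<in> carrier R" "q \<in> P"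
  shows "triple2 (c p) z q = c (triple2 p z q)"
  by (rule triple2_eqI[of _ _ _ "\<lambda>u. c (triple2 p z u)"])
    (simp_all add: assms K_app lin_smult triple2 mult_op_mult_ring)

text \<open>The same passage for the last argument. The starting point, with both \<open>p\<close>
  and \<open>q\<close> in R, is the action of an operator of M(R)' on the hull; a nested induction
  then frees first \<open>q\<close> and after it \<open>p\<close>.\<close>

lemma extension_third:
  assumes "p \<in> P" "q \<in> P"
  shows "\<exists>f. lin f \<and> (\<forall>z\<in>carrier R. f (j z) = triple2 p z q)"
  using assms(1)
proof (induction rule: P_induct)
  case (base x)
  show ?case using assms(2)
  proof (induction rule: P_induct)
    case (base y)
    then show ?case
      using \<open>x \<in> carrier R\<close>
      by (intro exI[of _ "\<lambda>r. mult_op3 R x y \<odot>\<^bsub>E\<^esub> r"]) (simp add: lin_act mult_op_mult_ring j_ops triple2_base)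
  next
    case (add p q)
    then obtain f g where "lin f" "\<forall>z\<in>carrier R. f (j z) = triple2 (j x) z p"
      "lin g" "\<forall>z\<in>carrier R. g (j z) = triple2 (j x) z q" by blast
    then show ?case
      using add base by (intro exI[of _ "\<lambda>u. f u \<oplus>\<^bsub>E\<^esub> g u"]) (simp add: lin_add linD[OF triple2(1)])
  next
    case (smult c p)
    then obtain f where "lin f" "\<forall>z\<in>carrier R. f (j z) = triple2 (j x) z p" by blast
    then show ?case
      using smult base by (intro exI[of _ "\<lambda>u. c (f u)"]) (simp add: lin_smult linD[OF triple2(1)])
  qed
next
  case (add p p')
  then obtain f g where "lin f" "\<forall>z\<in>carrier R. f (j z) = triple2 p z q"
    "lin g" "\<forall>z\<in>carrier R. g (j z) = triple2 p' z q" by blast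
  then show ?case
    using add assms(2) by (intro exI[of _ "\<lambda>u. f u \<oplus>\<^bsub>E\<^esub> g u"]) (simp add: lin_add triple2_add)
next
  case (smult c p)
  then obtain f where "lin f" "\<forall>z\<in>carrier R. f (j z) = triple2 p z q" by blast
  then show ?case
    using smult assms(2) by (intro exI[of _ "\<lambda>u. c (f u)"]) (simp add: lin_smult triple2_smult)
qed

definition triple3 :: "'e \<Rightarrow> 'e \<Rightarrow> 'e \<Rightarrow> 'e"
  where "triple3 p q = (SOME f. lin f \<and> (\<forall>z\<in>carrier R. f (j z) = triple2 p z q))"

lemma triple3:
  assumes "p \<in> P" "q \<in> P"
  shows "lin (triple3 p q)" "z \<in> carrier R \<Longrightarrow> triple3 p q (j z) = triple2 p z q"
  using someI_ex[OF extension_third[OF assms]] unfolding triple3_def by auto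

lemma triple3_eqI:
  assumes "p \<in> P" "q \<in> P" "r \<in> P" "lin f" "\<And>z. z \<in> carrier R \<Longrightarrow> f (j z) = triple2 p z q"
  shows "triple3 p q r = f r"
  by (rule lin_unique[OF triple3(1)[OF assms(1,2)] assms(4) _ assms(3)]) (simp add: triple3 assms)

lemma triple3_add:
  assumes "p \<in> P" "p' \<in> P" "q \<in> P" "r \<in> P"
  shows "triple3 (p \<oplus>\<^bsub>E\<^esub> p') q r = triple3 p q r \<oplus>\<^bsub>E\<^esub> triple3 p' q r"
    and "triple3 q (p \<oplus>\<^bsub>E\<^esub> p') r = triple3 q p r \<oplus>\<^bsub>E\<^esub> triple3 q p' r"
  by (rule triple3_eqI[of _ _ _ "\<lambda>u. triple3 p q u \<oplus>\<^bsub>E\<^esub> triple3 p' q u"],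
      simp_all add: assms P_closed lin_add triple3 triple2_add)
    (rule triple3_eqI[of _ _ _ "\<lambda>u. triple3 q p u \<oplus>\<^bsub>E\<^esub> triple3 q p' u"],
      simp_all add: assms P_closed lin_add triple3 linD[OF triple2(1)])

lemma triple3_smult:
  assumes "c \<in> carrier K" "p \<in> P" "q \<in> P" "r \<in> P"
  shows "triple3 (c p) q r = c (triple3 p q r)" "triple3 q (c p) r = c (triple3 q p r)"
  by (rule triple3_eqI[of _ _ _ "\<lambda>u. c (triple3 p q u)"],
      simp_all add: assms K_app lin_smult triple3 triple2_smult)
    (rule triple3_eqI[of _ _ _ "\<lambda>u. c (triple3 q p u)"],
      simp_all add: assms K_app lin_smult triple3 linD[OF triple2(1)])

abbreviation Psys where "Psys \<equiv> P_system F R E j"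

lemma Psys_simps [simp]:
  "carrier Psys = P" "\<zero>\<^bsub>Psys\<^esub> = \<zero>\<^bsub>E\<^esub>" "p \<oplus>\<^bsub>Psys\<^esub> q = p \<oplus>\<^bsub>E\<^esub> q" "c \<odot>\<^bsub>Psys\<^esub> p = c p"
  by (simp_all add: P_system_def)

text \<open>The composition of P(R) is a choice among trilinear extensions, and
  \<open>triple3\<close> shows that one exists. From here on only trilinearity and the values on R
  are used.\<close>

lemma Psys_trilinear: "trilinear K Psys (triple Psys)"
  and Psys_base: "\<lbrakk>x \<in> carrier R; y \<in> carrier R; z \<in> carrier R\<rbrakk> \<Longrightarrow> \<lblot>j x,j y,j z\<rblot>\<^bsub>Psys\<^esub> = j \<lblot>x,y,z\<rblot>"
proof -
  let ?Q = "\<lambda>t. trilinear K (P_module F R E j) t \<and>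
    (\<forall>x\<in>carrier R. \<forall>y\<in>carrier R. \<forall>z\<in>carrier R. t (j x) (j y) (j z) = j \<lblot>x,y,z\<rblot>)"
  have "?Q triple3"
    by (auto simp: trilinear_def P_module_def triple3_add triple3_smult linD[OF triple3(1)] triple3 triple2 j_ops)
  then have "?Q (P_triple F R E j)" unfolding P_triple_def by (rule someI[of ?Q])
  moreover have "triple Psys = P_triple F R E j" by (simp add: P_system_def)
  ultimately show "trilinear K Psys (triple Psys)"
    "\<lbrakk>x \<in> carrier R; y \<in> carrier R; z \<in> carrier R\<rbrakk> \<Longrightarrow> \<lblot>j x,j y,j z\<rblot>\<^bsub>Psys\<^esub> = j \<lblot>x,y,z\<rblot>"
    by (simp_all add: trilinear_def P_module_def P_system_def)
qed

section \<open>The identities of a triple Lie system on P(R)\<close>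

lemma lin_triple:
  assumes "lin f" "q \<in> P" "r \<in> P"
  shows "lin (\<lambda>p. \<lblot>f p,q,r\<rblot>\<^bsub>Psys\<^esub>)" "lin (\<lambda>p. \<lblot>q,f p,r\<rblot>\<^bsub>Psys\<^esub>)" "lin (\<lambda>p. \<lblot>q,r,f p\<rblot>\<^bsub>Psys\<^esub>)"
  using Psys_trilinear assms by (auto simp: trilinear_def lin_def Pi_iff)

lemma triple_P: "\<lbrakk>p \<in> P; q \<in> P; r \<in> P\<rbrakk> \<Longrightarrow> \<lblot>p,q,r\<rblot>\<^bsub>Psys\<^esub> \<in> P"
  using Psys_trilinear by (auto simp: trilinear_def)

text \<open>An expression built from compositions and sums is linear in a variable that occurs once
  in each summand; with these rules \<open>intro\<close> proves this by following the
  expression.\<close>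

lemmas lin_intros = lin_id lin_triple lin_add lin_zero triple_P j_P

text \<open>Both sides are CM(R)-linear in \<open>p\<close> and agree on R. This connects the
  composition of P(R) with the action of M(R)' on the hull, so that ideals of P(R) can be compared
  with submodules of \<open>E\<close>.\<close>

lemma triple_act:
  assumes "p \<in> P" "y \<in> carrier R" "z \<in> carrier R"
  shows "\<lblot>p,j y,j z\<rblot>\<^bsub>Psys\<^esub> = mult_op1 R y z \<odot>\<^bsub>E\<^esub> p"
    and "\<lblot>j y,p,j z\<rblot>\<^bsub>Psys\<^esub> = mult_op2 R y z \<odot>\<^bsub>E\<^esub> p"
    and "\<lblot>j y,j z,p\<rblot>\<^bsub>Psys\<^esub> = mult_op3 R y z \<odot>\<^bsub>E\<^esub> p"
proof -
  show "\<lblot>p,j y,j z\<rblot>\<^bsub>Psys\<^esub> = mult_op1 R y z \<odot>\<^bsub>E\<^esub> p"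
    by (rule lin_unique[OF lin_triple(1)[OF lin_id] lin_act _ assms(1)])
      (simp_all add: Psys_base j_ops mult_op_mult_ring assms)
  show "\<lblot>j y,p,j z\<rblot>\<^bsub>Psys\<^esub> = mult_op2 R y z \<odot>\<^bsub>E\<^esub> p"
    by (rule lin_unique[OF lin_triple(2)[OF lin_id] lin_act _ assms(1)])
      (simp_all add: Psys_base j_ops mult_op_mult_ring assms)
  show "\<lblot>j y,j z,p\<rblot>\<^bsub>Psys\<^esub> = mult_op3 R y z \<odot>\<^bsub>E\<^esub> p"
    by (rule lin_unique[OF lin_triple(3)[OF lin_id] lin_act _ assms(1)])
      (simp_all add: Psys_base j_ops mult_op_mult_ring assms)
qed

text \<open>The alternating law is quadratic and cannot be carried over by linearity; its
  polarisation can, and is needed for the law itself.\<close>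

lemma Psys_swap:
  assumes "p \<in> P" "q \<in> P" "r \<in> P"
  shows "\<lblot>p,q,r\<rblot>\<^bsub>Psys\<^esub> \<oplus>\<^bsub>E\<^esub> \<lblot>q,p,r\<rblot>\<^bsub>Psys\<^esub> = \<zero>\<^bsub>E\<^esub>"
proof -
  have 0: "\<lblot>j x,j y,j z\<rblot>\<^bsub>Psys\<^esub> \<oplus>\<^bsub>E\<^esub> \<lblot>j y,j x,j z\<rblot>\<^bsub>Psys\<^esub> = \<zero>\<^bsub>E\<^esub>"
    if "x \<in> carrier R" "y \<in> carrier R" "z \<in> carrier R" for x y z
    using that triple_swap[of x y z] by (simp add: Psys_base j_minus X.M.r_neg)
  have 1: "\<lblot>j x,j y,r\<rblot>\<^bsub>Psys\<^esub> \<oplus>\<^bsub>E\<^esub> \<lblot>j y,j x,r\<rblot>\<^bsub>Psys\<^esub> = \<zero>\<^bsub>E\<^esub>"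
    if "x \<in> carrier R" "y \<in> carrier R" "r \<in> P" for x y r
    by (rule lin_unique[OF _ lin_zero _ that(3)]) (intro lin_intros that | simp add: 0 that)+
  have 2: "\<lblot>j x,q,r\<rblot>\<^bsub>Psys\<^esub> \<oplus>\<^bsub>E\<^esub> \<lblot>q,j x,r\<rblot>\<^bsub>Psys\<^esub> = \<zero>\<^bsub>E\<^esub>"
    if "x \<in> carrier R" "q \<in> P" "r \<in> P" for x q r
    by (rule lin_unique[OF _ lin_zero _ that(2)]) (intro lin_intros that | simp add: 1 that)+
  show ?thesis
    by (rule lin_unique[OF _ lin_zero _ assms(1)]) (intro lin_intros assms | simp add: 2 assms)+
qed

text \<open>Skew-symmetry alone does not suffice when 2 is not invertible, hence the induction on
  \<open>p\<close>: skew-symmetry disposes of the mixed terms of a sum, and a scalar comes out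
  twice.\<close>

lemma Psys_alternating:
  assumes "p \<in> P" "r \<in> P"
  shows "\<lblot>p,p,r\<rblot>\<^bsub>Psys\<^esub> = \<zero>\<^bsub>E\<^esub>"
  using assms(1)
proof (induction rule: P_induct)
  case (base x)
  have "\<lblot>j x,j x,j z\<rblot>\<^bsub>Psys\<^esub> = \<zero>\<^bsub>E\<^esub>" if "z \<in> carrier R" for z
    using base that by (simp add: Psys_base alternating)
  then show ?case using lin_unique[OF lin_triple(3)[OF lin_id j_P[OF base] j_P[OF base]] lin_zero _ assms(2)] by simp
next
  case (add p q)
  note t = linD(2)[OF lin_triple(1)[OF lin_id]] linD(2)[OF lin_triple(2)[OF lin_id]]
  have "\<lblot>p \<oplus>\<^bsub>E\<^esub> q,p \<oplus>\<^bsub>E\<^esub> q,r\<rblot>\<^bsub>Psys\<^esub> = \<lblot>p,q,r\<rblot>\<^bsub>Psys\<^esub> \<oplus>\<^bsub>E\<^esub> \<lblot>q,p,r\<rblot>\<^bsub>Psys\<^esub>"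
    using add assms(2) P_add P_closed(1) triple_P by (simp add: t X.M.a_comm)
  then show ?case using Psys_swap add assms(2) by simp
next
  case (smult c p)
  then have "\<lblot>c p,c p,r\<rblot>\<^bsub>Psys\<^esub> = c (c \<lblot>p,p,r\<rblot>\<^bsub>Psys\<^esub>)"
    using linD(3)[OF lin_triple(1)[OF lin_id]] linD(3)[OF lin_triple(2)[OF lin_id]] K_app(1) assms(2) by simp
  then show ?case using smult linD(3)[OF lin_zero, of _ c] P_closed(2) by simp
qed

lemma Psys_cyclic:
  assumes "p \<in> P" "q \<in> P" "r \<in> P"
  shows "\<lblot>p,q,r\<rblot>\<^bsub>Psys\<^esub> \<oplus>\<^bsub>E\<^esub> \<lblot>q,r,p\<rblot>\<^bsub>Psys\<^esub> \<oplus>\<^bsub>E\<^esub> \<lblot>r,p,q\<rblot>\<^bsub>Psys\<^esub> = \<zero>\<^bsub>E\<^esub>"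
proof -
  have 0: "\<lblot>j x,j y,j z\<rblot>\<^bsub>Psys\<^esub> \<oplus>\<^bsub>E\<^esub> \<lblot>j y,j z,j x\<rblot>\<^bsub>Psys\<^esub> \<oplus>\<^bsub>E\<^esub> \<lblot>j z,j x,j y\<rblot>\<^bsub>Psys\<^esub> = \<zero>\<^bsub>E\<^esub>"
    if "x \<in> carrier R" "y \<in> carrier R" "z \<in> carrier R" for x y z
    using that cyclic[of x y z] by (simp add: Psys_base j_add[symmetric])
  have 1: "\<lblot>j x,j y,r\<rblot>\<^bsub>Psys\<^esub> \<oplus>\<^bsub>E\<^esub> \<lblot>j y,r,j x\<rblot>\<^bsub>Psys\<^esub> \<oplus>\<^bsub>E\<^esub> \<lblot>r,j x,j y\<rblot>\<^bsub>Psys\<^esub> = \<zero>\<^bsub>E\<^esub>"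
    if "x \<in> carrier R" "y \<in> carrier R" "r \<in> P" for x y r
    by (rule lin_unique[OF _ lin_zero _ that(3)]) (intro lin_intros that | simp add: 0 that)+
  have 2: "\<lblot>j x,q,r\<rblot>\<^bsub>Psys\<^esub> \<oplus>\<^bsub>E\<^esub> \<lblot>q,r,j x\<rblot>\<^bsub>Psys\<^esub> \<oplus>\<^bsub>E\<^esub> \<lblot>r,j x,q\<rblot>\<^bsub>Psys\<^esub> = \<zero>\<^bsub>E\<^esub>"
    if "x \<in> carrier R" "q \<in> P" "r \<in> P" for x q r
    by (rule lin_unique[OF _ lin_zero _ that(2)]) (intro lin_intros that | simp add: 1 that)+
  show ?thesis
    by (rule lin_unique[OF _ lin_zero _ assms(1)]) (intro lin_intros assms | simp add: 2 assms)+
qed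

text \<open>Both sides are linear in each of the five arguments; these pass from R to P(R) one by
  one, beginning with \<open>c\<close>.\<close>

lemma Psys_derivation:
  assumes "p \<in> P" "q \<in> P" "a \<in> P" "b \<in> P" "c \<in> P"
  shows "\<lblot>p,q,\<lblot>a,b,c\<rblot>\<^bsub>Psys\<^esub>\<rblot>\<^bsub>Psys\<^esub> =
    \<lblot>\<lblot>p,q,a\<rblot>\<^bsub>Psys\<^esub>,b,c\<rblot>\<^bsub>Psys\<^esub> \<oplus>\<^bsub>E\<^esub> \<lblot>a,\<lblot>p,q,b\<rblot>\<^bsub>Psys\<^esub>,c\<rblot>\<^bsub>Psys\<^esub> \<oplus>\<^bsub>E\<^esub> \<lblot>a,b,\<lblot>p,q,c\<rblot>\<^bsub>Psys\<^esub>\<rblot>\<^bsub>Psys\<^esub>"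
    (is "?L p q a b c = ?R p q a b c")
proof -
  have 0: "?L (j x) (j y) (j a) (j b) (j c) = ?R (j x) (j y) (j a) (j b) (j c)"
    if "x \<in> carrier R" "y \<in> carrier R" "a \<in> carrier R" "b \<in> carrier R" "c \<in> carrier R" for x y a b c
    using that derivation[of x y a b c] by (simp add: Psys_base j_add[symmetric])
  have 1: "?L (j x) (j y) (j a) (j b) c = ?R (j x) (j y) (j a) (j b) c"
    if "x \<in> carrier R" "y \<in> carrier R" "a \<in> carrier R" "b \<in> carrier R" "c \<in> P" for x y a b c
    by (rule lin_unique[of "\<lambda>c. ?L (j x) (j y) (j a) (j b) c" "\<lambda>c. ?R (j x) (j y) (j a) (j b) c", OF _ _ _ that(5)]) (intro lin_intros that | (rule 0; simp add: that))+
  have 2: "?L (j x) (j y) (j a) b c = ?R (j x) (j y) (j a) b c"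
    if "x \<in> carrier R" "y \<in> carrier R" "a \<in> carrier R" "b \<in> P" "c \<in> P" for x y a b c
    by (rule lin_unique[of "\<lambda>b. ?L (j x) (j y) (j a) b c" "\<lambda>b. ?R (j x) (j y) (j a) b c", OF _ _ _ that(4)]) (intro lin_intros that | (rule 1; simp add: that))+
  have 3: "?L (j x) (j y) a b c = ?R (j x) (j y) a b c"
    if "x \<in> carrier R" "y \<in> carrier R" "a \<in> P" "b \<in> P" "c \<in> P" for x y a b c
    by (rule lin_unique[of "\<lambda>a. ?L (j x) (j y) a b c" "\<lambda>a. ?R (j x) (j y) a b c", OF _ _ _ that(3)]) (intro lin_intros that | (rule 2; simp add: that))+
  have 4: "?L (j x) q a b c = ?R (j x) q a b c"
    if "x \<in> carrier R" "q \<in> P" "a \<in> P" "b \<in> P" "c \<in> P" for x q a b c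
    by (rule lin_unique[of "\<lambda>q. ?L (j x) q a b c" "\<lambda>q. ?R (j x) q a b c", OF _ _ _ that(2)]) (intro lin_intros that | (rule 3; simp add: that))+
  show ?thesis
    by (rule lin_unique[of "\<lambda>p. ?L p q a b c" "\<lambda>p. ?R p q a b c", OF _ _ _ assms(1)]) (intro lin_intros assms | (rule 4; simp add: assms))+
qed

lemma Psys_triple_lie_system: "triple_lie_system K Psys"
proof -
  interpret module K Psys by (rule P_module) (auto simp: P_system_def)
  show ?thesis
  proof
    fix p q a b c assume "p \<in> carrier Psys" "q \<in> carrier Psys" "a \<in> carrier Psys" "b \<in> carrier Psys" "c \<in> carrier Psys"
    then show "\<lblot>p,q,\<lblot>a,b,c\<rblot>\<^bsub>Psys\<^esub>\<rblot>\<^bsub>Psys\<^esub> = \<lblot>\<lblot>p,q,a\<rblot>\<^bsub>Psys\<^esub>,b,c\<rblot>\<^bsub>Psys\<^esub> \<oplus>\<^bsub>Psys\<^esub>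
        \<lblot>a,\<lblot>p,q,b\<rblot>\<^bsub>Psys\<^esub>,c\<rblot>\<^bsub>Psys\<^esub> \<oplus>\<^bsub>Psys\<^esub> \<lblot>a,b,\<lblot>p,q,c\<rblot>\<^bsub>Psys\<^esub>\<rblot>\<^bsub>Psys\<^esub>"
      unfolding Psys_simps by (rule Psys_derivation)
  qed (simp_all add: Psys_trilinear Psys_alternating Psys_cyclic)
qed

end

text \<open>The properties of \<open>P(R)\<close> over \<open>CM(R)\<close> on which everything below rests: \<open>CM(R)\<close> acts faithfully and
  realises every partial endomorphism, defined on an ideal, of the multiplication module.\<close>

locale closed_system = semiprime_system K T
  for K :: "('a, 'm) ring_scheme" and T :: "('a, 'b, 'n) triple_system_scheme" (structure) +
  assumes faithful: "\<lbrakk>c \<in> carrier K; \<And>x. x \<in> carrier T \<Longrightarrow> c \<odot> x = \<zero>\<rbrakk> \<Longrightarrow> c = \<zero>\<^bsub>K\<^esub>"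
    and partial: "\<lbrakk>triple_ideal K T V; f \<in> V \<rightarrow> carrier T;
      \<And>x y. \<lbrakk>x \<in> V; y \<in> V\<rbrakk> \<Longrightarrow> f (x \<oplus> y) = f x \<oplus> f y;
      \<And>c x. \<lbrakk>c \<in> carrier K; x \<in> V\<rbrakk> \<Longrightarrow> f (c \<odot> x) = c \<odot> f x;
      \<And>x y z. \<lbrakk>x \<in> V; y \<in> carrier T; z \<in> carrier T\<rbrakk> \<Longrightarrow>
        f \<lblot>x,y,z\<rblot> = \<lblot>f x,y,z\<rblot> \<and> f \<lblot>y,x,z\<rblot> = \<lblot>y,f x,z\<rblot> \<and> f \<lblot>y,z,x\<rblot> = \<lblot>y,z,f x\<rblot>\<rbrakk> \<Longrightarrow>
      \<exists>c\<in>carrier K. \<forall>x\<in>V. c \<odot> x = f x"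

section \<open>P(R) as a closed system over CM(R)\<close>

context hull_system
begin

interpretation PS: triple_lie_system K Psys
  by (rule Psys_triple_lie_system)

text \<open>Scalars of F commute with M(R)' on the hull, so each acts on P(R) as an element of
  CM(R). Ideals over CM(R) are therefore stable under F.\<close>

lemma scalar_K:
  assumes c: "c \<in> carrier F"
  shows "(\<lambda>p\<in>P. scalar_op R c \<odot>\<^bsub>E\<^esub> p) \<in> carrier K"
proof -
  note s = scalar_op_mult_ring[OF c]
  show ?thesis
    using s P_closed act_scalar_swap[OF _ c] unfolding K_carrier by (auto simp: rmod_hom_def X.act_r_distr)
qed

text \<open>Multiplications by elements of R are among those by elements of P(R). Consequently the
  essentiality of R in the hull applies to ideals of P(R).\<close>

lemma ideal_submodule:
  assumes "triple_ideal K Psys V"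
  shows "submodule V S E"
proof -
  note V = PS.triple_ideal_mem[OF assms] PS.triple_ideal_triple[OF assms]
  have VP: "v \<in> P" if "v \<in> V" for v using PS.triple_ideal_subset[OF assms] that by auto
  show ?thesis
  proof (rule submodule_multI)
    show "V \<subseteq> carrier E" using VP P_subset by blast
    show "scalar_op R c \<odot>\<^bsub>E\<^esub> x \<in> V" if "c \<in> carrier F" "x \<in> V" for c x
      using V(4)[OF scalar_K[OF that(1)] that(2)] VP[OF that(2)] by simp
    fix y z x assume *: "y \<in> carrier R" "z \<in> carrier R" "x \<in> V"
    then show "mult_op1 R y z \<odot>\<^bsub>E\<^esub> x \<in> V" "mult_op2 R y z \<odot>\<^bsub>E\<^esub> x \<in> V" "mult_op3 R y z \<odot>\<^bsub>E\<^esub> x \<in> V"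
      using V(5-7)[of x "j y" "j z"] by (simp_all add: VP triple_act)
  qed (use V in auto)
qed

lemma P_closed_system: "closed_system K Psys"
proof
  fix I assume I: "triple_ideal K Psys I"
    and z: "\<And>a b r. \<lbrakk>a \<in> I; b \<in> I; r \<in> carrier Psys\<rbrakk> \<Longrightarrow>
      \<lblot>a,b,r\<rblot>\<^bsub>Psys\<^esub> = \<zero>\<^bsub>Psys\<^esub> \<and> \<lblot>a,r,b\<rblot>\<^bsub>Psys\<^esub> = \<zero>\<^bsub>Psys\<^esub>"
  note sub = ideal_submodule[OF I]
  \<comment> \<open>The trace of \<open>I\<close> on R has only zero products and is zero by
    semiprimeness of R, whereas a nonzero \<open>I\<close> would meet R.\<close>
  have "{x \<in> carrier R. j x \<in> I} \<subseteq> {\<zero>}"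
  proof (rule semiprime[OF preimage_ideal[OF sub]])
    fix a b r assume "a \<in> {x \<in> carrier R. j x \<in> I}" "b \<in> {x \<in> carrier R. j x \<in> I}" and r: "r \<in> carrier R"
    then have "j \<lblot>a,b,r\<rblot> = j \<zero>" "j \<lblot>a,r,b\<rblot> = j \<zero>" "a \<in> carrier R" "b \<in> carrier R"
      using z[of "j a" "j b" "j r"] by (simp_all add: Psys_base)
    then show "\<lblot>a,b,r\<rblot> = \<zero> \<and> \<lblot>a,r,b\<rblot> = \<zero>" using r by (simp only: j_eq_iff triple_closed M.zero_closed)
  qed
  then have *: "x = \<zero>" if "x \<in> carrier R" "j x \<in> I" for x using that by blast
  show "I \<subseteq> {\<zero>\<^bsub>Psys\<^esub>}"
  proof (rule subsetI, rule ccontr)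
    fix p assume "p \<in> I" "p \<notin> {\<zero>\<^bsub>Psys\<^esub>}"
    then show False using submodule_meets[OF sub, of p] * by auto
  qed
next
  \<comment> \<open>Scalars are functions on P(R), undefined elsewhere, so faithfulness is
    extensionality.\<close>
  fix c assume "c \<in> carrier K" "\<And>x. x \<in> carrier Psys \<Longrightarrow> c \<odot>\<^bsub>Psys\<^esub> x = \<zero>\<^bsub>Psys\<^esub>"
  then show "c = \<zero>\<^bsub>K\<^esub>" by (auto simp: K_simps K_carrier fun_eq_iff extensional_def)
next
  fix V f
  assume V: "triple_ideal K Psys V" and f: "f \<in> V \<rightarrow> carrier Psys"
    and add: "\<And>x y. \<lbrakk>x \<in> V; y \<in> V\<rbrakk> \<Longrightarrow> f (x \<oplus>\<^bsub>Psys\<^esub> y) = f x \<oplus>\<^bsub>Psys\<^esub> f y"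
    and smult: "\<And>c x. \<lbrakk>c \<in> carrier K; x \<in> V\<rbrakk> \<Longrightarrow> f (c \<odot>\<^bsub>Psys\<^esub> x) = c \<odot>\<^bsub>Psys\<^esub> f x"
    and triple: "\<And>x y z. \<lbrakk>x \<in> V; y \<in> carrier Psys; z \<in> carrier Psys\<rbrakk> \<Longrightarrow>
        f \<lblot>x,y,z\<rblot>\<^bsub>Psys\<^esub> = \<lblot>f x,y,z\<rblot>\<^bsub>Psys\<^esub> \<and> f \<lblot>y,x,z\<rblot>\<^bsub>Psys\<^esub> = \<lblot>y,f x,z\<rblot>\<^bsub>Psys\<^esub> \<and>
        f \<lblot>y,z,x\<rblot>\<^bsub>Psys\<^esub> = \<lblot>y,z,f x\<rblot>\<^bsub>Psys\<^esub>"
  note sub = ideal_submodule[OF V]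
  have VP: "v \<in> P" "f v \<in> P" if "v \<in> V" for v using PS.triple_ideal_subset[OF V] that f by auto
  interpret VX: mult_module F R "E\<lparr>carrier := V\<rparr>"
    by (intro mult_module.intro triple_lie_system_axioms X.right_module_submodule[OF sub])
  \<comment> \<open>Compatibility with P(R) contains compatibility with R, which by
    \<open>triple_act\<close> is linearity over M(R)'; injectivity of the hull then yields the
    scalar.\<close>
  have "f \<in> rmod_hom S (E\<lparr>carrier := V\<rparr>) E"
  proof (rule VX.rmod_hom_multI[OF X.right_module_axioms])
    show "f \<in> carrier (E\<lparr>carrier := V\<rparr>) \<rightarrow> carrier E" using VP(2) P_subset by auto
    show "f (scalar_op R c \<odot>\<^bsub>E\<lparr>carrier := V\<rparr>\<^esub> x) = scalar_op R c \<odot>\<^bsub>E\<^esub> f x"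
      if "c \<in> carrier F" "x \<in> carrier (E\<lparr>carrier := V\<rparr>)" for c x
      using smult[OF scalar_K[OF that(1)], of x] that VP by simp
    fix y z x assume *: "y \<in> carrier R" "z \<in> carrier R" "x \<in> carrier (E\<lparr>carrier := V\<rparr>)"
    then show "f (mult_op1 R y z \<odot>\<^bsub>E\<lparr>carrier := V\<rparr>\<^esub> x) = mult_op1 R y z \<odot>\<^bsub>E\<^esub> f x"
      "f (mult_op2 R y z \<odot>\<^bsub>E\<lparr>carrier := V\<rparr>\<^esub> x) = mult_op2 R y z \<odot>\<^bsub>E\<^esub> f x"
      "f (mult_op3 R y z \<odot>\<^bsub>E\<lparr>carrier := V\<rparr>\<^esub> x) = mult_op3 R y z \<odot>\<^bsub>E\<^esub> f x"
      using triple[of x "j y" "j z"] by (simp_all add: VP triple_act)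
  qed (use add in auto)
  moreover have "V \<subseteq> P" using VP by blast
  ultimately obtain c where "c \<in> carrier K" "\<And>v. v \<in> V \<Longrightarrow> c v = f v" using K_partial[OF sub] by blast
  then show "\<exists>c\<in>carrier K. \<forall>x\<in>V. c \<odot>\<^bsub>Psys\<^esub> x = f x" by auto
qed

section \<open>P(R) over F as a system of quotients of R\<close>

abbreviation Pbase where "Pbase \<equiv> P_system_base F R E j"

lemma Pbase_simps [simp]:
  "carrier Pbase = P" "\<zero>\<^bsub>Pbase\<^esub> = \<zero>\<^bsub>E\<^esub>" "p \<oplus>\<^bsub>Pbase\<^esub> q = p \<oplus>\<^bsub>E\<^esub> q" "c \<odot>\<^bsub>Pbase\<^esub> p = scalar_op R c \<odot>\<^bsub>E\<^esub> p"
  "triple Pbase = triple Psys"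
  by (simp_all add: P_system_base_def P_system_def scalar_module_def)

lemma Pbase_triple_lie_system: "triple_lie_system F Pbase"
proof -
  interpret SM: module F "scalar_module R E" by (rule scalar_module_module)
  have s [simp]: "carrier (scalar_module R E) = carrier E" "a \<oplus>\<^bsub>scalar_module R E\<^esub> b = a \<oplus>\<^bsub>E\<^esub> b"
    "c \<odot>\<^bsub>scalar_module R E\<^esub> b = scalar_op R c \<odot>\<^bsub>E\<^esub> b" for a b c
    by (simp_all add: scalar_module_def)
  have "abelian_group Pbase" by (rule P_abelian_group) (simp_all add: P_system_base_def)
  then have "module F Pbase"
    using SM.smult_l_distr SM.smult_r_distr SM.smult_assoc1 SM.smult_one P_closed scalar_op_mult_ring
    by (intro moduleI R.cring_axioms) auto
  then interpret PM: module F Pbase .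
  show ?thesis
  proof
    have "\<lblot>scalar_op R c \<odot>\<^bsub>E\<^esub> x,y,z\<rblot>\<^bsub>Psys\<^esub> = scalar_op R c \<odot>\<^bsub>E\<^esub> \<lblot>x,y,z\<rblot>\<^bsub>Psys\<^esub>"
      "\<lblot>x,scalar_op R c \<odot>\<^bsub>E\<^esub> y,z\<rblot>\<^bsub>Psys\<^esub> = scalar_op R c \<odot>\<^bsub>E\<^esub> \<lblot>x,y,z\<rblot>\<^bsub>Psys\<^esub>"
      "\<lblot>x,y,scalar_op R c \<odot>\<^bsub>E\<^esub> z\<rblot>\<^bsub>Psys\<^esub> = scalar_op R c \<odot>\<^bsub>E\<^esub> \<lblot>x,y,z\<rblot>\<^bsub>Psys\<^esub>"
      if "c \<in> carrier F" "x \<in> P" "y \<in> P" "z \<in> P" for c x y z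
      using PS.triple_smult[OF scalar_K[OF that(1)], of x y z] that triple_P by simp_all
    then show "trilinear F Pbase (triple Pbase)"
      using PS.triple_add unfolding trilinear_def by (auto simp: triple_P)
    show "\<lblot>x,x,y\<rblot>\<^bsub>Pbase\<^esub> = \<zero>\<^bsub>Pbase\<^esub>" if "x \<in> carrier Pbase" "y \<in> carrier Pbase" for x y
      using that Psys_alternating by simp
    show "\<lblot>x,y,z\<rblot>\<^bsub>Pbase\<^esub> \<oplus>\<^bsub>Pbase\<^esub> \<lblot>y,z,x\<rblot>\<^bsub>Pbase\<^esub> \<oplus>\<^bsub>Pbase\<^esub> \<lblot>z,x,y\<rblot>\<^bsub>Pbase\<^esub> = \<zero>\<^bsub>Pbase\<^esub>"
      if "x \<in> carrier Pbase" "y \<in> carrier Pbase" "z \<in> carrier Pbase" for x y z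
      using that Psys_cyclic by simp
    show "\<lblot>x,y,\<lblot>a,b,c\<rblot>\<^bsub>Pbase\<^esub>\<rblot>\<^bsub>Pbase\<^esub> = \<lblot>\<lblot>x,y,a\<rblot>\<^bsub>Pbase\<^esub>,b,c\<rblot>\<^bsub>Pbase\<^esub> \<oplus>\<^bsub>Pbase\<^esub>
        \<lblot>a,\<lblot>x,y,b\<rblot>\<^bsub>Pbase\<^esub>,c\<rblot>\<^bsub>Pbase\<^esub> \<oplus>\<^bsub>Pbase\<^esub> \<lblot>a,b,\<lblot>x,y,c\<rblot>\<^bsub>Pbase\<^esub>\<rblot>\<^bsub>Pbase\<^esub>"
      if "x \<in> carrier Pbase" "y \<in> carrier Pbase" "a \<in> carrier Pbase" "b \<in> carrier Pbase" "c \<in> carrier Pbase"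
      for x y a b c
      using that unfolding Pbase_simps by (rule Psys_derivation)
  qed
qed

lemma Pbase_embedding: "triple_embedding F R Pbase j"
  using triple_lie_system_axioms Pbase_triple_lie_system
  by (auto simp: triple_embedding_def inj_on_def j_add j_ops Psys_base)

text \<open>For h (j x) the denominators of h serve: [h (j x), j a, j z] equals h (j [x,a,z]), and h
  can be read on a instead, where its value lies in R. Sums are handled by intersecting
  ideals.\<close>

lemma P_denominator_ideal:
  assumes "p \<in> P"
  shows "\<exists>N. denominator_ideal F R Pbase j p N"
  unfolding denominator_ideal_def Pbase_simps(5)
  using assms
proof (induction rule: P_gen_induct)
  case (gen h x)
  have "\<lblot>h (j x),j a,j z\<rblot>\<^bsub>Psys\<^esub> \<in> j ` carrier R \<and> \<lblot>h (j x),j z,j a\<rblot>\<^bsub>Psys\<^esub> \<in> j ` carrier R"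
    if a: "a \<in> denominators h" and z: "z \<in> carrier R" for a z
  proof -
    obtain b where b: "a \<in> carrier R" "b \<in> carrier R" "h (j a) = j b"
      using a unfolding denominators_def by blast
    have "mult_op1 R a z \<odot>\<^bsub>E\<^esub> h (j x) = j \<lblot>x,b,z\<rblot>"
      using HE_ops(1)[OF gen b(1) z] HE_ops(2)[OF gen b(1) z] b z gen by (simp add: j_ops)
    moreover have "mult_op1 R z a \<odot>\<^bsub>E\<^esub> h (j x) = j \<lblot>x,z,b\<rblot>"
      using HE_ops(1)[OF gen z b(1)] HE_ops(3)[OF gen z b(1)] b z gen by (simp add: j_ops)
    ultimately show ?thesis using b z gen P_gen[OF gen] by (simp add: triple_act)
  qed
  then show ?case using denominators_ideal denominators_ann gen by blast
next
  case (add p q)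
  then obtain I J where I: "triple_ideal F R I" "triple_ann R I = {\<zero>}"
      "\<forall>a\<in>I. \<forall>z\<in>carrier R. \<lblot>p,j a,j z\<rblot>\<^bsub>Psys\<^esub> \<in> j ` carrier R \<and> \<lblot>p,j z,j a\<rblot>\<^bsub>Psys\<^esub> \<in> j ` carrier R"
    and J: "triple_ideal F R J" "triple_ann R J = {\<zero>}"
      "\<forall>a\<in>J. \<forall>z\<in>carrier R. \<lblot>q,j a,j z\<rblot>\<^bsub>Psys\<^esub> \<in> j ` carrier R \<and> \<lblot>q,j z,j a\<rblot>\<^bsub>Psys\<^esub> \<in> j ` carrier R"
    by blast
  note jR = X.submoduleD(3)[OF image_ideal[OF triple_ideal_carrier]]
  have "\<lblot>p \<oplus>\<^bsub>E\<^esub> q,j a,j z\<rblot>\<^bsub>Psys\<^esub> \<in> j ` carrier R \<and> \<lblot>p \<oplus>\<^bsub>E\<^esub> q,j z,j a\<rblot>\<^bsub>Psys\<^esub> \<in> j ` carrier R"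
    if "a \<in> I \<inter> J" "z \<in> carrier R" for a z
  proof -
    have "a \<in> carrier R" using that triple_ideal_subset[OF I(1)] by blast
    then show ?thesis
      using PS.triple_add(1)[of p q "j a" "j z"] PS.triple_add(1)[of p q "j z" "j a"] add that I(3) J(3) jR by simp
  qed
  then show ?case using triple_ideal_Int[OF I(1) J(1)] ann_Int_zero[OF I(1,2) J(1,2)] by blast
qed

text \<open>An ideal of R with zero annihilator kills no nonzero element of P(R), because nonzero
  submodules of the hull meet R. So any denominator ideal of p detects p as well.\<close>

lemma Pbase_quotient_system: "quotient_system F R Pbase j"
proof -
  interpret B: embedded_system F R Pbase j by (rule embedded_systemI[OF Pbase_embedding])
  have nonsingular: "p = \<zero>\<^bsub>Pbase\<^esub>"
    if N: "triple_ideal F R N" "triple_ann R N = {\<zero>}" and p: "p \<in> carrier Pbase" "kills R Pbase j p N" for p N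
  proof (rule B.essential_nonsingular[OF N p])
    fix Z assume ZP: "Z \<subseteq> carrier Pbase" and "\<zero>\<^bsub>Pbase\<^esub> \<in> Z"
      "\<And>u v. \<lbrakk>u \<in> Z; v \<in> Z\<rbrakk> \<Longrightarrow> u \<oplus>\<^bsub>Pbase\<^esub> v \<in> Z" "\<And>c u. \<lbrakk>c \<in> carrier F; u \<in> Z\<rbrakk> \<Longrightarrow> c \<odot>\<^bsub>Pbase\<^esub> u \<in> Z"
      and Zt: "\<And>u y z. \<lbrakk>u \<in> Z; y \<in> carrier R; z \<in> carrier R\<rbrakk> \<Longrightarrow>
        \<lblot>u,j y,j z\<rblot>\<^bsub>Pbase\<^esub> \<in> Z \<and> \<lblot>j y,u,j z\<rblot>\<^bsub>Pbase\<^esub> \<in> Z \<and> \<lblot>j y,j z,u\<rblot>\<^bsub>Pbase\<^esub> \<in> Z"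
      and pZ: "p \<in> Z" "p \<noteq> \<zero>\<^bsub>Pbase\<^esub>"
    have ZP': "u \<in> P" if "u \<in> Z" for u using ZP that by auto
    have "submodule Z S E"
    proof (rule submodule_multI)
      show "Z \<subseteq> carrier E" using ZP' P_subset by blast
      fix y z u assume *: "y \<in> carrier R" "z \<in> carrier R" "u \<in> Z"
      then show "mult_op1 R y z \<odot>\<^bsub>E\<^esub> u \<in> Z" "mult_op2 R y z \<odot>\<^bsub>E\<^esub> u \<in> Z" "mult_op3 R y z \<odot>\<^bsub>E\<^esub> u \<in> Z"
        using Zt[OF *(3,1,2)] triple_act[OF ZP'[OF *(3)] *(1,2)] by simp_all
    qed (use \<open>\<zero>\<^bsub>Pbase\<^esub> \<in> Z\<close> \<open>\<And>u v. \<lbrakk>u \<in> Z; v \<in> Z\<rbrakk> \<Longrightarrow> u \<oplus>\<^bsub>Pbase\<^esub> v \<in> Z\<close>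
        \<open>\<And>c u. \<lbrakk>c \<in> carrier F; u \<in> Z\<rbrakk> \<Longrightarrow> c \<odot>\<^bsub>Pbase\<^esub> u \<in> Z\<close> in simp_all)
    then show "\<exists>x\<in>carrier R. x \<noteq> \<zero> \<and> j x \<in> Z" using submodule_meets[OF _ pZ(1)] pZ(2) by auto
  qed
  show ?thesis
    unfolding B.quotient_system_iff
  proof (intro ballI impI)
    fix p assume p: "p \<in> carrier Pbase" "p \<noteq> \<zero>\<^bsub>Pbase\<^esub>"
    then obtain N where "B.denom p N" using P_denominator_ideal by auto
    then show "\<exists>I. B.denom p I \<and> \<not> kills R Pbase j p I" using nonsingular B.denomD(1,2) p by blast
  qed
qed

end

section \<open>Idempotents and orthogonal sums\<close>

context cring
begin

lemma idempotents_closed: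
  assumes "a \<in> idempotents R" "b \<in> idempotents R"
  shows "a \<otimes> b \<in> idempotents R"
proof -
  have c: "a \<in> carrier R" "b \<in> carrier R" using assms by (auto simp: idempotents_def)
  have "a \<otimes> b \<otimes> (a \<otimes> b) = (a \<otimes> a) \<otimes> (b \<otimes> b)" using c by (simp add: m_ac)
  then show ?thesis using assms c by (simp add: idempotents_def)
qed

lemma idempotent_compl:
  assumes "a \<in> idempotents R"
  shows "\<one> \<ominus> a \<in> idempotents R" "(\<one> \<ominus> a) \<otimes> a = \<zero>" "a \<otimes> (\<one> \<ominus> a) = \<zero>"
proof -
  have a: "a \<in> carrier R" "a \<otimes> a = a" using assms by (auto simp: idempotents_def)
  show 1: "(\<one> \<ominus> a) \<otimes> a = \<zero>" using a by (simp add: a_minus_def l_distr l_minus r_neg)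
  then show "a \<otimes> (\<one> \<ominus> a) = \<zero>" using a m_comm[of a "\<one> \<ominus> a"] by simp
  then have "(\<one> \<ominus> a) \<otimes> (\<one> \<ominus> a) = \<one> \<ominus> a"
    using a l_distr[of \<one> "\<ominus> a" "\<one> \<ominus> a"] by (simp add: a_minus_def l_minus)
  then show "\<one> \<ominus> a \<in> idempotents R" using a by (simp add: idempotents_def)
qed

lemma dense_orthogonalD:
  assumes "dense_orthogonal R D"
  shows "d \<in> D \<Longrightarrow> d \<in> idempotents R" "d \<in> D \<Longrightarrow> d \<in> carrier R" "d \<in> D \<Longrightarrow> d \<otimes> d = d"
    "\<lbrakk>d \<in> D; e \<in> D; d \<noteq> e\<rbrakk> \<Longrightarrow> d \<otimes> e = \<zero>"
    "\<lbrakk>b \<in> idempotents R; \<And>d. d \<in> D \<Longrightarrow> b \<otimes> d = \<zero>\<rbrakk> \<Longrightarrow> b = \<zero>"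
  using assms unfolding dense_orthogonal_def by (auto simp: idempotents_def)

lemma dense_orthogonalI:
  assumes "D \<subseteq> idempotents R" "\<And>d e. \<lbrakk>d \<in> D; e \<in> D; d \<noteq> e\<rbrakk> \<Longrightarrow> d \<otimes> e = \<zero>"
    and "\<And>b. \<lbrakk>b \<in> idempotents R; \<And>d. d \<in> D \<Longrightarrow> b \<otimes> d = \<zero>\<rbrakk> \<Longrightarrow> b = \<zero>"
  shows "dense_orthogonal R D"
proof -
  have "{b \<in> idempotents R. \<forall>d\<in>D. b \<otimes> d = \<zero>} = {\<zero>}"
    using assms(1,3) by (auto simp: idempotents_def subset_iff)
  then show ?thesis using assms unfolding dense_orthogonal_def by simp
qed

text \<open>Needed when every piece d carries a partition \<open>G d\<close> of its own. For
  density, an idempotent b orthogonal to all products has b d orthogonal to \<open>G d\<close>, so b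
  d = 0 for every d.\<close>

lemma dense_orthogonal_refine:
  assumes D: "dense_orthogonal R D" and G: "\<And>d. d \<in> D \<Longrightarrow> dense_orthogonal R (G d)"
  shows "dense_orthogonal R {d \<otimes> e | d e. d \<in> D \<and> e \<in> G d}"
proof (rule dense_orthogonalI)
  note D = dense_orthogonalD[OF D] and G = dense_orthogonalD[OF G]
  show "{d \<otimes> e |d e. d \<in> D \<and> e \<in> G d} \<subseteq> idempotents R" using D(1) G(1) idempotents_closed by blast
  fix u v assume "u \<in> {d \<otimes> e |d e. d \<in> D \<and> e \<in> G d}" "v \<in> {d \<otimes> e |d e. d \<in> D \<and> e \<in> G d}" and ne: "u \<noteq> v"
  then obtain d e d' e' where *: "d \<in> D" "e \<in> G d" "u = d \<otimes> e" "d' \<in> D" "e' \<in> G d'" "v = d' \<otimes> e'" by blast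
  note c = D(2)[OF *(1)] D(2)[OF *(4)] G(2)[OF *(1,2)] G(2)[OF *(4,5)]
  have "u \<otimes> v = (d \<otimes> d') \<otimes> (e \<otimes> e')" using c *(3,6) by (simp add: m_ac)
  \<comment> \<open>If d = d', then e and e' are different members of the same set
    \<open>G d\<close>.\<close>
  moreover have "d \<otimes> d' = \<zero> \<or> e \<otimes> e' = \<zero>"
    using D(4)[OF *(1,4)] G(4)[of d e e'] * ne by metis
  ultimately show "u \<otimes> v = \<zero>" using c by auto
next
  fix b assume b: "b \<in> idempotents R" and z: "\<And>u. u \<in> {d \<otimes> e |d e. d \<in> D \<and> e \<in> G d} \<Longrightarrow> b \<otimes> u = \<zero>"
  have bc: "b \<in> carrier R" using b by (simp add: idempotents_def)
  show "b = \<zero>"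
  proof (rule dense_orthogonalD(5)[OF D b])
    fix d assume d: "d \<in> D"
    show "b \<otimes> d = \<zero>"
    proof (rule dense_orthogonalD(5)[OF G[OF d]])
      show "b \<otimes> d \<in> idempotents R" using idempotents_closed[OF b dense_orthogonalD(1)[OF D d]] .
      fix e assume e: "e \<in> G d"
      have "b \<otimes> (d \<otimes> e) = \<zero>" using z d e by blast
      then show "b \<otimes> d \<otimes> e = \<zero>"
        using m_assoc[OF bc dense_orthogonalD(2)[OF D d] dense_orthogonalD(2)[OF G[OF d] e]] by simp
    qed
  qed
qed

text \<open>Zorn's lemma gives a maximal orthogonal set of idempotents with the property. A nonzero
  idempotent orthogonal to it would have a nonzero part b with the property; b could be adjoined,
  and being orthogonal to itself it would be zero.\<close>

lemma exists_dense_orthogonal: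
  assumes ex: "\<And>c. \<lbrakk>c \<in> idempotents R; c \<noteq> \<zero>\<rbrakk> \<Longrightarrow> \<exists>b\<in>idempotents R. b \<noteq> \<zero> \<and> b \<otimes> c = b \<and> Pr b"
  obtains D where "dense_orthogonal R D" "\<And>b. b \<in> D \<Longrightarrow> Pr b"
proof -
  define \<A> where "\<A> = {D. D \<subseteq> idempotents R \<and> (\<forall>d\<in>D. \<forall>e\<in>D. d \<noteq> e \<longrightarrow> d \<otimes> e = \<zero>) \<and> (\<forall>d\<in>D. Pr d)}"
  have "\<Union>C \<in> \<A>" if C: "subset.chain \<A> C" for C
  proof -
    have "d \<otimes> e = \<zero>" if de: "d \<in> \<Union>C" "e \<in> \<Union>C" "d \<noteq> e" for d e
    proof -
      obtain X Y where XY: "X \<in> C" "Y \<in> C" "d \<in> X" "e \<in> Y" using de by blast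
      then have "X \<subseteq> Y \<or> Y \<subseteq> X" using C by (auto simp: subset.chain_def)
      then obtain Z where "Z \<in> C" "d \<in> Z" "e \<in> Z" using XY by blast
      then show ?thesis using C de(3) by (auto simp: subset.chain_def \<A>_def)
    qed
    then show ?thesis using C by (auto simp: subset.chain_def \<A>_def)
  qed
  then obtain D where D: "D \<in> \<A>" and max: "\<And>X. \<lbrakk>X \<in> \<A>; D \<subseteq> X\<rbrakk> \<Longrightarrow> X = D"
    using subset_Zorn'[of \<A>] by blast
  have "c = \<zero>" if c: "c \<in> idempotents R" and z: "\<And>d. d \<in> D \<Longrightarrow> c \<otimes> d = \<zero>" for c
  proof (rule ccontr)
    assume "c \<noteq> \<zero>"
    then obtain b where b: "b \<in> idempotents R" "b \<noteq> \<zero>" "b \<otimes> c = b" "Pr b" using ex c by blast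
    have cc: "b \<in> carrier R" "c \<in> carrier R" using b c by (auto simp: idempotents_def)
    have bd: "b \<otimes> d = \<zero>" "d \<otimes> b = \<zero>" if d: "d \<in> D" for d
    proof -
      have dc: "d \<in> carrier R" using D d by (auto simp: \<A>_def idempotents_def)
      have "b \<otimes> d = b \<otimes> (c \<otimes> d)" using m_assoc[OF cc dc] b(3) by simp
      then show "b \<otimes> d = \<zero>" using z[OF d] cc by simp
      then show "d \<otimes> b = \<zero>" using m_comm[OF cc(1) dc] by simp
    qed
    have "insert b D \<in> \<A>" using D b bd unfolding \<A>_def by auto
    then have "b \<in> D" using max by blast
    then have "b \<otimes> b = \<zero>" using bd by blast
    then show False using b by (simp add: idempotents_def)
  qed
  then have "dense_orthogonal R D" using D by (intro dense_orthogonalI) (auto simp: \<A>_def)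
  then show thesis using that D by (auto simp: \<A>_def)
qed

end

text \<open>Used to compare two decompositions of one element: the difference then lies in both
  summands.\<close>

lemma (in abelian_group) add_eq_minus_eq:
  assumes "a \<in> carrier G" "b \<in> carrier G" "c \<in> carrier G" "d \<in> carrier G" "a \<oplus> b = c \<oplus> d"
  shows "a \<oplus> \<ominus> c = d \<oplus> \<ominus> b"
proof -
  have "a \<oplus> \<ominus> c = (a \<oplus> b) \<oplus> (\<ominus> b \<oplus> \<ominus> c)" using assms(1-4) by (simp add: a_assoc r_neg2 r_neg1)
  also have "\<dots> = (d \<oplus> c) \<oplus> (\<ominus> c \<oplus> \<ominus> b)" using assms by (simp add: a_comm)
  also have "\<dots> = d \<oplus> \<ominus> b" using assms(1-4) by (simp add: a_assoc r_neg2 r_neg1)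
  finally show ?thesis .
qed

section \<open>Support idempotents\<close>

context closed_system
begin

text \<open>If b kills \<open>V\<close>, then [b x,v,y] = [x,b v,y] = 0, and likewise with v and y
  interchanged; so b x lies in the annihilator of \<open>V\<close>, and b is zero by
  faithfulness.\<close>

lemma scalar_eqI:
  assumes V: "triple_ideal K T V" "triple_ann T V = {\<zero>}" and c: "c \<in> carrier K" "d \<in> carrier K"
    and eq: "\<And>v. v \<in> V \<Longrightarrow> c \<odot> v = d \<odot> v"
  shows "c = d"
proof -
  define b where "b = c \<oplus>\<^bsub>K\<^esub> \<ominus>\<^bsub>K\<^esub> d"
  have b: "b \<in> carrier K" using c by (simp add: b_def)
  note Vc = subsetD[OF triple_ideal_subset[OF V(1)]]
  have bV: "b \<odot> v = \<zero>" if "v \<in> V" for v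
    using eq[OF that] Vc[OF that] c by (simp add: b_def smult_l_distr smult_l_minus M.r_neg)
  have "b \<odot> x = \<zero>" if x: "x \<in> carrier T" for x
  proof -
    have "\<lblot>b \<odot> x,v,y\<rblot> = \<zero> \<and> \<lblot>b \<odot> x,y,v\<rblot> = \<zero>" if v: "v \<in> V" and y: "y \<in> carrier T" for v y
    proof -
      have "\<lblot>b \<odot> x,v,y\<rblot> = \<lblot>x,b \<odot> v,y\<rblot>" "\<lblot>b \<odot> x,y,v\<rblot> = \<lblot>x,y,b \<odot> v\<rblot>" using b x y Vc[OF v] by (simp_all add: triple_smult)
      then show ?thesis using bV[OF v] x y by simp
    qed
    then have "b \<odot> x \<in> triple_ann T V" using b x by (auto simp: triple_ann_def)
    then show ?thesis using V(2) by simp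
  qed
  then have "b = \<zero>\<^bsub>K\<^esub>" using faithful b by blast
  then show ?thesis using c R.minus_equality[of c "\<ominus>\<^bsub>K\<^esub> d"] by (simp add: b_def)
qed

text \<open>The projection of L + Ann L onto L is a partial endomorphism, hence given by a scalar s.
  It is the smallest idempotent acting as the identity on \<open>L\<close>, which the last
  conclusion expresses through the scalars killing \<open>L\<close>.\<close>

lemma support_ideal:
  assumes L: "triple_ideal K T L"
  obtains s where "s \<in> idempotents K" "\<And>y. y \<in> L \<Longrightarrow> s \<odot> y = y"
    "\<forall>b\<in>carrier K. (\<forall>y\<in>L. b \<odot> y = \<zero>) \<longrightarrow> b \<otimes>\<^bsub>K\<^esub> s = \<zero>\<^bsub>K\<^esub>"
proof -
  define A where "A = triple_ann T L"
  have A: "triple_ideal K T A" unfolding A_def by (rule triple_ideal_ann[OF L])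
  define V where "V = {l \<oplus> a | l a. l \<in> L \<and> a \<in> A}"
  note Lc = subsetD[OF triple_ideal_subset[OF L]] and Ac = subsetD[OF triple_ideal_subset[OF A]]
  note Lm = triple_ideal_mem[OF L] and Am = triple_ideal_mem[OF A]
  note Lt = triple_ideal_triple[OF L] and At = triple_ideal_triple[OF A]
  have VI: "l \<oplus> a \<in> V" if "l \<in> L" "a \<in> A" for l a using that V_def by blast
  have VE: "\<exists>l\<in>L. \<exists>a\<in>A. v = l \<oplus> a" if "v \<in> V" for v using that V_def by blast
  have LV: "l \<in> V" if "l \<in> L" for l using VI[OF that Am(1)] Lc[OF that] by simp
  have AV: "a \<in> V" if "a \<in> A" for a using VI[OF Lm(1) that] Ac[OF that] by simp
  have Vadd: "(l \<oplus> a) \<oplus> (l' \<oplus> a') = (l \<oplus> l') \<oplus> (a \<oplus> a')" if "l \<in> L" "a \<in> A" "l' \<in> L" "a' \<in> A" for l a l' a'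
    using that Lc Ac by (simp add: M.a_ac)
  have Vtriple: "\<lblot>l \<oplus> a,y,z\<rblot> = \<lblot>l,y,z\<rblot> \<oplus> \<lblot>a,y,z\<rblot>" "\<lblot>y,l \<oplus> a,z\<rblot> = \<lblot>y,l,z\<rblot> \<oplus> \<lblot>y,a,z\<rblot>"
      "\<lblot>y,z,l \<oplus> a\<rblot> = \<lblot>y,z,l\<rblot> \<oplus> \<lblot>y,z,a\<rblot>"
    if "l \<in> L" "a \<in> A" "y \<in> carrier T" "z \<in> carrier T" for l a y z
    using that Lc Ac by (simp_all add: triple_add)
  have V: "triple_ideal K T V"
  proof (rule triple_idealI)
    show "V \<subseteq> carrier T" using VE Lc Ac by force
    show "\<zero> \<in> V" using LV Lm(1) by blast
    show "x \<oplus> y \<in> V" if xy: "x \<in> V" "y \<in> V" for x y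
    proof -
      obtain l a l' a' where "l \<in> L" "a \<in> A" "l' \<in> L" "a' \<in> A" "x = l \<oplus> a" "y = l' \<oplus> a'"
        using VE[OF xy(1)] VE[OF xy(2)] by blast
      then show ?thesis using VI[OF Lm(2) Am(2), of l l' a a'] Vadd[of l a l' a'] by simp
    qed
    show "c \<odot> x \<in> V" if cx: "c \<in> carrier K" "x \<in> V" for c x
    proof -
      obtain l a where "l \<in> L" "a \<in> A" "x = l \<oplus> a" using VE[OF cx(2)] by blast
      then show ?thesis using VI[OF Lm(4) Am(4), of c l c a] Lc[of l] Ac[of a] cx(1) by (simp add: smult_r_distr)
    qed
    show "\<lblot>x,y,z\<rblot> \<in> V" if xyz: "x \<in> V" "y \<in> carrier T" "z \<in> carrier T" for x y z
    proof -
      obtain l a where "l \<in> L" "a \<in> A" "x = l \<oplus> a" using VE[OF xyz(1)] by blast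
      then show ?thesis using VI[OF Lt(1) At(1), of l y z a y z] xyz(2,3) by (simp add: Vtriple)
    qed
  qed
  \<comment> \<open>The component in \<open>L\<close> is picked by choice, but semiprimeness makes L
    and Ann L meet in zero, so it is unique.\<close>
  define f where "f v = (SOME l. l \<in> L \<and> (\<exists>a\<in>A. v = l \<oplus> a))" for v
  have f: "f (l \<oplus> a) = l" if la: "l \<in> L" "a \<in> A" for l a
  proof -
    have "\<exists>l'. l' \<in> L \<and> (\<exists>a'\<in>A. l \<oplus> a = l' \<oplus> a')" using la by blast
    then have "f (l \<oplus> a) \<in> L \<and> (\<exists>a'\<in>A. l \<oplus> a = f (l \<oplus> a) \<oplus> a')" unfolding f_def by (rule someI_ex)
    then obtain l' a' where *: "l' = f (l \<oplus> a)" "l' \<in> L" "a' \<in> A" "l \<oplus> a = l' \<oplus> a'" by blast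
    have "l \<oplus> \<ominus> l' = a' \<oplus> \<ominus> a" using M.add_eq_minus_eq la * Lc Ac by blast
    moreover have "l \<oplus> \<ominus> l' \<in> L" "a' \<oplus> \<ominus> a \<in> A" using la * Lm Am by auto
    ultimately have "l \<oplus> \<ominus> l' = \<zero>" using ann_inter[OF L] unfolding A_def by simp
    then have "l = l'" using Lc[OF la(1)] Lc[OF *(2)] M.minus_equality[of l "\<ominus> l'"] by simp
    then show ?thesis using *(1) by simp
  qed
  have "\<exists>c\<in>carrier K. \<forall>x\<in>V. c \<odot> x = f x"
  proof (rule partial[OF V])
    show "f \<in> V \<rightarrow> carrier T" using VE f Lc by force
    show "f (x \<oplus> y) = f x \<oplus> f y" if xy: "x \<in> V" "y \<in> V" for x y
    proof -
      obtain l a l' a' where "l \<in> L" "a \<in> A" "l' \<in> L" "a' \<in> A" "x = l \<oplus> a" "y = l' \<oplus> a'"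
        using VE[OF xy(1)] VE[OF xy(2)] by blast
      then show ?thesis using f[OF Lm(2) Am(2), of l l' a a'] Vadd[of l a l' a'] by (simp add: f)
    qed
    show "f (c \<odot> x) = c \<odot> f x" if cx: "c \<in> carrier K" "x \<in> V" for c x
    proof -
      obtain l a where "l \<in> L" "a \<in> A" "x = l \<oplus> a" using VE[OF cx(2)] by blast
      then show ?thesis using f[OF Lm(4) Am(4), of c l c a] Lc[of l] Ac[of a] cx(1) by (simp add: smult_r_distr f)
    qed
    show "f \<lblot>x,y,z\<rblot> = \<lblot>f x,y,z\<rblot> \<and> f \<lblot>y,x,z\<rblot> = \<lblot>y,f x,z\<rblot> \<and> f \<lblot>y,z,x\<rblot> = \<lblot>y,z,f x\<rblot>"
      if xyz: "x \<in> V" "y \<in> carrier T" "z \<in> carrier T" for x y z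
    proof -
      obtain l a where "l \<in> L" "a \<in> A" "x = l \<oplus> a" using VE[OF xyz(1)] by blast
      then show ?thesis
        using f[OF Lt(1) At(1), of l y z a y z] f[OF Lt(2) At(2), of l y z a y z] f[OF Lt(3) At(3), of l y z a y z] xyz(2,3)
        by (simp add: Vtriple f)
    qed
  qed
  then obtain s where s: "s \<in> carrier K" "\<And>x. x \<in> V \<Longrightarrow> s \<odot> x = f x" by blast
  have sL: "s \<odot> l = l" if "l \<in> L" for l
    using s(2)[OF LV[OF that]] f[OF that Am(1)] Lc[OF that] by simp
  have sA: "s \<odot> a = \<zero>" if "a \<in> A" for a
    using s(2)[OF AV[OF that]] f[OF Lm(1) that] Ac[OF that] by simp
  have sV: "s \<odot> (l \<oplus> a) = l" if "l \<in> L" "a \<in> A" for l a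
    using that s(1) Lc Ac by (simp add: smult_r_distr sL sA)
  \<comment> \<open>If an ideal J misses \<open>V\<close>, its products with \<open>L\<close> lie in
    J and in L and so vanish; thus J is contained in Ann L, hence in \<open>V\<close>, and is
    zero.\<close>
  have annV: "triple_ann T V = {\<zero>}"
  proof (rule ann_zeroI[OF V])
    fix J assume J: "triple_ideal K T J" "V \<inter> J \<subseteq> {\<zero>}"
    note Jc = subsetD[OF triple_ideal_subset[OF J(1)]]
    have "x \<in> A" if x: "x \<in> J" for x
    proof -
      have "\<lblot>x,l,y\<rblot> = \<zero> \<and> \<lblot>x,y,l\<rblot> = \<zero>" if "l \<in> L" "y \<in> carrier T" for l y
        using J(2) LV[OF Lt(2)[OF that(1) Jc[OF x] that(2)]] LV[OF Lt(3)[OF that(1) Jc[OF x] that(2)]]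
          triple_ideal_triple(1)[OF J(1) x Lc[OF that(1)] that(2)] triple_ideal_triple(1)[OF J(1) x that(2) Lc[OF that(1)]]
        by blast
      then show ?thesis using Jc[OF x] by (auto simp: A_def triple_ann_def)
    qed
    then show "J \<subseteq> {\<zero>}" using J(2) AV by blast
  qed
  show thesis
  proof (rule that)
    \<comment> \<open>Scalars are determined by their action on \<open>V\<close>, and there s is the
      projection onto \<open>L\<close>.\<close>
    have "s \<otimes>\<^bsub>K\<^esub> s = s"
    proof (rule scalar_eqI[OF V annV])
      fix v assume "v \<in> V"
      then obtain l a where la: "l \<in> L" "a \<in> A" "v = l \<oplus> a" using VE by blast
      then show "(s \<otimes>\<^bsub>K\<^esub> s) \<odot> v = s \<odot> v" using smult_assoc1[OF s(1) s(1), of v] sV[OF la(1,2)] sL[OF la(1)] Lc Ac by simp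
    qed (use s in auto)
    then show "s \<in> idempotents K" using s by (simp add: idempotents_def)
    have "b \<otimes>\<^bsub>K\<^esub> s = \<zero>\<^bsub>K\<^esub>" if b: "b \<in> carrier K" "\<forall>y\<in>L. b \<odot> y = \<zero>" for b
    proof (rule scalar_eqI[OF V annV])
      fix v assume "v \<in> V"
      then obtain l a where la: "l \<in> L" "a \<in> A" "v = l \<oplus> a" using VE by blast
      then show "(b \<otimes>\<^bsub>K\<^esub> s) \<odot> v = \<zero>\<^bsub>K\<^esub> \<odot> v" using smult_assoc1[OF b(1) s(1), of v] sV[OF la(1,2)] bspec[OF b(2) la(1)] Lc Ac by simp
    qed (use s b in auto)
    then show "\<forall>b\<in>carrier K. (\<forall>y\<in>L. b \<odot> y = \<zero>) \<longrightarrow> b \<otimes>\<^bsub>K\<^esub> s = \<zero>\<^bsub>K\<^esub>" by blast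
  qed (use sL in blast)
qed

end

locale closed_quotient = closed_system K T + quotient_embedding K T Q i
  for K :: "('a, 'm) ring_scheme" and T :: "('a, 'b, 'n) triple_system_scheme" (structure)
    and Q :: "('a, 'c, 'p) triple_system_scheme" and i :: "'b \<Rightarrow> 'c"
begin

text \<open>The definition attaches ideals to nonzero elements only; for zero the whole system
  serves.\<close>

lemma quotient_ideal_any:
  assumes "q \<in> carrier Q"
  obtains I where "denom q I"
proof (cases "q = \<zero>\<^bsub>Q\<^esub>")
  case True
  have "\<zero>\<^bsub>Q\<^esub> \<in> i ` carrier T" using imageI[OF M.zero_closed, of i] by simp
  then have "denom q (carrier T)"
    using True triple_ideal_carrier ann_carrier by (simp add: denominator_ideal_def)
  then show thesis by (rule that)
next
  case False
  show thesis by (rule quotient_ideal[OF assms False]) (rule that)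
qed

lemma smult_swap:
  "\<lbrakk>b \<in> carrier K; c \<in> carrier K; x \<in> carrier Q\<rbrakk> \<Longrightarrow> b \<odot>\<^bsub>Q\<^esub> (c \<odot>\<^bsub>Q\<^esub> x) = c \<odot>\<^bsub>Q\<^esub> (b \<odot>\<^bsub>Q\<^esub> x)"
  using Q.smult_assoc1[of b c x] Q.smult_assoc1[of c b x] R.m_comm[of b c] by simp

text \<open>Let L consist of the elements of \<open>T\<close> killed by every scalar that kills
  \<open>q\<close>. Products of \<open>q\<close> falling into \<open>T\<close> belong to L and are
  fixed by the support s of L, so s fixes \<open>q\<close>. Conversely a scalar killing
  \<open>q\<close> kills L and hence s.\<close>

lemma support:
  assumes q: "q \<in> carrier Q"
  obtains s where "s \<in> idempotents K" "s \<odot>\<^bsub>Q\<^esub> q = q"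
    "\<forall>b\<in>carrier K. b \<odot>\<^bsub>Q\<^esub> q = \<zero>\<^bsub>Q\<^esub> \<longrightarrow> b \<otimes>\<^bsub>K\<^esub> s = \<zero>\<^bsub>K\<^esub>"
proof -
  define L where "L = {y \<in> carrier T. \<forall>b\<in>carrier K. b \<odot>\<^bsub>Q\<^esub> q = \<zero>\<^bsub>Q\<^esub> \<longrightarrow> b \<odot> y = \<zero>}"
  have L: "triple_ideal K T L"
  proof (rule triple_idealI)
    show "c \<odot> x \<in> L" if "c \<in> carrier K" "x \<in> L" for c x
    proof -
      have "b \<odot> (c \<odot> x) = \<zero>" if b: "b \<in> carrier K" "b \<odot>\<^bsub>Q\<^esub> q = \<zero>\<^bsub>Q\<^esub>" for b
        using b \<open>c \<in> carrier K\<close> \<open>x \<in> L\<close> smult_assoc1[of b c x] smult_assoc1[of c b x] R.m_comm[of b c]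
        by (simp add: L_def)
      then show ?thesis using that by (simp add: L_def)
    qed
  qed (auto simp: L_def smult_r_distr triple_smult(1)[symmetric])
  obtain s where s: "s \<in> idempotents K" "\<And>y. y \<in> L \<Longrightarrow> s \<odot> y = y"
    "\<forall>b\<in>carrier K. (\<forall>y\<in>L. b \<odot> y = \<zero>) \<longrightarrow> b \<otimes>\<^bsub>K\<^esub> s = \<zero>\<^bsub>K\<^esub>"
    by (rule support_ideal[OF L]) (rule that)
  have sc: "s \<in> carrier K" using s(1) by (simp add: idempotents_def)
  obtain I where I: "denom q I" by (rule quotient_ideal_any[OF q])
  have *: "s \<odot>\<^bsub>Q\<^esub> \<lblot>q,i u,i v\<rblot>\<^bsub>Q\<^esub> = \<lblot>q,i u,i v\<rblot>\<^bsub>Q\<^esub>"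
    if uv: "u \<in> carrier T" "v \<in> carrier T" "\<lblot>q,i u,i v\<rblot>\<^bsub>Q\<^esub> \<in> i ` carrier T" for u v
  proof -
    obtain t where t: "t \<in> carrier T" "\<lblot>q,i u,i v\<rblot>\<^bsub>Q\<^esub> = i t" using uv(3) by blast
    have "b \<odot> t = \<zero>" if b: "b \<in> carrier K" "b \<odot>\<^bsub>Q\<^esub> q = \<zero>\<^bsub>Q\<^esub>" for b
    proof -
      have "i (b \<odot> t) = i \<zero>"
        using Q.triple_smult(1)[OF b(1) q, of "i u" "i v"] uv b t by simp
      then show ?thesis using b t by (simp only: emb_eq_iff M.zero_closed smult_closed)
    qed
    then have "s \<odot> t = t" using s(2) t by (simp add: L_def)
    then show ?thesis using t sc emb_smult[OF sc t(1)] by simp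
  qed
  have "s \<odot>\<^bsub>Q\<^esub> q = q"
    by (rule quotient_eqI[OF denomD(1,2)[OF I]])
      (use q sc denomD(3-5)[OF I] * in \<open>auto simp: Q.triple_smult\<close>)
  moreover have "b \<otimes>\<^bsub>K\<^esub> s = \<zero>\<^bsub>K\<^esub>" if "b \<in> carrier K" "b \<odot>\<^bsub>Q\<^esub> q = \<zero>\<^bsub>Q\<^esub>" for b
    using s(3) that by (auto simp: L_def)
  ultimately show thesis using that s(1) by blast
qed

text \<open>The support idempotent of \<open>q\<close> is orthogonal to every member of
  \<open>D\<close>, so it is zero by density, and it fixes \<open>q\<close>.\<close>

lemma dense_zero:
  assumes D: "dense_orthogonal K D" and q: "q \<in> carrier Q" and z: "\<And>e. e \<in> D \<Longrightarrow> e \<odot>\<^bsub>Q\<^esub> q = \<zero>\<^bsub>Q\<^esub>"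
  shows "q = \<zero>\<^bsub>Q\<^esub>"
proof -
  obtain s where s: "s \<in> idempotents K" "s \<odot>\<^bsub>Q\<^esub> q = q"
    "\<forall>b\<in>carrier K. b \<odot>\<^bsub>Q\<^esub> q = \<zero>\<^bsub>Q\<^esub> \<longrightarrow> b \<otimes>\<^bsub>K\<^esub> s = \<zero>\<^bsub>K\<^esub>"
    by (rule support[OF q]) (rule that)
  have "s = \<zero>\<^bsub>K\<^esub>"
  proof (rule R.dense_orthogonalD(5)[OF D s(1)])
    fix e assume e: "e \<in> D"
    then have "e \<otimes>\<^bsub>K\<^esub> s = \<zero>\<^bsub>K\<^esub>" using s(3) z R.dense_orthogonalD(2)[OF D] by blast
    then show "s \<otimes>\<^bsub>K\<^esub> e = \<zero>\<^bsub>K\<^esub>"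
      using R.m_comm[of s e] R.dense_orthogonalD(2)[OF D e] s(1) by (simp add: idempotents_def)
  qed
  then show ?thesis using s(2) q by simp
qed

lemma dense_eqI:
  assumes D: "dense_orthogonal K D" and q: "p \<in> carrier Q" "q \<in> carrier Q"
    and eq: "\<And>e. e \<in> D \<Longrightarrow> e \<odot>\<^bsub>Q\<^esub> p = e \<odot>\<^bsub>Q\<^esub> q"
  shows "p = q"
proof -
  have "p \<oplus>\<^bsub>Q\<^esub> \<ominus>\<^bsub>Q\<^esub> q = \<zero>\<^bsub>Q\<^esub>"
    by (rule dense_zero[OF D])
      (use q R.dense_orthogonalD(2)[OF D] eq in \<open>simp_all add: Q.smult_r_distr Q.smult_r_minus Q.M.r_neg\<close>)
  then show ?thesis using Q.M.minus_equality[of p "\<ominus>\<^bsub>Q\<^esub> q"] q by simp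
qed

end

section \<open>Orthogonal completeness of \<open>Q\<^sub>m(P(R))\<close>\<close>

text \<open>The direct product of the corners e T for e in D, with componentwise operations.\<close>

definition component_system :: "'a set \<Rightarrow> ('a, 'b, 'n) triple_system_scheme \<Rightarrow> ('a, 'a \<Rightarrow> 'b) triple_system"
  where "component_system D T =
    \<lparr>carrier = {f \<in> D \<rightarrow>\<^sub>E carrier T. \<forall>e\<in>D. e \<odot>\<^bsub>T\<^esub> f e = f e}, monoid.mult = undefined, one = undefined,
     ring.zero = (\<lambda>e\<in>D. \<zero>\<^bsub>T\<^esub>), ring.add = (\<lambda>f g. \<lambda>e\<in>D. f e \<oplus>\<^bsub>T\<^esub> g e),
     module.smult = (\<lambda>c f. \<lambda>e\<in>D. c \<odot>\<^bsub>T\<^esub> f e), triple = (\<lambda>f g h. \<lambda>e\<in>D. \<lblot>f e,g e,h e\<rblot>\<^bsub>T\<^esub>)\<rparr>"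

lemma component_system_simps:
  "f \<in> carrier (component_system D T) \<longleftrightarrow> f \<in> D \<rightarrow>\<^sub>E carrier T \<and> (\<forall>e\<in>D. e \<odot>\<^bsub>T\<^esub> f e = f e)"
  "\<zero>\<^bsub>component_system D T\<^esub> = (\<lambda>e\<in>D. \<zero>\<^bsub>T\<^esub>)"
  "f \<oplus>\<^bsub>component_system D T\<^esub> g = (\<lambda>e\<in>D. f e \<oplus>\<^bsub>T\<^esub> g e)"
  "c \<odot>\<^bsub>component_system D T\<^esub> f = (\<lambda>e\<in>D. c \<odot>\<^bsub>T\<^esub> f e)"
  "\<lblot>f,g,h\<rblot>\<^bsub>component_system D T\<^esub> = (\<lambda>e\<in>D. \<lblot>f e,g e,h e\<rblot>\<^bsub>T\<^esub>)"
  by (simp_all add: component_system_def)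

context triple_lie_system
begin

lemma component_system:
  assumes D: "D \<subseteq> carrier K"
  shows "triple_lie_system K (component_system D T)"
proof -
  let ?C = "component_system D T"
  note simps = component_system_simps and ops = component_system_simps(2-5)
  have D [simp]: "e \<in> carrier K" if "e \<in> D" for e using assms that by blast
  have C: "f e \<in> carrier T" "e \<odot> f e = f e" if "f \<in> carrier ?C" "e \<in> D" for f e
    using that by (auto simp: simps)
  have ext: "f \<in> extensional D" if "f \<in> carrier ?C" for f using that by (auto simp: simps PiE_def)
  have I: "(\<lambda>e\<in>D. f e) \<in> carrier ?C" if "\<And>e. e \<in> D \<Longrightarrow> f e \<in> carrier T \<and> e \<odot> f e = f e" for f
    using that by (auto simp: simps)
  have cl: "f \<oplus>\<^bsub>?C\<^esub> g \<in> carrier ?C" if "f \<in> carrier ?C" "g \<in> carrier ?C" for f g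
    unfolding ops by (rule I) (use C that in \<open>simp add: smult_r_distr\<close>)
  have cls: "c \<odot>\<^bsub>?C\<^esub> f \<in> carrier ?C" if "f \<in> carrier ?C" "c \<in> carrier K" for f c
    unfolding ops
  proof (rule I)
    fix e assume e: "e \<in> D"
    have "e \<odot> (c \<odot> f e) = c \<odot> (e \<odot> f e)"
      using smult_assoc1[of e c "f e"] smult_assoc1[of c e "f e"] R.m_comm[of e c] C[OF that(1) e] that(2) e by simp
    then show "c \<odot> f e \<in> carrier T \<and> e \<odot> (c \<odot> f e) = c \<odot> f e" using C[OF that(1) e] that(2) by simp
  qed
  have clt: "\<lblot>f,g,h\<rblot>\<^bsub>?C\<^esub> \<in> carrier ?C" if "f \<in> carrier ?C" "g \<in> carrier ?C" "h \<in> carrier ?C" for f g h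
    unfolding ops
  proof (rule I)
    fix e assume e: "e \<in> D"
    show "\<lblot>f e,g e,h e\<rblot> \<in> carrier T \<and> e \<odot> \<lblot>f e,g e,h e\<rblot> = \<lblot>f e,g e,h e\<rblot>"
      using triple_smult(1)[of e "f e" "g e" "h e"] C that e by simp
  qed
  have z: "\<zero>\<^bsub>?C\<^esub> \<in> carrier ?C" unfolding ops by (rule I) simp
  have e: "f = g" if "f \<in> extensional D" "g \<in> extensional D" "\<And>e. e \<in> D \<Longrightarrow> f e = g e" for f g :: "'a \<Rightarrow> 'b"
    using extensionalityI[of f D g] that by blast
  have "abelian_group ?C"
  proof (rule abelian_groupI)
    fix f assume f: "f \<in> carrier ?C"
    have "(\<lambda>e\<in>D. \<ominus> f e) \<in> carrier ?C" by (rule I) (use C[OF f] in \<open>simp add: smult_r_minus\<close>)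
    moreover have "(\<lambda>e\<in>D. \<ominus> f e) \<oplus>\<^bsub>?C\<^esub> f = \<zero>\<^bsub>?C\<^esub>"
      unfolding ops by (rule e) (use C[OF f] in \<open>auto simp: M.l_neg\<close>)
    ultimately show "\<exists>g\<in>carrier ?C. g \<oplus>\<^bsub>?C\<^esub> f = \<zero>\<^bsub>?C\<^esub>" by blast
    show "\<zero>\<^bsub>?C\<^esub> \<oplus>\<^bsub>?C\<^esub> f = f"
      unfolding ops by (rule e) (use C[OF f] ext[OF f] in auto)
    fix g assume g: "g \<in> carrier ?C"
    show "f \<oplus>\<^bsub>?C\<^esub> g = g \<oplus>\<^bsub>?C\<^esub> f" unfolding ops by (rule e) (use C[OF f] C[OF g] in \<open>auto simp: M.a_comm\<close>)
    fix h assume h: "h \<in> carrier ?C"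
    show "f \<oplus>\<^bsub>?C\<^esub> g \<oplus>\<^bsub>?C\<^esub> h = f \<oplus>\<^bsub>?C\<^esub> (g \<oplus>\<^bsub>?C\<^esub> h)"
      unfolding ops by (rule e) (use C[OF f] C[OF g] C[OF h] in \<open>auto simp: M.a_assoc\<close>)
  qed (use cl z in auto)
  then have "module K ?C"
  proof (rule moduleI[OF R.cring_axioms])
    fix a b f assume a: "a \<in> carrier K" and b: "b \<in> carrier K" and f: "f \<in> carrier ?C"
    show "(a \<oplus>\<^bsub>K\<^esub> b) \<odot>\<^bsub>?C\<^esub> f = a \<odot>\<^bsub>?C\<^esub> f \<oplus>\<^bsub>?C\<^esub> b \<odot>\<^bsub>?C\<^esub> f"
      unfolding ops by (rule e) (use C[OF f] a b in \<open>auto simp: smult_l_distr\<close>)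
    show "(a \<otimes>\<^bsub>K\<^esub> b) \<odot>\<^bsub>?C\<^esub> f = a \<odot>\<^bsub>?C\<^esub> (b \<odot>\<^bsub>?C\<^esub> f)"
      unfolding ops by (rule e) (use C[OF f] a b in \<open>auto simp: smult_assoc1\<close>)
    fix g assume g: "g \<in> carrier ?C"
    show "a \<odot>\<^bsub>?C\<^esub> (f \<oplus>\<^bsub>?C\<^esub> g) = a \<odot>\<^bsub>?C\<^esub> f \<oplus>\<^bsub>?C\<^esub> a \<odot>\<^bsub>?C\<^esub> g"
      unfolding ops by (rule e) (use C[OF f] C[OF g] a in \<open>auto simp: smult_r_distr\<close>)
  next
    fix f assume f: "f \<in> carrier ?C"
    show "\<one>\<^bsub>K\<^esub> \<odot>\<^bsub>?C\<^esub> f = f" unfolding ops by (rule e) (use C[OF f] ext[OF f] in auto)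
  qed (use cls in auto)
  then interpret C: module K ?C .
  show ?thesis
  proof
    show "trilinear K ?C (triple ?C)"
      unfolding trilinear_def
    proof (intro conjI ballI)
      fix x y z assume x: "x \<in> carrier ?C" and y: "y \<in> carrier ?C" and z: "z \<in> carrier ?C"
      show "\<lblot>x,y,z\<rblot>\<^bsub>?C\<^esub> \<in> carrier ?C" by (rule clt[OF x y z])
      fix x' assume x': "x' \<in> carrier ?C"
      note c = C[OF x] C[OF y] C[OF z] C[OF x']
      show "\<lblot>x \<oplus>\<^bsub>?C\<^esub> x',y,z\<rblot>\<^bsub>?C\<^esub> = \<lblot>x,y,z\<rblot>\<^bsub>?C\<^esub> \<oplus>\<^bsub>?C\<^esub> \<lblot>x',y,z\<rblot>\<^bsub>?C\<^esub>"
        "\<lblot>y,x \<oplus>\<^bsub>?C\<^esub> x',z\<rblot>\<^bsub>?C\<^esub> = \<lblot>y,x,z\<rblot>\<^bsub>?C\<^esub> \<oplus>\<^bsub>?C\<^esub> \<lblot>y,x',z\<rblot>\<^bsub>?C\<^esub>"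
        "\<lblot>y,z,x \<oplus>\<^bsub>?C\<^esub> x'\<rblot>\<^bsub>?C\<^esub> = \<lblot>y,z,x\<rblot>\<^bsub>?C\<^esub> \<oplus>\<^bsub>?C\<^esub> \<lblot>y,z,x'\<rblot>\<^bsub>?C\<^esub>"
        unfolding ops by (rule e; use c in \<open>auto simp: triple_add\<close>)+
    next
      fix a x y z assume a: "a \<in> carrier K" and x: "x \<in> carrier ?C" and y: "y \<in> carrier ?C" and z: "z \<in> carrier ?C"
      note c = C[OF x] C[OF y] C[OF z]
      show "\<lblot>a \<odot>\<^bsub>?C\<^esub> x,y,z\<rblot>\<^bsub>?C\<^esub> = a \<odot>\<^bsub>?C\<^esub> \<lblot>x,y,z\<rblot>\<^bsub>?C\<^esub>"
        "\<lblot>x,a \<odot>\<^bsub>?C\<^esub> y,z\<rblot>\<^bsub>?C\<^esub> = a \<odot>\<^bsub>?C\<^esub> \<lblot>x,y,z\<rblot>\<^bsub>?C\<^esub>"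
        "\<lblot>x,y,a \<odot>\<^bsub>?C\<^esub> z\<rblot>\<^bsub>?C\<^esub> = a \<odot>\<^bsub>?C\<^esub> \<lblot>x,y,z\<rblot>\<^bsub>?C\<^esub>"
        unfolding ops by (rule e; use c a in \<open>auto simp: triple_smult\<close>)+
    qed
    fix x y z a b assume x: "x \<in> carrier ?C" and y: "y \<in> carrier ?C"
    show "\<lblot>x,x,y\<rblot>\<^bsub>?C\<^esub> = \<zero>\<^bsub>?C\<^esub>"
      unfolding ops by (rule e) (use C[OF x] C[OF y] in \<open>auto simp: alternating\<close>)
    assume z: "z \<in> carrier ?C"
    show "\<lblot>x,y,z\<rblot>\<^bsub>?C\<^esub> \<oplus>\<^bsub>?C\<^esub> \<lblot>y,z,x\<rblot>\<^bsub>?C\<^esub> \<oplus>\<^bsub>?C\<^esub> \<lblot>z,x,y\<rblot>\<^bsub>?C\<^esub> = \<zero>\<^bsub>?C\<^esub>"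
      unfolding ops by (rule e) (use C[OF x] C[OF y] C[OF z] in \<open>auto simp: cyclic\<close>)
    assume a: "a \<in> carrier ?C" and b: "b \<in> carrier ?C"
    show "\<lblot>x,y,\<lblot>z,a,b\<rblot>\<^bsub>?C\<^esub>\<rblot>\<^bsub>?C\<^esub> = \<lblot>\<lblot>x,y,z\<rblot>\<^bsub>?C\<^esub>,a,b\<rblot>\<^bsub>?C\<^esub> \<oplus>\<^bsub>?C\<^esub> \<lblot>z,\<lblot>x,y,a\<rblot>\<^bsub>?C\<^esub>,b\<rblot>\<^bsub>?C\<^esub> \<oplus>\<^bsub>?C\<^esub>
        \<lblot>z,a,\<lblot>x,y,b\<rblot>\<^bsub>?C\<^esub>\<rblot>\<^bsub>?C\<^esub>"
      unfolding ops
    proof (rule e)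
      fix u assume u: "u \<in> D"
      note c = C(1)[OF x u] C(1)[OF y u] C(1)[OF z u] C(1)[OF a u] C(1)[OF b u]
      show "(\<lambda>e\<in>D. \<lblot>x e,y e,(\<lambda>e\<in>D. \<lblot>z e,a e,b e\<rblot>) e\<rblot>) u = (\<lambda>e\<in>D. (\<lambda>e\<in>D. (\<lambda>e\<in>D. \<lblot>(\<lambda>e\<in>D. \<lblot>x e,y e,z e\<rblot>) e,a e,b e\<rblot>) e \<oplus>
          (\<lambda>e\<in>D. \<lblot>z e,(\<lambda>e\<in>D. \<lblot>x e,y e,a e\<rblot>) e,b e\<rblot>) e) e \<oplus> (\<lambda>e\<in>D. \<lblot>z e,a e,(\<lambda>e\<in>D. \<lblot>x e,y e,b e\<rblot>) e\<rblot>) e) u"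
        using derivation[OF c] u by simp
    qed auto
  qed
qed

end

section \<open>Families indexed by a dense orthogonal set\<close>

context closed_quotient
begin

text \<open>The sum of the e p_e works because e (d p_d) = 0 for different e and d. Only finite
  families can be glued inside \<open>T\<close> in this way, which dictates the choice of
  denominators for infinite families.\<close>

lemma finite_orthogonal_sum:
  assumes D: "dense_orthogonal K D" and "finite F" "F \<subseteq> D" and p: "\<And>e. e \<in> F \<Longrightarrow> p e \<in> carrier T"
  shows "\<exists>x\<in>carrier T. (\<forall>e\<in>F. e \<odot> x = e \<odot> p e) \<and> (\<forall>e\<in>D - F. e \<odot> x = \<zero>)"
  using assms(2,3,4)
proof (induction F)
  case empty
  then show ?case using R.dense_orthogonalD(2)[OF D] by (intro bexI[of _ \<zero>]) auto
next
  case (insert d F)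
  then obtain x where x: "x \<in> carrier T" "\<forall>e\<in>F. e \<odot> x = e \<odot> p e" "\<forall>e\<in>D - F. e \<odot> x = \<zero>" by auto
  note D' = R.dense_orthogonalD[OF D]
  have d: "d \<in> D" "p d \<in> carrier T" using insert by auto
  have ed: "e \<odot> (d \<odot> p d) = (if e = d then d \<odot> p d else \<zero>)" if "e \<in> D" for e
    using smult_assoc1[OF D'(2)[OF that] D'(2)[OF d(1)] d(2)] D'(3)[OF d(1)] D'(4)[OF that d(1)] d by auto
  have "e \<odot> (x \<oplus> d \<odot> p d) = e \<odot> x \<oplus> e \<odot> (d \<odot> p d)" if "e \<in> D" for e
    using D'(2)[OF that] D'(2)[OF d(1)] d(2) x(1) by (simp add: smult_r_distr)
  then show ?case
    using x insert d D'(2) ed by (intro bexI[of _ "x \<oplus> d \<odot> p d"]) (auto split: if_splits)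
qed

definition diagonal :: "'a set \<Rightarrow> 'b \<Rightarrow> 'a \<Rightarrow> 'c"
  where "diagonal D x = (\<lambda>e\<in>D. e \<odot>\<^bsub>Q\<^esub> i x)"

text \<open>Injectivity is \<open>dense_eqI\<close>; the composition is preserved because e, being
  idempotent, may be distributed over all three arguments.\<close>

lemma diagonal_embedding:
  assumes D: "dense_orthogonal K D"
  shows "triple_embedding K T (component_system D Q) (diagonal D)"
proof -
  note D' = R.dense_orthogonalD[OF D]
  let ?C = "component_system D Q"
  have DK: "D \<subseteq> carrier K" using D' by blast
  have ee: "e \<odot>\<^bsub>Q\<^esub> (e \<odot>\<^bsub>Q\<^esub> x) = e \<odot>\<^bsub>Q\<^esub> x" if "e \<in> D" "x \<in> carrier Q" for e x
    using Q.smult_assoc1[OF D'(2,2), of e e x] D'(3) that by simp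
  have inj: "x = y" if "x \<in> carrier T" "y \<in> carrier T" "diagonal D x = diagonal D y" for x y
  proof -
    have "i x = i y"
    proof (rule dense_eqI[OF D])
      fix e assume "e \<in> D"
      then show "e \<odot>\<^bsub>Q\<^esub> i x = e \<odot>\<^bsub>Q\<^esub> i y" using fun_cong[OF that(3), of e] by (simp add: diagonal_def)
    qed (use that in auto)
    then show ?thesis using that by simp
  qed
  have t: "e \<odot>\<^bsub>Q\<^esub> \<lblot>x,y,z\<rblot>\<^bsub>Q\<^esub> = \<lblot>e \<odot>\<^bsub>Q\<^esub> x,e \<odot>\<^bsub>Q\<^esub> y,e \<odot>\<^bsub>Q\<^esub> z\<rblot>\<^bsub>Q\<^esub>"
    if "e \<in> D" "x \<in> carrier Q" "y \<in> carrier Q" "z \<in> carrier Q" for e x y z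
    using that D'(2) ee by (simp add: Q.triple_smult)
  show ?thesis
    unfolding triple_embedding_def
  proof (intro conjI ballI triple_lie_system_axioms Q.component_system[OF DK])
    show "diagonal D \<in> carrier T \<rightarrow> carrier ?C"
      using D'(2) ee by (auto simp: component_system_simps diagonal_def)
    show "inj_on (diagonal D) (carrier T)" using inj by (auto simp: inj_on_def)
  qed (use D'(2) in \<open>auto simp: component_system_simps diagonal_def Q.smult_r_distr t smult_swap intro!: restrict_ext\<close>)
qed

text \<open>With denominator ideals \<open>I e\<close> of the components, the denominators of the
  family are the a with e a in \<open>I e\<close> for all e and e a = 0 for almost all e. Finiteness
  brings the products back to the diagonal copy of \<open>T\<close>, where only finite orthogonal
  sums exist.\<close>

lemma diagonal_quotient_system:
  assumes D: "dense_orthogonal K D"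
  shows "quotient_system K T (component_system D Q) (diagonal D)"
proof -
  let ?C = "component_system D Q"
  note D' = R.dense_orthogonalD[OF D]
  interpret C: embedded_system K T ?C "diagonal D" by (rule embedded_systemI[OF diagonal_embedding[OF D]])
  show ?thesis
    unfolding C.quotient_system_iff
  proof (intro ballI impI)
    fix q assume q: "q \<in> carrier ?C" and q0: "q \<noteq> \<zero>\<^bsub>?C\<^esub>"
    have qe: "q e \<in> carrier Q" "e \<odot>\<^bsub>Q\<^esub> q e = q e" if "e \<in> D" for e
      using q that by (auto simp: component_system_simps)
    have "\<exists>I. denom (q e) I" if e: "e \<in> D" for e
      by (rule quotient_ideal_any[OF qe(1)[OF e]]) blast
    then obtain I where "\<And>e. e \<in> D \<Longrightarrow> denom (q e) (I e)" by metis
    note Id = denomD[OF this]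
    note I = Id(1,2) and Iq = Id(3,4) and Ic = Id(5)
    define J where "J = {a \<in> carrier T. (\<forall>e\<in>D. e \<odot> a \<in> I e) \<and> finite {e \<in> D. e \<odot> a \<noteq> \<zero>}}"
    have J: "triple_ideal K T J"
    proof (rule triple_idealI)
      show "J \<subseteq> carrier T" by (auto simp: J_def)
      have empty: "{e \<in> D. e \<odot> \<zero> \<noteq> \<zero>} = {}" using D'(2) by auto
      have "finite {e \<in> D. e \<odot> \<zero> \<noteq> \<zero>}" unfolding empty by simp
      then show "\<zero> \<in> J" using triple_ideal_mem(1)[OF I(1)] D'(2) by (simp add: J_def)
      fix x assume x: "x \<in> J"
      then have xc: "x \<in> carrier T" by (simp add: J_def)
      show "x \<oplus> y \<in> J" if y: "y \<in> J" for y
      proof -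
        have yc: "y \<in> carrier T" using y by (simp add: J_def)
        have "{e \<in> D. e \<odot> (x \<oplus> y) \<noteq> \<zero>} \<subseteq> {e \<in> D. e \<odot> x \<noteq> \<zero>} \<union> {e \<in> D. e \<odot> y \<noteq> \<zero>}"
          using xc yc D'(2) by (auto simp: smult_r_distr)
        then have "finite {e \<in> D. e \<odot> (x \<oplus> y) \<noteq> \<zero>}" using x y finite_subset by (auto simp: J_def)
        then show ?thesis using x y xc yc triple_ideal_mem(2)[OF I(1)] D'(2) by (auto simp: J_def smult_r_distr)
      qed
      show "c \<odot> x \<in> J" if c: "c \<in> carrier K" for c
      proof -
        have ce: "e \<odot> (c \<odot> x) = c \<odot> (e \<odot> x)" if "e \<in> D" for e
          using smult_assoc1[OF D'(2)[OF that] c xc] smult_assoc1[OF c D'(2)[OF that] xc] R.m_comm[OF c D'(2)[OF that]] by simp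
        have "{e \<in> D. e \<odot> (c \<odot> x) \<noteq> \<zero>} \<subseteq> {e \<in> D. e \<odot> x \<noteq> \<zero>}" using ce c by auto
        then have "finite {e \<in> D. e \<odot> (c \<odot> x) \<noteq> \<zero>}" using x finite_subset by (auto simp: J_def)
        then show ?thesis using x xc c triple_ideal_mem(4)[OF I(1)] by (auto simp: J_def ce)
      qed
      show "\<lblot>x,y,z\<rblot> \<in> J" if yz: "y \<in> carrier T" "z \<in> carrier T" for y z
      proof -
        have et: "e \<odot> \<lblot>x,y,z\<rblot> = \<lblot>e \<odot> x,y,z\<rblot>" if "e \<in> D" for e
          using D'(2)[OF that] xc yz by (simp add: triple_smult)
        have "{e \<in> D. e \<odot> \<lblot>x,y,z\<rblot> \<noteq> \<zero>} \<subseteq> {e \<in> D. e \<odot> x \<noteq> \<zero>}" using et yz by auto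
        then have "finite {e \<in> D. e \<odot> \<lblot>x,y,z\<rblot> \<noteq> \<zero>}" using x finite_subset by (auto simp: J_def)
        then show ?thesis using x xc yz triple_ideal_triple(1)[OF I(1)] by (auto simp: J_def et)
      qed
    qed
    \<comment> \<open>Elements of the corner e (I e) have at most one nonzero component. They make
      \<open>J\<close> large enough for its annihilator to be zero and for the components of q to be
      detected.\<close>
    have eJ: "e \<odot> a \<in> J" if e: "e \<in> D" and a: "a \<in> I e" for e a
    proof -
      have ac: "a \<in> carrier T" using Ic[OF e a] .
      have de: "d \<odot> (e \<odot> a) = (if d = e then e \<odot> a else \<zero>)" if "d \<in> D" for d
        using smult_assoc1[OF D'(2)[OF that] D'(2)[OF e] ac] D'(3)[OF e] D'(4)[OF that e] ac by auto
      have "{d \<in> D. d \<odot> (e \<odot> a) \<noteq> \<zero>} \<subseteq> {e}" using de by (auto split: if_splits)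
      then have "finite {d \<in> D. d \<odot> (e \<odot> a) \<noteq> \<zero>}" using finite_subset by blast
      moreover have "d \<odot> (e \<odot> a) \<in> I d" if "d \<in> D" for d
        using de[OF that] triple_ideal_mem(1)[OF I(1)[OF that]] triple_ideal_mem(4)[OF I(1)[OF e] D'(2)[OF e] a] by auto
      ultimately show ?thesis using ac D'(2)[OF e] by (simp add: J_def)
    qed
    have annJ: "triple_ann T J = {\<zero>}"
    proof -
      have "x = \<zero>" if x: "x \<in> triple_ann T J" for x
      proof -
        have xc: "x \<in> carrier T" using x by (simp add: triple_ann_def)
        have "e \<odot> x = \<zero>" if e: "e \<in> D" for e
        proof -
          have "\<lblot>e \<odot> x,a,y\<rblot> = \<zero> \<and> \<lblot>e \<odot> x,y,a\<rblot> = \<zero>" if a: "a \<in> I e" and y: "y \<in> carrier T" for a y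
          proof -
            have "\<lblot>e \<odot> x,a,y\<rblot> = \<lblot>x,e \<odot> a,y\<rblot>" "\<lblot>e \<odot> x,y,a\<rblot> = \<lblot>x,y,e \<odot> a\<rblot>"
              using xc Ic[OF e a] y D'(2)[OF e] by (simp_all add: triple_smult)
            then show ?thesis using x eJ[OF e a] y by (simp add: triple_ann_def)
          qed
          then have "e \<odot> x \<in> triple_ann T (I e)" using xc D'(2)[OF e] by (simp add: triple_ann_def)
          then show ?thesis using I(2)[OF e] by simp
        qed
        then have "e \<odot>\<^bsub>Q\<^esub> i x = \<zero>\<^bsub>Q\<^esub>" if "e \<in> D" for e
          using that emb_smult[OF D'(2)[OF that] xc] emb_zero by simp
        then have "i x = i \<zero>" using dense_zero[OF D, of "i x"] xc by simp
        then show ?thesis using xc by (simp only: emb_eq_iff M.zero_closed)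
      qed
      then show ?thesis using triple_ideal_mem(1)[OF triple_ideal_ann[OF J]] by blast
    qed
    \<comment> \<open>A family from the corners of \<open>T\<close> with finite support is diagonal:
      glue the finitely many nonzero components.\<close>
    have components: "\<exists>x\<in>carrier T. \<forall>e\<in>D. w e = e \<odot>\<^bsub>Q\<^esub> i x"
      if F: "finite F" "F \<subseteq> D" and w: "\<And>e. e \<in> D \<Longrightarrow> w e \<in> i ` carrier T" "\<And>e. e \<in> D \<Longrightarrow> e \<odot>\<^bsub>Q\<^esub> w e = w e"
        "\<And>e. e \<in> D - F \<Longrightarrow> w e = \<zero>\<^bsub>Q\<^esub>" for F w
    proof -
      obtain p where p: "\<And>e. e \<in> D \<Longrightarrow> p e \<in> carrier T \<and> w e = i (p e)"
      proof -
        have "\<forall>e\<in>D. \<exists>x. x \<in> carrier T \<and> w e = i x" using w(1) by blast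
        then show thesis using that bchoice[of D "\<lambda>e x. x \<in> carrier T \<and> w e = i x"] by blast
      qed
      obtain x where x: "x \<in> carrier T" "\<forall>e\<in>F. e \<odot> x = e \<odot> p e" "\<forall>e\<in>D - F. e \<odot> x = \<zero>"
        using finite_orthogonal_sum[OF D F, of p] p F(2) by blast
      have "w e = e \<odot>\<^bsub>Q\<^esub> i x" if e: "e \<in> D" for e
      proof (cases "e \<in> F")
        case True
        have "w e = e \<odot>\<^bsub>Q\<^esub> i (p e)" using p[OF e] w(2)[OF e] by simp
        also have "\<dots> = i (e \<odot> p e)" using p[OF e] D'(2)[OF e] by simp
        also have "\<dots> = i (e \<odot> x)" using x(2) True by simp
        finally show ?thesis using x(1) D'(2)[OF e] by simp
      next
        case False
        then have "i (e \<odot> x) = \<zero>\<^bsub>Q\<^esub>" using x(3) e by simp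
        then show ?thesis using w(3) e False x(1) D'(2)[OF e] by simp
      qed
      then show ?thesis using x(1) by blast
    qed
    have tC: "\<lblot>q,diagonal D u,diagonal D v\<rblot>\<^bsub>?C\<^esub> = (\<lambda>e\<in>D. e \<odot>\<^bsub>Q\<^esub> \<lblot>q e,i u,i v\<rblot>\<^bsub>Q\<^esub>)"
      if "u \<in> carrier T" "v \<in> carrier T" for u v
    proof -
      have "\<lblot>q e,e \<odot>\<^bsub>Q\<^esub> i u,e \<odot>\<^bsub>Q\<^esub> i v\<rblot>\<^bsub>Q\<^esub> = e \<odot>\<^bsub>Q\<^esub> \<lblot>q e,i u,i v\<rblot>\<^bsub>Q\<^esub>" if e: "e \<in> D" for e
        using Q.smult_assoc1[OF D'(2)[OF e] D'(2)[OF e], of "\<lblot>q e,i u,i v\<rblot>\<^bsub>Q\<^esub>"] D'(3)[OF e] qe[OF e] D'(2)[OF e]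
          \<open>u \<in> carrier T\<close> \<open>v \<in> carrier T\<close> by (simp add: Q.triple_smult)
      then show ?thesis by (auto simp: component_system_simps diagonal_def)
    qed
    have in_C: "\<lblot>q,diagonal D u,diagonal D v\<rblot>\<^bsub>?C\<^esub> \<in> diagonal D ` carrier T"
      if uv: "u \<in> carrier T" "v \<in> carrier T" and a: "a \<in> J" "a = u \<or> a = v" for u v a
    proof -
      have "\<exists>x\<in>carrier T. \<forall>e\<in>D. e \<odot>\<^bsub>Q\<^esub> \<lblot>q e,i u,i v\<rblot>\<^bsub>Q\<^esub> = e \<odot>\<^bsub>Q\<^esub> i x"
      proof (rule components)
        show "finite {e \<in> D. e \<odot> a \<noteq> \<zero>}" using a by (simp add: J_def)
        fix e assume e: "e \<in> D"
        have *: "e \<odot>\<^bsub>Q\<^esub> \<lblot>q e,i u,i v\<rblot>\<^bsub>Q\<^esub> = \<lblot>q e,i (e \<odot> u),i v\<rblot>\<^bsub>Q\<^esub>"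
          "e \<odot>\<^bsub>Q\<^esub> \<lblot>q e,i u,i v\<rblot>\<^bsub>Q\<^esub> = \<lblot>q e,i u,i (e \<odot> v)\<rblot>\<^bsub>Q\<^esub>"
          using qe[OF e] D'(2)[OF e] uv by (simp_all add: Q.triple_smult)
        have "e \<odot> a \<in> I e" using a e by (simp add: J_def)
        then show "e \<odot>\<^bsub>Q\<^esub> \<lblot>q e,i u,i v\<rblot>\<^bsub>Q\<^esub> \<in> i ` carrier T"
          using Iq[OF e] uv a(2) * by metis
        show "e \<odot>\<^bsub>Q\<^esub> (e \<odot>\<^bsub>Q\<^esub> \<lblot>q e,i u,i v\<rblot>\<^bsub>Q\<^esub>) = e \<odot>\<^bsub>Q\<^esub> \<lblot>q e,i u,i v\<rblot>\<^bsub>Q\<^esub>"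
          using Q.smult_assoc1[OF D'(2)[OF e] D'(2)[OF e], of "\<lblot>q e,i u,i v\<rblot>\<^bsub>Q\<^esub>"] D'(3)[OF e] qe[OF e] uv by simp
      next
        fix e assume "e \<in> D - {e \<in> D. e \<odot> a \<noteq> \<zero>}"
        then have e: "e \<in> D" "e \<odot> a = \<zero>" by auto
        have *: "e \<odot>\<^bsub>Q\<^esub> \<lblot>q e,i u,i v\<rblot>\<^bsub>Q\<^esub> = \<lblot>q e,i (e \<odot> u),i v\<rblot>\<^bsub>Q\<^esub>"
          "e \<odot>\<^bsub>Q\<^esub> \<lblot>q e,i u,i v\<rblot>\<^bsub>Q\<^esub> = \<lblot>q e,i u,i (e \<odot> v)\<rblot>\<^bsub>Q\<^esub>"
          using qe[OF e(1)] D'(2)[OF e(1)] uv by (simp_all add: Q.triple_smult)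
        show "e \<odot>\<^bsub>Q\<^esub> \<lblot>q e,i u,i v\<rblot>\<^bsub>Q\<^esub> = \<zero>\<^bsub>Q\<^esub>"
          using a(2)
        proof
          assume "a = u"
          then show ?thesis using *(1) e qe[OF e(1)] uv by simp
        next
          assume "a = v"
          then show ?thesis using *(2) e qe[OF e(1)] uv by simp
        qed
      qed auto
      then obtain x where "x \<in> carrier T" "\<forall>e\<in>D. e \<odot>\<^bsub>Q\<^esub> \<lblot>q e,i u,i v\<rblot>\<^bsub>Q\<^esub> = e \<odot>\<^bsub>Q\<^esub> i x" by blast
      then have "x \<in> carrier T" "\<lblot>q,diagonal D u,diagonal D v\<rblot>\<^bsub>?C\<^esub> = diagonal D x"
        by (auto simp: tC[OF uv] diagonal_def[of D x] intro: restrict_ext)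
      then show ?thesis by blast
    qed
    have Jc: "a \<in> carrier T" if "a \<in> J" for a using that by (simp add: J_def)
    have "\<not> kills T ?C (diagonal D) q J"
    proof -
      have "\<exists>e\<in>D. q e \<noteq> \<zero>\<^bsub>Q\<^esub>"
      proof (rule ccontr)
        assume "\<not> ?thesis"
        then have "q = \<zero>\<^bsub>?C\<^esub>"
          using q by (intro extensionalityI[of q D]) (auto simp: component_system_simps PiE_def)
        then show False using q0 by simp
      qed
      then obtain e where e: "e \<in> D" "q e \<noteq> \<zero>\<^bsub>Q\<^esub>" by blast
      \<comment> \<open>By nonsingularity the ideal chosen for a nonzero component detects it;
        replacing a by e a, which lies in \<open>J\<close>, detects the family at e.\<close>
      then obtain a y where ay: "a \<in> I e" "y \<in> carrier T"
        "\<lblot>q e,i a,i y\<rblot>\<^bsub>Q\<^esub> \<noteq> \<zero>\<^bsub>Q\<^esub> \<or> \<lblot>q e,i y,i a\<rblot>\<^bsub>Q\<^esub> \<noteq> \<zero>\<^bsub>Q\<^esub>"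
        using quotient_nonsingular[OF I[OF e(1)] qe(1)[OF e(1)]] unfolding kills_def by blast
      note c = Ic[OF e(1) ay(1)] ay(2) D'(2)[OF e(1)] qe[OF e(1)]
      have "e \<odot>\<^bsub>Q\<^esub> \<lblot>q e,i (e \<odot> a),i y\<rblot>\<^bsub>Q\<^esub> = \<lblot>q e,i a,i y\<rblot>\<^bsub>Q\<^esub>"
        "e \<odot>\<^bsub>Q\<^esub> \<lblot>q e,i y,i (e \<odot> a)\<rblot>\<^bsub>Q\<^esub> = \<lblot>q e,i y,i a\<rblot>\<^bsub>Q\<^esub>"
        using c Q.triple_smult(1)[OF c(3,4), of "i a" "i y"] Q.triple_smult(1)[OF c(3,4), of "i y" "i a"]
        by (simp_all add: Q.triple_smult(2,3))
      then have "\<lblot>q,diagonal D (e \<odot> a),diagonal D y\<rblot>\<^bsub>?C\<^esub> e \<noteq> \<zero>\<^bsub>?C\<^esub> e \<or>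
        \<lblot>q,diagonal D y,diagonal D (e \<odot> a)\<rblot>\<^bsub>?C\<^esub> e \<noteq> \<zero>\<^bsub>?C\<^esub> e"
        using ay(3) e(1) c tC[of "e \<odot> a" y] tC[of y "e \<odot> a"] by (simp add: component_system_simps(2))
      then have "\<lblot>q,diagonal D (e \<odot> a),diagonal D y\<rblot>\<^bsub>?C\<^esub> \<noteq> \<zero>\<^bsub>?C\<^esub> \<or>
        \<lblot>q,diagonal D y,diagonal D (e \<odot> a)\<rblot>\<^bsub>?C\<^esub> \<noteq> \<zero>\<^bsub>?C\<^esub>" by metis
      then show ?thesis using eJ[OF e(1) ay(1)] ay(2) unfolding kills_def by blast
    qed
    moreover have "C.denom q J"
      unfolding denominator_ideal_def by (intro conjI ballI J annJ) (use in_C Jc in blast)+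
    ultimately show "\<exists>I. C.denom q I \<and> \<not> kills T ?C (diagonal D) q I" by blast
  qed
qed

text \<open>The quotient system of all families \<open>(e q\<^sub>e)\<close> embeds into a maximal one; the image of a
  family is its orthogonal sum.\<close>

lemma maximal_orth_complete:
  assumes max: "maximal_quotient_system K T Q i" and D: "dense_orthogonal K D"
    and f: "\<And>e. e \<in> D \<Longrightarrow> f e \<in> carrier Q"
  shows "\<exists>x\<in>carrier Q. \<forall>e\<in>D. e \<odot>\<^bsub>Q\<^esub> x = e \<odot>\<^bsub>Q\<^esub> f e"
proof -
  let ?C = "component_system D Q"
  note D' = R.dense_orthogonalD[OF D]
  obtain g where g: "triple_embedding K ?C Q g" "\<And>x. x \<in> carrier T \<Longrightarrow> g (diagonal D x) = i x"
    using maximal_quotient_system_embeds[OF max diagonal_quotient_system[OF D]] by blast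
  interpret g: embedded_system K ?C Q g by (rule embedded_systemI) fact
  interpret d: embedded_system K T ?C "diagonal D" by (rule embedded_systemI[OF diagonal_embedding[OF D]])
  have ee: "e \<odot>\<^bsub>Q\<^esub> (d \<odot>\<^bsub>Q\<^esub> x) = (if e = d then d \<odot>\<^bsub>Q\<^esub> x else \<zero>\<^bsub>Q\<^esub>)" if "e \<in> D" "d \<in> D" "x \<in> carrier Q" for e d x
    using Q.smult_assoc1[OF D'(2,2), of e d x] D'(3) D'(4)[of e d] that by auto
  define c where "c = (\<lambda>e\<in>D. e \<odot>\<^bsub>Q\<^esub> f e)"
  have c: "c \<in> carrier ?C" using f ee D'(2) by (auto simp: c_def component_system_simps)
  have "e \<odot>\<^bsub>Q\<^esub> g c = e \<odot>\<^bsub>Q\<^esub> f e" if e: "e \<in> D" for e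
  proof -
    define u where "u = e \<odot>\<^bsub>Q\<^esub> f e"
    have u: "u \<in> carrier Q" "e \<odot>\<^bsub>Q\<^esub> u = u" using f ee D'(2) e by (auto simp: u_def)
    \<comment> \<open>Multiplying the family \<open>c\<close> by e leaves only its component at e;
      it remains to see that \<open>g\<close> sends this one-component family to
      \<open>u\<close>.\<close>
    define b where "b = (\<lambda>d\<in>D. if d = e then u else \<zero>\<^bsub>Q\<^esub>)"
    have b: "b \<in> carrier ?C" using u D'(2) by (auto simp: b_def component_system_simps)
    have "e \<odot>\<^bsub>?C\<^esub> c = b"
      using ee e f by (auto simp: b_def c_def u_def component_system_simps intro!: restrict_ext)
    then have gb: "e \<odot>\<^bsub>Q\<^esub> g c = g b" using g.emb_smult[OF D'(2)[OF e] c] by simp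
    obtain I where I: "denom u I" by (rule quotient_ideal_any[OF u(1)])
    \<comment> \<open>The values of \<open>g\<close> are known only on the diagonal copy of
      \<open>T\<close>, so \<open>g b\<close> and \<open>u\<close> are compared through products.
      The element t with [u,x,y] = t in \<open>T\<close> is fixed by e and killed by the other
      members of \<open>D\<close>, so the product with \<open>b\<close> is the diagonal image of
      t.\<close>
    have *: "\<lblot>g b,i x,i y\<rblot>\<^bsub>Q\<^esub> = \<lblot>u,i x,i y\<rblot>\<^bsub>Q\<^esub>"
      if xy: "x \<in> carrier T" "y \<in> carrier T" "\<lblot>u,i x,i y\<rblot>\<^bsub>Q\<^esub> \<in> i ` carrier T" for x y
    proof -
      obtain t where t: "t \<in> carrier T" "\<lblot>u,i x,i y\<rblot>\<^bsub>Q\<^esub> = i t" using xy(3) by blast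
      have et: "e \<odot>\<^bsub>Q\<^esub> i t = i t"
        using Q.triple_smult(1)[OF D'(2)[OF e] u(1), of "i x" "i y"] xy t u by simp
      have "\<lblot>b,diagonal D x,diagonal D y\<rblot>\<^bsub>?C\<^esub> d = diagonal D t d" if d: "d \<in> D" for d
      proof (cases "d = e")
        case True
        have "\<lblot>u,e \<odot>\<^bsub>Q\<^esub> i x,e \<odot>\<^bsub>Q\<^esub> i y\<rblot>\<^bsub>Q\<^esub> = e \<odot>\<^bsub>Q\<^esub> (e \<odot>\<^bsub>Q\<^esub> \<lblot>u,i x,i y\<rblot>\<^bsub>Q\<^esub>)"
          using xy u D'(2)[OF e] by (simp add: Q.triple_smult)
        then show ?thesis using True d t(2) et by (simp add: component_system_simps diagonal_def b_def)
      next
        case False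
        have "d \<odot>\<^bsub>Q\<^esub> i t = \<zero>\<^bsub>Q\<^esub>" using ee[OF d e, of "i t"] et False t(1) by simp
        then show ?thesis using False d xy D'(2)[OF d] by (simp add: component_system_simps diagonal_def b_def)
      qed
      then have "\<lblot>b,diagonal D x,diagonal D y\<rblot>\<^bsub>?C\<^esub> = diagonal D t"
        by (intro extensionalityI[of _ D]) (auto simp: component_system_simps diagonal_def)
      then have "\<lblot>g b,g (diagonal D x),g (diagonal D y)\<rblot>\<^bsub>Q\<^esub> = g (diagonal D t)"
        using g.emb_triple[OF b d.emb_closed[OF xy(1)] d.emb_closed[OF xy(2)]] by simp
      then show ?thesis using xy t g(2) by simp
    qed
    have "g b = u"
      by (rule quotient_eqI[OF denomD(1,2)[OF I] g.emb_closed[OF b] u(1)]) (use * denomD(3-5)[OF I] in auto)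
    then show ?thesis using gb by (simp add: u_def)
  qed
  then show ?thesis using g.emb_closed[OF c] by blast
qed

end

section \<open>Orthogonal closures inside a maximal system of quotients\<close>

lemma (in cring) dense_orthogonal_one: "dense_orthogonal R {\<one>}"
  by (rule dense_orthogonalI) (auto simp: idempotents_def)

text \<open>Two properties, each valid on the pieces of its own partition and inherited by
  multiples, hold together on the products of pieces.\<close>

lemma (in cring) dense_orthogonal_common:
  assumes D: "dense_orthogonal R D" "\<And>e. e \<in> D \<Longrightarrow> Pr e" and D': "dense_orthogonal R D'" "\<And>e. e \<in> D' \<Longrightarrow> Pr' e"
    and Pr: "\<And>c e. \<lbrakk>c \<in> carrier R; e \<in> carrier R; Pr e\<rbrakk> \<Longrightarrow> Pr (c \<otimes> e)"
    and Pr': "\<And>c e. \<lbrakk>c \<in> carrier R; e \<in> carrier R; Pr' e\<rbrakk> \<Longrightarrow> Pr' (c \<otimes> e)"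
  obtains G where "dense_orthogonal R G" "\<And>e. e \<in> G \<Longrightarrow> Pr e \<and> Pr' e"
proof (rule that)
  show "dense_orthogonal R {d \<otimes> e | d e. d \<in> D \<and> e \<in> D'}" by (rule dense_orthogonal_refine[OF D(1) D'(1)])
  fix u assume "u \<in> {d \<otimes> e | d e. d \<in> D \<and> e \<in> D'}"
  then obtain d e where de: "d \<in> D" "e \<in> D'" "u = d \<otimes> e" by blast
  note c = dense_orthogonalD(2)[OF D(1) de(1)] dense_orthogonalD(2)[OF D'(1) de(2)]
  show "Pr u \<and> Pr' u"
    using Pr[OF c(2,1) D(2)[OF de(1)]] Pr'[OF c D'(2)[OF de(2)]] de(3) m_comm[OF c] by simp
qed

lemma triple_lie_subsystem:
  assumes "triple_lie_system K Q" and W: "carrier W \<subseteq> carrier Q" and zero: "\<zero>\<^bsub>W\<^esub> = \<zero>\<^bsub>Q\<^esub>" "\<zero>\<^bsub>Q\<^esub> \<in> carrier W"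
    and add: "\<And>x y. \<lbrakk>x \<in> carrier W; y \<in> carrier W\<rbrakk> \<Longrightarrow> x \<oplus>\<^bsub>W\<^esub> y = x \<oplus>\<^bsub>Q\<^esub> y \<and> x \<oplus>\<^bsub>Q\<^esub> y \<in> carrier W"
    and smult: "\<And>c x. \<lbrakk>c \<in> carrier K; x \<in> carrier W\<rbrakk> \<Longrightarrow> c \<odot>\<^bsub>W\<^esub> x = c \<odot>\<^bsub>Q\<^esub> x \<and> c \<odot>\<^bsub>Q\<^esub> x \<in> carrier W"
    and triple: "\<And>x y z. \<lbrakk>x \<in> carrier W; y \<in> carrier W; z \<in> carrier W\<rbrakk> \<Longrightarrow>
      \<lblot>x,y,z\<rblot>\<^bsub>W\<^esub> = \<lblot>x,y,z\<rblot>\<^bsub>Q\<^esub> \<and> \<lblot>x,y,z\<rblot>\<^bsub>Q\<^esub> \<in> carrier W"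
  shows "triple_subsystem K W Q"
proof -
  interpret Q: triple_lie_system K Q by fact
  note WQ [simp] = subsetD[OF W]
  note ops [simp] = add[THEN conjunct1] smult[THEN conjunct1] triple[THEN conjunct1] zero
    add[THEN conjunct2] smult[THEN conjunct2] triple[THEN conjunct2]
  have "abelian_group W"
  proof (rule abelian_groupI)
    fix x assume x: "x \<in> carrier W"
    have "\<ominus>\<^bsub>Q\<^esub> x = (\<ominus>\<^bsub>K\<^esub> \<one>\<^bsub>K\<^esub>) \<odot>\<^bsub>Q\<^esub> x" using x by (simp add: Q.smult_l_minus)
    then have m: "\<ominus>\<^bsub>Q\<^esub> x \<in> carrier W" using smult[of "\<ominus>\<^bsub>K\<^esub> \<one>\<^bsub>K\<^esub>" x] x by simp
    show "\<exists>y\<in>carrier W. y \<oplus>\<^bsub>W\<^esub> x = \<zero>\<^bsub>W\<^esub>" by (rule bexI[OF _ m]) (use m x in \<open>simp add: Q.M.l_neg\<close>)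
  qed (auto simp: Q.M.a_ac)
  then have "module K W"
    by (intro moduleI Q.R.cring_axioms) (auto simp: Q.smult_l_distr Q.smult_r_distr Q.smult_assoc1)
  then interpret W: module K W .
  have "triple_lie_system K W"
  proof
    show "trilinear K W (triple W)" by (auto simp: trilinear_def Q.triple_add Q.triple_smult)
    fix x y z a b assume x: "x \<in> carrier W" and y: "y \<in> carrier W"
    show "\<lblot>x,x,y\<rblot>\<^bsub>W\<^esub> = \<zero>\<^bsub>W\<^esub>" using x y by (simp add: Q.alternating)
    assume z: "z \<in> carrier W"
    show "\<lblot>x,y,z\<rblot>\<^bsub>W\<^esub> \<oplus>\<^bsub>W\<^esub> \<lblot>y,z,x\<rblot>\<^bsub>W\<^esub> \<oplus>\<^bsub>W\<^esub> \<lblot>z,x,y\<rblot>\<^bsub>W\<^esub> = \<zero>\<^bsub>W\<^esub>"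
      using x y z by (simp add: Q.cyclic)
    assume a: "a \<in> carrier W" and b: "b \<in> carrier W"
    show "\<lblot>x,y,\<lblot>z,a,b\<rblot>\<^bsub>W\<^esub>\<rblot>\<^bsub>W\<^esub> = \<lblot>\<lblot>x,y,z\<rblot>\<^bsub>W\<^esub>,a,b\<rblot>\<^bsub>W\<^esub> \<oplus>\<^bsub>W\<^esub> \<lblot>z,\<lblot>x,y,a\<rblot>\<^bsub>W\<^esub>,b\<rblot>\<^bsub>W\<^esub> \<oplus>\<^bsub>W\<^esub> \<lblot>z,a,\<lblot>x,y,b\<rblot>\<^bsub>W\<^esub>\<rblot>\<^bsub>W\<^esub>"
      using Q.derivation[of x y z a b] x y z a b by simp
  qed
  then show ?thesis using Q.triple_lie_system_axioms by (auto simp: triple_embedding_def)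
qed

context closed_quotient
begin

text \<open>The elements lying in \<open>A\<close> locally, that is, on the pieces of some dense
  orthogonal set. For A the image of \<open>T\<close> this will turn out to be the orthogonal
  completion; it is also formed for ideals, in order to pass denominators to the completion.\<close>

definition orth_closure :: "'c set \<Rightarrow> 'c set"
  where "orth_closure A = {x \<in> carrier Q. \<exists>D. dense_orthogonal K D \<and> (\<forall>e\<in>D. e \<odot>\<^bsub>Q\<^esub> x \<in> A)}"

lemma orth_closureI:
  "\<lbrakk>x \<in> carrier Q; dense_orthogonal K D; \<And>e. e \<in> D \<Longrightarrow> e \<odot>\<^bsub>Q\<^esub> x \<in> A\<rbrakk> \<Longrightarrow> x \<in> orth_closure A"
  unfolding orth_closure_def by blast

lemma orth_closureE:
  assumes "x \<in> orth_closure A"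
  obtains D where "dense_orthogonal K D" "\<And>e. e \<in> D \<Longrightarrow> e \<odot>\<^bsub>Q\<^esub> x \<in> A" "x \<in> carrier Q"
  using assms unfolding orth_closure_def by blast

lemma orth_closure_subset: "A \<subseteq> carrier Q \<Longrightarrow> A \<subseteq> orth_closure A"
  by (intro subsetI orth_closureI[OF _ R.dense_orthogonal_one]) auto

lemma image_smult:
  assumes I: "triple_ideal K T I" and "c \<in> carrier K" "x \<in> i ` I"
  shows "c \<odot>\<^bsub>Q\<^esub> x \<in> i ` I"
proof -
  obtain a where a: "a \<in> I" "x = i a" using assms by blast
  then have "c \<odot>\<^bsub>Q\<^esub> x = i (c \<odot> a)" using subsetD[OF triple_ideal_subset[OF I]] assms(2) by simp
  then show ?thesis using triple_ideal_mem(4)[OF I assms(2) a(1)] by blast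
qed

lemma image_smult_stable:
  assumes "triple_ideal K T I" "x \<in> carrier Q" "c \<in> carrier K" "e \<in> carrier K" "e \<odot>\<^bsub>Q\<^esub> x \<in> i ` I"
  shows "(c \<otimes>\<^bsub>K\<^esub> e) \<odot>\<^bsub>Q\<^esub> x \<in> i ` I"
  using image_smult[OF assms(1,3,5)] Q.smult_assoc1[OF assms(3,4,2)] by simp

lemma orth_closure_common:
  assumes I: "triple_ideal K T I" "x \<in> orth_closure (i ` I)" and J: "triple_ideal K T J" "y \<in> orth_closure (i ` J)"
  obtains D where "dense_orthogonal K D" "\<And>e. e \<in> D \<Longrightarrow> e \<odot>\<^bsub>Q\<^esub> x \<in> i ` I \<and> e \<odot>\<^bsub>Q\<^esub> y \<in> i ` J"
proof -
  obtain D where D: "dense_orthogonal K D" "\<And>e. e \<in> D \<Longrightarrow> e \<odot>\<^bsub>Q\<^esub> x \<in> i ` I" "x \<in> carrier Q"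
    using orth_closureE[OF I(2)] by blast
  obtain D' where D': "dense_orthogonal K D'" "\<And>e. e \<in> D' \<Longrightarrow> e \<odot>\<^bsub>Q\<^esub> y \<in> i ` J" "y \<in> carrier Q"
    using orth_closureE[OF J(2)] by blast
  show thesis
    by (rule R.dense_orthogonal_common[where Pr = "\<lambda>e. e \<odot>\<^bsub>Q\<^esub> x \<in> i ` I" and Pr' = "\<lambda>e. e \<odot>\<^bsub>Q\<^esub> y \<in> i ` J",
        OF D(1,2) D'(1,2) image_smult_stable[OF I(1) D(3)] image_smult_stable[OF J(1) D'(3)]])
      (assumption | rule that)+
qed

lemma orth_closure_add:
  assumes I: "triple_ideal K T I" and x: "x \<in> orth_closure (i ` I)" and y: "y \<in> orth_closure (i ` I)"
  shows "x \<oplus>\<^bsub>Q\<^esub> y \<in> orth_closure (i ` I)"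
proof -
  obtain D where D: "dense_orthogonal K D" "\<And>e. e \<in> D \<Longrightarrow> e \<odot>\<^bsub>Q\<^esub> x \<in> i ` I \<and> e \<odot>\<^bsub>Q\<^esub> y \<in> i ` I"
    using orth_closure_common[OF I x I y] by blast
  have c: "x \<in> carrier Q" "y \<in> carrier Q" using x y by (auto simp: orth_closure_def)
  show ?thesis
  proof (rule orth_closureI[OF _ D(1)])
    fix e assume e: "e \<in> D"
    obtain a b where ab: "a \<in> I" "b \<in> I" "e \<odot>\<^bsub>Q\<^esub> x = i a" "e \<odot>\<^bsub>Q\<^esub> y = i b" using D(2)[OF e] by blast
    then have "e \<odot>\<^bsub>Q\<^esub> (x \<oplus>\<^bsub>Q\<^esub> y) = i (a \<oplus> b)"
      using c R.dense_orthogonalD(2)[OF D(1) e] subsetD[OF triple_ideal_subset[OF I]] by (simp add: Q.smult_r_distr)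
    then show "e \<odot>\<^bsub>Q\<^esub> (x \<oplus>\<^bsub>Q\<^esub> y) \<in> i ` I" using triple_ideal_mem(2)[OF I ab(1,2)] by blast
  qed (use c in simp)
qed

lemma orth_closure_smult:
  assumes I: "triple_ideal K T I" and x: "x \<in> orth_closure (i ` I)" and c: "c \<in> carrier K"
  shows "c \<odot>\<^bsub>Q\<^esub> x \<in> orth_closure (i ` I)"
proof -
  obtain D where D: "dense_orthogonal K D" "\<And>e. e \<in> D \<Longrightarrow> e \<odot>\<^bsub>Q\<^esub> x \<in> i ` I" "x \<in> carrier Q"
    using orth_closureE[OF x] by blast
  show ?thesis
    using c D image_smult[OF I c] smult_swap[OF R.dense_orthogonalD(2)[OF D(1)] c D(3)]
    by (intro orth_closureI[OF _ D(1)]) auto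
qed

lemma idem_triple:
  assumes "e \<in> carrier K" "e \<otimes>\<^bsub>K\<^esub> e = e" "x \<in> carrier Q" "y \<in> carrier Q" "z \<in> carrier Q"
  shows "e \<odot>\<^bsub>Q\<^esub> \<lblot>x,y,z\<rblot>\<^bsub>Q\<^esub> = \<lblot>e \<odot>\<^bsub>Q\<^esub> x,e \<odot>\<^bsub>Q\<^esub> y,z\<rblot>\<^bsub>Q\<^esub>" "e \<odot>\<^bsub>Q\<^esub> \<lblot>x,y,z\<rblot>\<^bsub>Q\<^esub> = \<lblot>x,e \<odot>\<^bsub>Q\<^esub> y,e \<odot>\<^bsub>Q\<^esub> z\<rblot>\<^bsub>Q\<^esub>"
  using assms Q.smult_assoc1[of e e "\<lblot>x,y,z\<rblot>\<^bsub>Q\<^esub>"] by (simp_all add: Q.triple_smult)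

lemma orth_closure_triple:
  assumes I: "triple_ideal K T I" and x: "x \<in> orth_closure (i ` I)"
    and y: "y \<in> orth_closure (i ` carrier T)" and z: "z \<in> orth_closure (i ` carrier T)"
  shows "\<lblot>x,y,z\<rblot>\<^bsub>Q\<^esub> \<in> orth_closure (i ` I)"
proof -
  obtain D where D: "dense_orthogonal K D" "\<And>e. e \<in> D \<Longrightarrow> e \<odot>\<^bsub>Q\<^esub> x \<in> i ` I \<and> e \<odot>\<^bsub>Q\<^esub> y \<in> i ` carrier T"
    using orth_closure_common[OF I x triple_ideal_carrier y] by blast
  obtain D' where D': "dense_orthogonal K D'" "\<And>e. e \<in> D' \<Longrightarrow> e \<odot>\<^bsub>Q\<^esub> z \<in> i ` carrier T"
    using orth_closureE[OF z] by blast
  have c: "x \<in> carrier Q" "y \<in> carrier Q" "z \<in> carrier Q" using x y z by (auto simp: orth_closure_def)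
  show ?thesis
  proof (rule orth_closureI[OF _ R.dense_orthogonal_refine[OF D(1) D'(1)]])
    fix u assume "u \<in> {d \<otimes>\<^bsub>K\<^esub> e | d e. d \<in> D \<and> e \<in> D'}"
    then obtain d e where de: "d \<in> D" "e \<in> D'" "u = d \<otimes>\<^bsub>K\<^esub> e" by blast
    note dc = R.dense_orthogonalD(2,3)[OF D(1) de(1)] and ec = R.dense_orthogonalD(2,3)[OF D'(1) de(2)]
    obtain a b t where abt: "a \<in> I" "b \<in> carrier T" "t \<in> carrier T" "d \<odot>\<^bsub>Q\<^esub> x = i a" "d \<odot>\<^bsub>Q\<^esub> y = i b" "e \<odot>\<^bsub>Q\<^esub> z = i t"
      using D(2)[OF de(1)] D'(2)[OF de(2)] by blast
    \<comment> \<open>x and y share the partition containing d, while z has its own; the idempotent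
      d can be used on both of its arguments.\<close>
    have "u \<odot>\<^bsub>Q\<^esub> \<lblot>x,y,z\<rblot>\<^bsub>Q\<^esub> = \<lblot>d \<odot>\<^bsub>Q\<^esub> x,d \<odot>\<^bsub>Q\<^esub> y,e \<odot>\<^bsub>Q\<^esub> z\<rblot>\<^bsub>Q\<^esub>"
      using c dc ec Q.smult_assoc1[of d e "\<lblot>x,y,z\<rblot>\<^bsub>Q\<^esub>"] idem_triple(1)[OF dc c(1,2), of "e \<odot>\<^bsub>Q\<^esub> z"] de(3)
      by (simp add: Q.triple_smult(3)[of e x y z, symmetric])
    also have "\<dots> = i \<lblot>a,b,t\<rblot>" using abt subsetD[OF triple_ideal_subset[OF I]] by simp
    finally show "u \<odot>\<^bsub>Q\<^esub> \<lblot>x,y,z\<rblot>\<^bsub>Q\<^esub> \<in> i ` I" using triple_ideal_triple(1)[OF I abt(1-3)] by simp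
  qed (use c in simp)
qed

lemma orth_closure_zero:
  assumes I: "triple_ideal K T I"
  shows "\<zero>\<^bsub>Q\<^esub> \<in> orth_closure (i ` I)"
proof -
  have "i ` I \<subseteq> carrier Q" using triple_ideal_subset[OF I] by auto
  moreover have "\<zero>\<^bsub>Q\<^esub> \<in> i ` I" using imageI[OF triple_ideal_mem(1)[OF I], of i] by simp
  ultimately show ?thesis using orth_closure_subset by blast
qed

text \<open>Maximality provides the orthogonal sum in \<open>Q\<close>. It lies in the closure
  because the partitions belonging to the f e refine \<open>D\<close> to a dense orthogonal set on
  whose pieces the sum lies in the image of \<open>I\<close>.\<close>

lemma orth_closure_complete:
  assumes max: "maximal_quotient_system K T Q i" and I: "triple_ideal K T I" and D: "dense_orthogonal K D"
    and f: "\<And>e. e \<in> D \<Longrightarrow> f e \<in> orth_closure (i ` I)"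
  shows "\<exists>x\<in>orth_closure (i ` I). \<forall>e\<in>D. e \<odot>\<^bsub>Q\<^esub> x = e \<odot>\<^bsub>Q\<^esub> f e"
proof -
  have fc: "f e \<in> carrier Q" if "e \<in> D" for e using f[OF that] by (simp add: orth_closure_def)
  obtain x where x: "x \<in> carrier Q" "\<forall>e\<in>D. e \<odot>\<^bsub>Q\<^esub> x = e \<odot>\<^bsub>Q\<^esub> f e"
    using maximal_orth_complete[OF max D, of f] fc by blast
  have "\<forall>e\<in>D. \<exists>G. dense_orthogonal K G \<and> (\<forall>d\<in>G. d \<odot>\<^bsub>Q\<^esub> f e \<in> i ` I)"
    using f unfolding orth_closure_def by blast
  then obtain G where G: "\<And>e. e \<in> D \<Longrightarrow> dense_orthogonal K (G e)" "\<And>e d. \<lbrakk>e \<in> D; d \<in> G e\<rbrakk> \<Longrightarrow> d \<odot>\<^bsub>Q\<^esub> f e \<in> i ` I"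
    using bchoice[of D "\<lambda>e G. dense_orthogonal K G \<and> (\<forall>d\<in>G. d \<odot>\<^bsub>Q\<^esub> f e \<in> i ` I)"] by blast
  have "x \<in> orth_closure (i ` I)"
  proof (rule orth_closureI[OF x(1) R.dense_orthogonal_refine[OF D G(1)]])
    fix u assume "u \<in> {e \<otimes>\<^bsub>K\<^esub> d | e d. e \<in> D \<and> d \<in> G e}"
    then obtain e d where de: "e \<in> D" "d \<in> G e" "u = e \<otimes>\<^bsub>K\<^esub> d" by blast
    note c = R.dense_orthogonalD(2)[OF D de(1)] R.dense_orthogonalD(2)[OF G(1)[OF de(1)] de(2)]
    have "u \<odot>\<^bsub>Q\<^esub> x = d \<odot>\<^bsub>Q\<^esub> (e \<odot>\<^bsub>Q\<^esub> x)"
      using Q.smult_assoc1[OF c(2,1) x(1)] R.m_comm[OF c] de(3) by simp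
    also have "\<dots> = e \<odot>\<^bsub>Q\<^esub> (d \<odot>\<^bsub>Q\<^esub> f e)" using x(2) de(1) smult_swap[OF c(2,1) fc[OF de(1)]] by simp
    finally show "u \<odot>\<^bsub>Q\<^esub> x \<in> i ` I" using image_smult[OF I c(1) G(2)[OF de(1,2)]] by simp
  qed
  then show ?thesis using x(2) by blast
qed

end

section \<open>The orthogonal completion inside the hull\<close>

locale maximal_quotient_in_hull = closed_system K T
  for K :: "('a, 'm) ring_scheme" and T :: "('a, 'b, 'n) triple_system_scheme" (structure) +
  fixes H :: "('b \<Rightarrow> 'b, 'h) module" and k :: "'b \<Rightarrow> 'h" and Q :: "('a, 'h) triple_system"
  assumes hull: "injective_hull (mult_ring K T) (op_module T) H k"
    and maximal_in: "maximal_quotient_system_in K T H k Q"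
begin

lemma maximal: "maximal_quotient_system K T Q k"
  using maximal_in by (simp add: maximal_quotient_system_in_def)

end

sublocale maximal_quotient_in_hull \<subseteq> closed_quotient K T Q k
proof -
  have "quotient_system K T Q k" using maximal by (simp add: maximal_quotient_system_def)
  then interpret quotient_embedding K T Q k by (rule quotient_embeddingI)
  show "closed_quotient K T Q k" ..
qed

sublocale maximal_quotient_in_hull \<subseteq> HM: mult_module K T H
  by (intro mult_module.intro triple_lie_system_axioms)
    (use hull in \<open>simp add: injective_hull_def injective_rmod_def\<close>)

context maximal_quotient_in_hull
begin

abbreviation OQ where "OQ \<equiv> orth_closure (k ` carrier T)"

lemma Q_H:
  shows Q_subset: "x \<in> carrier Q \<Longrightarrow> x \<in> carrier H"
    and Q_add: "\<lbrakk>x \<in> carrier Q; y \<in> carrier Q\<rbrakk> \<Longrightarrow> x \<oplus>\<^bsub>H\<^esub> y = x \<oplus>\<^bsub>Q\<^esub> y"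
    and Q_smult: "\<lbrakk>c \<in> carrier K; x \<in> carrier Q\<rbrakk> \<Longrightarrow> scalar_op T c \<odot>\<^bsub>H\<^esub> x = c \<odot>\<^bsub>Q\<^esub> x"
  using maximal_in HM.X.submoduleD(1)[of "carrier Q" x] by (auto simp: maximal_quotient_system_in_def)

lemma Q_zero: "\<zero>\<^bsub>H\<^esub> = \<zero>\<^bsub>Q\<^esub>"
  using Q_add[of "\<zero>\<^bsub>Q\<^esub>" "\<zero>\<^bsub>Q\<^esub>"] Q_subset[of "\<zero>\<^bsub>Q\<^esub>"] HM.X.M.add.r_cancel_one'[of "\<zero>\<^bsub>Q\<^esub>" "\<zero>\<^bsub>Q\<^esub>"] by simp

text \<open>Scalars commute with M(T)', so the elements of \<open>H\<close> killed by
  \<open>D\<close> form a submodule. It meets \<open>T\<close> in zero by \<open>dense_zero\<close>,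
  hence is zero by essentiality. Uniqueness of orthogonal sums is thereby secured in all of
  \<open>H\<close>, as the completion is formed there and not in \<open>Q\<close>.\<close>

lemma hull_dense_zero:
  assumes D: "dense_orthogonal K D" and h: "h \<in> carrier H" and z: "\<And>e. e \<in> D \<Longrightarrow> scalar_op T e \<odot>\<^bsub>H\<^esub> h = \<zero>\<^bsub>H\<^esub>"
  shows "h = \<zero>\<^bsub>H\<^esub>"
proof -
  note D' = R.dense_orthogonalD(2)[OF D]
  define A where "A = {h \<in> carrier H. \<forall>e\<in>D. scalar_op T e \<odot>\<^bsub>H\<^esub> h = \<zero>\<^bsub>H\<^esub>}"
  have "submodule A (mult_ring K T) H"
  proof (rule HM.X.submoduleI)
    show "m \<odot>\<^bsub>H\<^esub> x \<in> A" if "m \<in> carrier (mult_ring K T)" "x \<in> A" for m x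
      using that D' HM.act_scalar_swap[OF that(1) D', symmetric] by (auto simp: A_def HM.X.act_closed)
  qed (use D' scalar_op_mult_ring in \<open>auto simp: A_def HM.X.act_r_distr\<close>)
  moreover have "A \<inter> k ` carrier T = {\<zero>\<^bsub>H\<^esub>}"
  proof -
    have "x = \<zero>\<^bsub>H\<^esub>" if x: "x \<in> A" "x \<in> k ` carrier T" for x
    proof -
      have "x \<in> carrier Q" using x(2) by auto
      then show ?thesis using dense_zero[OF D, of x] x(1) Q_smult[OF D'] Q_zero by (simp add: A_def)
    qed
    moreover have "\<zero>\<^bsub>H\<^esub> \<in> k ` carrier T" using Q_zero emb_zero M.zero_closed by (metis imageI)
    moreover have "\<zero>\<^bsub>H\<^esub> \<in> A" using HM.X.submoduleD(2)[OF \<open>submodule A (mult_ring K T) H\<close>] .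
    ultimately show ?thesis by blast
  qed
  ultimately have "A = {\<zero>\<^bsub>H\<^esub>}"
    using hull by (auto simp: injective_hull_def essential_submodule_def op_module_def)
  then show ?thesis using h z by (auto simp: A_def)
qed

lemma hull_dense_eqI:
  assumes D: "dense_orthogonal K D" and h: "g \<in> carrier H" "h \<in> carrier H"
    and eq: "\<And>e. e \<in> D \<Longrightarrow> scalar_op T e \<odot>\<^bsub>H\<^esub> g = scalar_op T e \<odot>\<^bsub>H\<^esub> h"
  shows "g = h"
proof -
  have "g \<oplus>\<^bsub>H\<^esub> \<ominus>\<^bsub>H\<^esub> h = \<zero>\<^bsub>H\<^esub>"
  proof (rule hull_dense_zero[OF D])
    fix e assume e: "e \<in> D"
    note s = scalar_op_mult_ring[OF R.dense_orthogonalD(2)[OF D e]]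
    show "scalar_op T e \<odot>\<^bsub>H\<^esub> (g \<oplus>\<^bsub>H\<^esub> \<ominus>\<^bsub>H\<^esub> h) = \<zero>\<^bsub>H\<^esub>"
      using h eq[OF e] by (simp add: HM.X.act_r_distr[OF s] HM.X.act_minus[OF s] HM.X.M.r_neg HM.X.act_closed[OF s])
  qed (use h in simp)
  then show ?thesis using HM.X.M.minus_equality[of g "\<ominus>\<^bsub>H\<^esub> h"] h by simp
qed

lemma scalar_module_simps:
  "carrier (scalar_module T H) = carrier H" "c \<odot>\<^bsub>scalar_module T H\<^esub> x = scalar_op T c \<odot>\<^bsub>H\<^esub> x"
  by (simp_all add: scalar_module_def)

lemma Q_orth_complete: "orth_complete K (scalar_module T H) (carrier Q)"
  unfolding orth_complete_def orth_sum_def scalar_module_simps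
proof (intro conjI allI impI)
  fix D f assume "dense_orthogonal K D \<and> f \<in> D \<rightarrow> carrier Q"
  then have D: "dense_orthogonal K D" and f: "\<And>e. e \<in> D \<Longrightarrow> f e \<in> carrier Q" by auto
  obtain x where "x \<in> carrier Q" "\<forall>e\<in>D. e \<odot>\<^bsub>Q\<^esub> x = e \<odot>\<^bsub>Q\<^esub> f e" using maximal_orth_complete[OF maximal D, of f] f by blast
  then show "\<exists>x\<in>carrier Q. dense_orthogonal K D \<and> (\<forall>e\<in>D. scalar_op T e \<odot>\<^bsub>H\<^esub> x = scalar_op T e \<odot>\<^bsub>H\<^esub> f e)"
    using D f Q_smult[OF R.dense_orthogonalD(2)[OF D]] by (intro bexI[of _ x]) auto
qed (use Q_subset in blast)

lemma Q_orth_completion: "carrier Q = orth_completion K (scalar_module T H) (carrier Q)"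
  using Q_orth_complete unfolding orth_completion_def by blast

lemma OQ_subset: "x \<in> OQ \<Longrightarrow> x \<in> carrier Q"
  by (simp add: orth_closure_def)

lemma OQ_orth_complete: "orth_complete K (scalar_module T H) OQ"
  unfolding orth_complete_def orth_sum_def scalar_module_simps
proof (intro conjI allI impI)
  fix D f assume "dense_orthogonal K D \<and> f \<in> D \<rightarrow> OQ"
  then have D: "dense_orthogonal K D" and f: "\<And>e. e \<in> D \<Longrightarrow> f e \<in> OQ" by auto
  obtain x where "x \<in> OQ" "\<forall>e\<in>D. e \<odot>\<^bsub>Q\<^esub> x = e \<odot>\<^bsub>Q\<^esub> f e"
    using orth_closure_complete[OF maximal triple_ideal_carrier D, of f] f by blast
  then show "\<exists>x\<in>OQ. dense_orthogonal K D \<and> (\<forall>e\<in>D. scalar_op T e \<odot>\<^bsub>H\<^esub> x = scalar_op T e \<odot>\<^bsub>H\<^esub> f e)"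
    using D OQ_subset f Q_smult[OF R.dense_orthogonalD(2)[OF D]] by (intro bexI[of _ x]) auto
qed (use Q_subset OQ_subset in blast)

lemma OQ_orth_completion: "orth_completion K (scalar_module T H) (k ` carrier T) = OQ"
proof
  have "k ` carrier T \<subseteq> OQ" by (rule orth_closure_subset) auto
  then show "orth_completion K (scalar_module T H) (k ` carrier T) \<subseteq> OQ"
    using OQ_orth_complete unfolding orth_completion_def by blast
  show "OQ \<subseteq> orth_completion K (scalar_module T H) (k ` carrier T)"
    unfolding orth_completion_def
  proof (intro subsetI InterI)
    fix x W assume x: "x \<in> OQ" and "W \<in> {W. orth_complete K (scalar_module T H) W \<and> k ` carrier T \<subseteq> W}"
    then have W: "orth_complete K (scalar_module T H) W" "k ` carrier T \<subseteq> W" by auto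
    obtain D where D: "dense_orthogonal K D" "\<And>e. e \<in> D \<Longrightarrow> e \<odot>\<^bsub>Q\<^esub> x \<in> k ` carrier T" "x \<in> carrier Q"
      using orth_closureE[OF x] by blast
    note D' = R.dense_orthogonalD[OF D(1)]
    have "(\<lambda>e. e \<odot>\<^bsub>Q\<^esub> x) \<in> D \<rightarrow> W" using D(2) W(2) by auto
    \<comment> \<open>An orthogonally complete \<open>W\<close> containing \<open>T\<close> contains
      an orthogonal sum of the pieces e x, and uniqueness in \<open>H\<close> identifies this sum
      with \<open>x\<close>.\<close>
    then obtain w where w: "w \<in> W" "orth_sum K (scalar_module T H) D (\<lambda>e. e \<odot>\<^bsub>Q\<^esub> x) w"
      using W(1) D(1) unfolding orth_complete_def by blast
    have wH: "w \<in> carrier H" using w(1) W(1) by (auto simp: orth_complete_def scalar_module_simps)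
    have "w = x"
    proof (rule hull_dense_eqI[OF D(1) wH Q_subset[OF D(3)]])
      fix e assume e: "e \<in> D"
      have "scalar_op T e \<odot>\<^bsub>H\<^esub> w = scalar_op T e \<odot>\<^bsub>H\<^esub> (e \<odot>\<^bsub>Q\<^esub> x)"
        using w(2) e by (simp add: orth_sum_def scalar_module_simps)
      also have "\<dots> = e \<odot>\<^bsub>Q\<^esub> (e \<odot>\<^bsub>Q\<^esub> x)" using Q_smult D'(2)[OF e] D(3) by simp
      also have "\<dots> = e \<odot>\<^bsub>Q\<^esub> x" using Q.smult_assoc1[OF D'(2)[OF e] D'(2)[OF e], of x] D'(3)[OF e] D(3) e by simp
      finally show "scalar_op T e \<odot>\<^bsub>H\<^esub> w = scalar_op T e \<odot>\<^bsub>H\<^esub> x" using Q_smult[OF D'(2)[OF e] D(3)] by simp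
    qed
    then show "x \<in> W" using w(1) by simp
  qed
qed

lemma OQ_orth_sum:
  assumes "x \<in> OQ"
  obtains A a where "a \<in> A \<rightarrow> carrier T" "orth_sum K (scalar_module T H) A (k \<circ> a) x"
proof -
  obtain D where D: "dense_orthogonal K D" "\<And>e. e \<in> D \<Longrightarrow> e \<odot>\<^bsub>Q\<^esub> x \<in> k ` carrier T" "x \<in> carrier Q"
    using orth_closureE[OF assms] by blast
  note D' = R.dense_orthogonalD[OF D(1)]
  have "\<forall>e\<in>D. \<exists>a. a \<in> carrier T \<and> e \<odot>\<^bsub>Q\<^esub> x = k a" using D(2) by blast
  then obtain a where a: "\<And>e. e \<in> D \<Longrightarrow> a e \<in> carrier T \<and> e \<odot>\<^bsub>Q\<^esub> x = k (a e)"
    using bchoice[of D "\<lambda>e a. a \<in> carrier T \<and> e \<odot>\<^bsub>Q\<^esub> x = k a"] by blast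
  have "e \<odot>\<^bsub>Q\<^esub> x = e \<odot>\<^bsub>Q\<^esub> k (a e)" if e: "e \<in> D" for e
  proof -
    have "e \<odot>\<^bsub>Q\<^esub> x = e \<odot>\<^bsub>Q\<^esub> (e \<odot>\<^bsub>Q\<^esub> x)" using Q.smult_assoc1[OF D'(2)[OF e] D'(2)[OF e], of x] D'(3)[OF e] D(3) by simp
    then show ?thesis using a[OF e] by simp
  qed
  then have "orth_sum K (scalar_module T H) D (k \<circ> a) x"
    using D(1,3) D'(2) a Q_smult by (simp add: orth_sum_def scalar_module_simps)
  then show thesis using that[of a D] a by blast
qed

text \<open>The componentwise composition is a definite description quantified over all
  representations of x, y, z. The product in \<open>Q\<close> satisfies it for every representation,
  because d e g splits over the three arguments; this also settles independence of the
  representation.\<close>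

lemma O_triple_eq:
  assumes x: "x \<in> OQ" and y: "y \<in> OQ" and z: "z \<in> OQ"
  shows "O_triple K T H k x y z = \<lblot>x,y,z\<rblot>\<^bsub>Q\<^esub>"
proof -
  let ?M = "scalar_module T H"
  note xyz = OQ_subset[OF x] OQ_subset[OF y] OQ_subset[OF z]
  have key: "(d \<otimes>\<^bsub>K\<^esub> e \<otimes>\<^bsub>K\<^esub> g) \<odot>\<^bsub>Q\<^esub> \<lblot>x,y,z\<rblot>\<^bsub>Q\<^esub> = (d \<otimes>\<^bsub>K\<^esub> e \<otimes>\<^bsub>K\<^esub> g) \<odot>\<^bsub>Q\<^esub> k \<lblot>a d,b e,c g\<rblot>"
    if a: "a \<in> A \<rightarrow> carrier T" "orth_sum K ?M A (k \<circ> a) x" and b: "b \<in> B \<rightarrow> carrier T" "orth_sum K ?M B (k \<circ> b) y"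
      and c: "c \<in> C \<rightarrow> carrier T" "orth_sum K ?M C (k \<circ> c) z" and deg: "d \<in> A" "e \<in> B" "g \<in> C"
    for A a B b C c d e g
  proof -
    have cl: "a d \<in> carrier T" "b e \<in> carrier T" "c g \<in> carrier T" using that by auto
    have K: "d \<in> carrier K" "e \<in> carrier K" "g \<in> carrier K"
      using that R.dense_orthogonalD(2) unfolding orth_sum_def by blast+
    have eq: "d \<odot>\<^bsub>Q\<^esub> x = d \<odot>\<^bsub>Q\<^esub> k (a d)" "e \<odot>\<^bsub>Q\<^esub> y = e \<odot>\<^bsub>Q\<^esub> k (b e)" "g \<odot>\<^bsub>Q\<^esub> z = g \<odot>\<^bsub>Q\<^esub> k (c g)"
      using a(2) b(2) c(2) deg Q_smult K cl xyz by (auto simp: orth_sum_def scalar_module_simps)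
    have split: "(d \<otimes>\<^bsub>K\<^esub> e \<otimes>\<^bsub>K\<^esub> g) \<odot>\<^bsub>Q\<^esub> \<lblot>u,v,w\<rblot>\<^bsub>Q\<^esub> = \<lblot>d \<odot>\<^bsub>Q\<^esub> u,e \<odot>\<^bsub>Q\<^esub> v,g \<odot>\<^bsub>Q\<^esub> w\<rblot>\<^bsub>Q\<^esub>"
      if "u \<in> carrier Q" "v \<in> carrier Q" "w \<in> carrier Q" for u v w
      using that K Q.triple_smult(1)[of d u "e \<odot>\<^bsub>Q\<^esub> v" "g \<odot>\<^bsub>Q\<^esub> w"] Q.triple_smult(2)[of e u v "g \<odot>\<^bsub>Q\<^esub> w"]
        Q.triple_smult(3)[of g u v w] by (simp add: Q.smult_assoc1)
    show ?thesis using split[OF xyz] split[of "k (a d)" "k (b e)" "k (c g)"] eq cl by simp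
  qed
  have smQ: "u \<odot>\<^bsub>?M\<^esub> w = u \<odot>\<^bsub>Q\<^esub> w" if "u \<in> carrier K" "w \<in> carrier Q" for u w
    using Q_smult[OF that] by (simp add: scalar_module_simps)
  have KK: "d \<otimes>\<^bsub>K\<^esub> e \<otimes>\<^bsub>K\<^esub> g \<in> carrier K"
    if "orth_sum K ?M A f x'" "orth_sum K ?M B f' y'" "orth_sum K ?M C f'' z'" "d \<in> A" "e \<in> B" "g \<in> C"
    for A B C f f' f'' x' y' z' d e g
    using that R.dense_orthogonalD(2) unfolding orth_sum_def by (metis R.m_closed)
  show ?thesis
    unfolding O_triple_def Let_def OQ_orth_completion
  proof (rule the_equality)
    obtain A a where a: "a \<in> A \<rightarrow> carrier T" "orth_sum K ?M A (k \<circ> a) x" by (rule OQ_orth_sum[OF x])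
    obtain B b where b: "b \<in> B \<rightarrow> carrier T" "orth_sum K ?M B (k \<circ> b) y" by (rule OQ_orth_sum[OF y])
    obtain C c where c: "c \<in> C \<rightarrow> carrier T" "orth_sum K ?M C (k \<circ> c) z" by (rule OQ_orth_sum[OF z])
    have val: "(d \<otimes>\<^bsub>K\<^esub> e \<otimes>\<^bsub>K\<^esub> g) \<odot>\<^bsub>?M\<^esub> \<lblot>x,y,z\<rblot>\<^bsub>Q\<^esub> = (d \<otimes>\<^bsub>K\<^esub> e \<otimes>\<^bsub>K\<^esub> g) \<odot>\<^bsub>?M\<^esub> k \<lblot>a d,b e,c g\<rblot>"
      if "d \<in> A" "e \<in> B" "g \<in> C" for d e g
    proof -
      have "a d \<in> carrier T" "b e \<in> carrier T" "c g \<in> carrier T" using that a b c by auto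
      then show ?thesis
        using key[OF a b c that] smQ[OF KK[OF a(2) b(2) c(2) that]] xyz by (simp del: emb_triple)
    qed
    show "\<lblot>x,y,z\<rblot>\<^bsub>Q\<^esub> \<in> OQ \<and> (\<exists>A a B b C c. a \<in> A \<rightarrow> carrier T \<and> b \<in> B \<rightarrow> carrier T \<and> c \<in> C \<rightarrow> carrier T \<and>
        orth_sum K ?M A (k \<circ> a) x \<and> orth_sum K ?M B (k \<circ> b) y \<and> orth_sum K ?M C (k \<circ> c) z \<and>
        (\<forall>d\<in>A. \<forall>e\<in>B. \<forall>g\<in>C.
          (d \<otimes>\<^bsub>K\<^esub> e \<otimes>\<^bsub>K\<^esub> g) \<odot>\<^bsub>?M\<^esub> \<lblot>x,y,z\<rblot>\<^bsub>Q\<^esub> = (d \<otimes>\<^bsub>K\<^esub> e \<otimes>\<^bsub>K\<^esub> g) \<odot>\<^bsub>?M\<^esub> k \<lblot>a d,b e,c g\<rblot>))"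
      by (rule conjI, rule orth_closure_triple[OF triple_ideal_carrier x y z],
          rule exI[of _ A], rule exI[of _ a], rule exI[of _ B], rule exI[of _ b], rule exI[of _ C], rule exI[of _ c])
        (intro conjI ballI a b c val; assumption)
  next
    fix w assume w: "w \<in> OQ \<and> (\<exists>A a B b C c. a \<in> A \<rightarrow> carrier T \<and> b \<in> B \<rightarrow> carrier T \<and> c \<in> C \<rightarrow> carrier T \<and>
        orth_sum K ?M A (k \<circ> a) x \<and> orth_sum K ?M B (k \<circ> b) y \<and> orth_sum K ?M C (k \<circ> c) z \<and>
        (\<forall>d\<in>A. \<forall>e\<in>B. \<forall>g\<in>C. (d \<otimes>\<^bsub>K\<^esub> e \<otimes>\<^bsub>K\<^esub> g) \<odot>\<^bsub>?M\<^esub> w = (d \<otimes>\<^bsub>K\<^esub> e \<otimes>\<^bsub>K\<^esub> g) \<odot>\<^bsub>?M\<^esub> k \<lblot>a d,b e,c g\<rblot>))"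
    then obtain A a B b C c where a: "a \<in> A \<rightarrow> carrier T" "orth_sum K ?M A (k \<circ> a) x"
      and b: "b \<in> B \<rightarrow> carrier T" "orth_sum K ?M B (k \<circ> b) y" and c: "c \<in> C \<rightarrow> carrier T" "orth_sum K ?M C (k \<circ> c) z"
      and eq: "\<And>d e g. \<lbrakk>d \<in> A; e \<in> B; g \<in> C\<rbrakk> \<Longrightarrow>
        (d \<otimes>\<^bsub>K\<^esub> e \<otimes>\<^bsub>K\<^esub> g) \<odot>\<^bsub>?M\<^esub> w = (d \<otimes>\<^bsub>K\<^esub> e \<otimes>\<^bsub>K\<^esub> g) \<odot>\<^bsub>?M\<^esub> k \<lblot>a d,b e,c g\<rblot>"
      by blast
    have wQ: "w \<in> carrier Q" using w OQ_subset by blast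
    have A: "dense_orthogonal K A" and B: "dense_orthogonal K B" and C: "dense_orthogonal K C"
      using a b c by (auto simp: orth_sum_def)
    show "w = \<lblot>x,y,z\<rblot>\<^bsub>Q\<^esub>"
    \<comment> \<open>The products d e g form a dense orthogonal set, so agreement on all of them
      determines the value.\<close>
    proof (rule dense_eqI[OF R.dense_orthogonal_refine[OF R.dense_orthogonal_refine[OF A B] C] wQ])
      fix u assume "u \<in> {v \<otimes>\<^bsub>K\<^esub> g |v g. v \<in> {d \<otimes>\<^bsub>K\<^esub> e |d e. d \<in> A \<and> e \<in> B} \<and> g \<in> C}"
      then obtain d e g where deg: "d \<in> A" "e \<in> B" "g \<in> C" and u: "u = d \<otimes>\<^bsub>K\<^esub> e \<otimes>\<^bsub>K\<^esub> g" by blast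
      have "a d \<in> carrier T" "b e \<in> carrier T" "c g \<in> carrier T" using deg a b c by auto
      then show "u \<odot>\<^bsub>Q\<^esub> w = u \<odot>\<^bsub>Q\<^esub> \<lblot>x,y,z\<rblot>\<^bsub>Q\<^esub>"
        using key[OF a b c deg] eq[OF deg] smQ[OF KK[OF a(2) b(2) c(2) deg]] xyz wQ u by (simp del: emb_triple)
    qed (use xyz in simp)
  qed
qed

abbreviation Osys where "Osys \<equiv> O_system K T H k"

lemma Osys_simps:
  "carrier Osys = OQ" "\<zero>\<^bsub>Osys\<^esub> = \<zero>\<^bsub>Q\<^esub>"
  "\<lbrakk>x \<in> OQ; y \<in> OQ\<rbrakk> \<Longrightarrow> x \<oplus>\<^bsub>Osys\<^esub> y = x \<oplus>\<^bsub>Q\<^esub> y"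
  "\<lbrakk>c \<in> carrier K; x \<in> OQ\<rbrakk> \<Longrightarrow> c \<odot>\<^bsub>Osys\<^esub> x = c \<odot>\<^bsub>Q\<^esub> x"
  "\<lbrakk>x \<in> OQ; y \<in> OQ; z \<in> OQ\<rbrakk> \<Longrightarrow> \<lblot>x,y,z\<rblot>\<^bsub>Osys\<^esub> = \<lblot>x,y,z\<rblot>\<^bsub>Q\<^esub>"
  using OQ_subset Q_add Q_smult Q_zero O_triple_eq
  by (simp_all add: O_system_def OQ_orth_completion scalar_module_simps)

lemma Osys_subsystem: "triple_subsystem K Osys Q"
  using OQ_subset orth_closure_zero[OF triple_ideal_carrier] orth_closure_add[OF triple_ideal_carrier]
    orth_closure_smult[OF triple_ideal_carrier] orth_closure_triple[OF triple_ideal_carrier]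
  by (intro triple_lie_subsystem Q.triple_lie_system_axioms) (simp_all add: Osys_simps subset_iff)

end

section \<open>Localisation\<close>

context triple_lie_system
begin

lemma coset_mem: "u \<in> N +> x \<longleftrightarrow> (\<exists>n\<in>N. u = n \<oplus> x)"
  by (auto simp: a_r_coset_def')

lemma coset_absorb:
  assumes N: "triple_ideal K T N" and n: "n \<in> N" and x: "x \<in> carrier T"
  shows "N +> (n \<oplus> x) = N +> x"
proof -
  note Nc = subsetD[OF triple_ideal_subset[OF N]]
  have 1: "m \<oplus> (n \<oplus> x) = (m \<oplus> n) \<oplus> x" if "m \<in> N" for m using Nc[OF n] Nc[OF that] x by (simp add: M.a_assoc)
  have 2: "m \<oplus> x = (m \<oplus> \<ominus> n) \<oplus> (n \<oplus> x)" if "m \<in> N" for m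
    using Nc[OF n] Nc[OF that] x by (simp add: M.a_assoc M.r_neg1)
  show ?thesis
  proof (intro Set.set_eqI iffI)
    fix u assume "u \<in> N +> (n \<oplus> x)"
    then obtain m where "m \<in> N" "u = m \<oplus> (n \<oplus> x)" unfolding coset_mem by blast
    then have "m \<oplus> n \<in> N" "u = (m \<oplus> n) \<oplus> x" using 1 triple_ideal_mem(2)[OF N _ n] by simp_all
    then show "u \<in> N +> x" unfolding coset_mem by blast
  next
    fix u assume "u \<in> N +> x"
    then obtain m where "m \<in> N" "u = m \<oplus> x" unfolding coset_mem by blast
    then have "m \<oplus> \<ominus> n \<in> N" "u = (m \<oplus> \<ominus> n) \<oplus> (n \<oplus> x)"
      using 2 triple_ideal_mem(2)[OF N _ triple_ideal_mem(3)[OF N n]] by simp_all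
    then show "u \<in> N +> (n \<oplus> x)" unfolding coset_mem by blast
  qed
qed

lemma coset_self:
  assumes "triple_ideal K T N" "x \<in> carrier T"
  shows "x \<in> N +> x"
  unfolding coset_mem using triple_ideal_mem(1)[OF assms(1)] assms(2) by force

lemma coset_eq_iff:
  assumes N: "triple_ideal K T N" and x: "x \<in> carrier T" "y \<in> carrier T"
  shows "N +> x = N +> y \<longleftrightarrow> x \<oplus> \<ominus> y \<in> N"
proof
  assume "N +> x = N +> y"
  then have "x \<in> N +> y" using coset_self[OF N x(1)] by simp
  then obtain n where n: "n \<in> N" "x = n \<oplus> y" unfolding coset_mem by blast
  then have "x \<oplus> \<ominus> y = n" using subsetD[OF triple_ideal_subset[OF N] n(1)] x by (simp add: M.a_assoc M.r_neg)
  then show "x \<oplus> \<ominus> y \<in> N" using n(1) by simp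
next
  assume "x \<oplus> \<ominus> y \<in> N"
  then have "N +> (x \<oplus> \<ominus> y \<oplus> y) = N +> y" using coset_absorb[OF N _ x(2)] by simp
  then show "N +> x = N +> y" using x by (simp add: M.a_assoc M.l_neg)
qed

lemma coset_zero: "triple_ideal K T N \<Longrightarrow> N +> \<zero> = N"
  using triple_ideal_subset[of N] by (auto simp: coset_mem)

lemma coset_zero_iff:
  assumes N: "triple_ideal K T N" and x: "x \<in> carrier T"
  shows "N +> x = N \<longleftrightarrow> x \<in> N"
  using coset_eq_iff[OF N x M.zero_closed] coset_zero[OF N] x by simp

lemma coset_add:
  assumes N: "triple_ideal K T N" and x: "x \<in> carrier T" and y: "y \<in> carrier T"
  shows "(N +> x) <+> (N +> y) = N +> (x \<oplus> y)"
proof -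
  have "abelian_subgroup N T"
    using N by (intro abelian_subgroupI3 additive_subgroupI M.abelian_group_axioms submodule.axioms(1)[of N K T])
      (simp add: triple_ideal_def)
  then show ?thesis using x y by (rule abelian_subgroup.a_rcos_sum)
qed

lemma coset_smult:
  assumes N: "triple_ideal K T N" and x: "x \<in> carrier T" and c: "c \<in> carrier K"
  shows "(\<Union>u\<in>N +> x. N +> (c \<odot> u)) = N +> (c \<odot> x)"
proof -
  have "N +> (c \<odot> u) = N +> (c \<odot> x)" if u: "u \<in> N +> x" for u
  proof -
    obtain n where n: "n \<in> N" "u = n \<oplus> x" using u unfolding coset_mem by blast
    then have "c \<odot> u = c \<odot> n \<oplus> c \<odot> x" using subsetD[OF triple_ideal_subset[OF N] n(1)] x c by (simp add: smult_r_distr)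
    then show ?thesis using coset_absorb[OF N triple_ideal_mem(4)[OF N c n(1)]] x c by simp
  qed
  then show ?thesis using coset_self[OF N x] by blast
qed

text \<open>The operation on cosets is a union over representatives. It is a single coset because
  representatives can be exchanged one argument at a time, the difference being absorbed by the
  ideal.\<close>

lemma coset_triple:
  assumes N: "triple_ideal K T N" and x: "x \<in> carrier T" and y: "y \<in> carrier T" and z: "z \<in> carrier T"
  shows "(\<Union>u\<in>N +> x. \<Union>v\<in>N +> y. \<Union>w\<in>N +> z. N +> \<lblot>u,v,w\<rblot>) = N +> \<lblot>x,y,z\<rblot>"
proof -
  have "N +> \<lblot>u,v,w\<rblot> = N +> \<lblot>x,y,z\<rblot>" if uvw: "u \<in> N +> x" "v \<in> N +> y" "w \<in> N +> z" for u v w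
  proof -
    obtain l m n where lmn: "l \<in> N" "u = l \<oplus> x" "m \<in> N" "v = m \<oplus> y" "n \<in> N" "w = n \<oplus> z"
      using uvw unfolding coset_mem by blast
    note c = subsetD[OF triple_ideal_subset[OF N] lmn(1)] subsetD[OF triple_ideal_subset[OF N] lmn(3)]
      subsetD[OF triple_ideal_subset[OF N] lmn(5)]
    have vw: "v \<in> carrier T" "w \<in> carrier T" using lmn c y z by auto
    have "N +> \<lblot>u,v,w\<rblot> = N +> (\<lblot>l,v,w\<rblot> \<oplus> \<lblot>x,v,w\<rblot>)" using lmn(2) c x vw by (simp add: triple_add)
    also have "\<dots> = N +> \<lblot>x,v,w\<rblot>" using coset_absorb[OF N triple_ideal_triple(1)[OF N lmn(1) vw]] x vw by simp
    also have "\<dots> = N +> (\<lblot>x,m,w\<rblot> \<oplus> \<lblot>x,y,w\<rblot>)" using lmn(4) c x y vw by (simp add: triple_add)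
    also have "\<dots> = N +> \<lblot>x,y,w\<rblot>" using coset_absorb[OF N triple_ideal_triple(2)[OF N lmn(3) x vw(2)]] x y vw by simp
    also have "\<dots> = N +> (\<lblot>x,y,n\<rblot> \<oplus> \<lblot>x,y,z\<rblot>)" using lmn(6) c x y z by (simp add: triple_add)
    also have "\<dots> = N +> \<lblot>x,y,z\<rblot>" using coset_absorb[OF N triple_ideal_triple(3)[OF N lmn(5) x y]] x y z by simp
    finally show ?thesis .
  qed
  then show ?thesis using coset_self[OF N x] coset_self[OF N y] coset_self[OF N z] by blast
qed

end

section \<open>The null part of an ultrafilter\<close>

locale localisation = triple_lie_system K T
  for K :: "('a, 'm) ring_scheme" and T :: "('a, 'b, 'n) triple_system_scheme" (structure) +
  fixes U :: "'a set"
  assumes ultrafilter: "idem_ultrafilter K U"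
begin

abbreviation N where "N \<equiv> null_part K T U"
abbreviation L where "L \<equiv> localised_system K T U"

lemma U_mem:
  shows "e \<in> U \<Longrightarrow> e \<in> carrier K" "e \<in> U \<Longrightarrow> e \<otimes>\<^bsub>K\<^esub> e = e" "\<lbrakk>e \<in> U; d \<in> U\<rbrakk> \<Longrightarrow> e \<otimes>\<^bsub>K\<^esub> d \<in> U" "\<zero>\<^bsub>K\<^esub> \<notin> U"
    "\<one>\<^bsub>K\<^esub> \<in> U" "\<lbrakk>a \<in> idempotents K; a \<notin> U\<rbrakk> \<Longrightarrow> \<one>\<^bsub>K\<^esub> \<ominus>\<^bsub>K\<^esub> a \<in> U"
proof -
  note u = ultrafilter[unfolded idem_ultrafilter_def]
  show "\<lbrakk>a \<in> idempotents K; a \<notin> U\<rbrakk> \<Longrightarrow> \<one>\<^bsub>K\<^esub> \<ominus>\<^bsub>K\<^esub> a \<in> U" for a using u by blast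
  \<comment> \<open>Zero is not in the ultrafilter, so its complement is.\<close>
  from this[of "\<zero>\<^bsub>K\<^esub>"] show "\<one>\<^bsub>K\<^esub> \<in> U" using u by (auto simp: idempotents_def a_minus_def)
qed (use ultrafilter in \<open>auto simp: idem_ultrafilter_def idempotents_def\<close>)

text \<open>If x = a y with a outside U, then 1 - a is in U and kills x. If e in U kills x, then x =
  (1 - e) x, and 1 - e is outside U since its product with e is zero. In this form closure under
  sums is the closure of U under products.\<close>

lemma null_iff: "x \<in> N \<longleftrightarrow> x \<in> carrier T \<and> (\<exists>e\<in>U. e \<odot> x = \<zero>)"
proof
  assume "x \<in> N"
  then obtain a y where a: "a \<in> idempotents K" "a \<notin> U" and y: "y \<in> carrier T" "x = a \<odot> y" "x \<in> carrier T"
    unfolding null_part_def by blast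
  have "(\<one>\<^bsub>K\<^esub> \<ominus>\<^bsub>K\<^esub> a) \<odot> x = \<zero>"
    using R.idempotent_compl[OF a(1)] smult_assoc1[of "\<one>\<^bsub>K\<^esub> \<ominus>\<^bsub>K\<^esub> a" a y] a y by (simp add: idempotents_def)
  then show "x \<in> carrier T \<and> (\<exists>e\<in>U. e \<odot> x = \<zero>)" using U_mem(6)[OF a] y(3) by blast
next
  assume "x \<in> carrier T \<and> (\<exists>e\<in>U. e \<odot> x = \<zero>)"
  then obtain e where x: "x \<in> carrier T" and e: "e \<in> U" "e \<odot> x = \<zero>" by blast
  have ei: "e \<in> idempotents K" "e \<in> carrier K" using U_mem(1,2)[OF e(1)] by (auto simp: idempotents_def)
  have "\<one>\<^bsub>K\<^esub> \<ominus>\<^bsub>K\<^esub> e \<notin> U" using U_mem(3)[OF e(1)] U_mem(4) R.idempotent_compl(3)[OF ei(1)] by metis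
  moreover have "x = (\<one>\<^bsub>K\<^esub> \<ominus>\<^bsub>K\<^esub> e) \<odot> x"
    using x e(2) ei by (simp add: a_minus_def smult_l_distr smult_l_minus)
  ultimately show "x \<in> N" using x R.idempotent_compl(1)[OF ei(1)] unfolding null_part_def by blast
qed

lemma N_ideal: "triple_ideal K T N"
proof (rule triple_idealI)
  show "N \<subseteq> carrier T" using null_iff by blast
  have "\<one>\<^bsub>K\<^esub> \<odot> \<zero> = \<zero>" by simp
  then show "\<zero> \<in> N" using null_iff U_mem(5) M.zero_closed by blast
  fix x assume "x \<in> N"
  then obtain e where x: "x \<in> carrier T" and e: "e \<in> U" "e \<odot> x = \<zero>" using null_iff by blast
  note ec = U_mem(1)[OF e(1)]
  show "x \<oplus> y \<in> N" if yN: "y \<in> N" for y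
  proof -
    obtain d where y: "y \<in> carrier T" and d: "d \<in> U" "d \<odot> y = \<zero>" using yN null_iff by blast
    note dc = U_mem(1)[OF d(1)]
    have "(e \<otimes>\<^bsub>K\<^esub> d) \<odot> x = (d \<otimes>\<^bsub>K\<^esub> e) \<odot> x" using R.m_comm[OF ec dc] by simp
    then have "(e \<otimes>\<^bsub>K\<^esub> d) \<odot> (x \<oplus> y) = \<zero>"
      using smult_assoc1[OF dc ec x] smult_assoc1[OF ec dc y] e d ec dc x y by (simp add: smult_r_distr)
    then show ?thesis using null_iff U_mem(3)[OF e(1) d(1)] x y by auto
  qed
  show "c \<odot> x \<in> N" if "c \<in> carrier K" for c
    using smult_assoc1[OF ec that x] smult_assoc1[OF that ec x] R.m_comm[OF ec that] e x that null_iff by auto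
  show "\<lblot>x,y,z\<rblot> \<in> N" if "y \<in> carrier T" "z \<in> carrier T" for y z
    using triple_smult(1)[OF ec x that] e x that null_iff by auto
qed

lemma L_simps:
  "carrier L = (\<lambda>x. N +> x) ` carrier T" "\<zero>\<^bsub>L\<^esub> = N"
  "\<lbrakk>x \<in> carrier T; y \<in> carrier T\<rbrakk> \<Longrightarrow> (N +> x) \<oplus>\<^bsub>L\<^esub> (N +> y) = N +> (x \<oplus> y)"
  "\<lbrakk>c \<in> carrier K; x \<in> carrier T\<rbrakk> \<Longrightarrow> c \<odot>\<^bsub>L\<^esub> (N +> x) = N +> (c \<odot> x)"
  "\<lbrakk>x \<in> carrier T; y \<in> carrier T; z \<in> carrier T\<rbrakk> \<Longrightarrow> \<lblot>N +> x,N +> y,N +> z\<rblot>\<^bsub>L\<^esub> = N +> \<lblot>x,y,z\<rblot>"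
  using coset_add[OF N_ideal] coset_smult[OF N_ideal] coset_triple[OF N_ideal]
  by (auto simp: localised_system_def Let_def A_RCOSETS_def')

lemma L_triple_lie_system: "triple_lie_system K L"
  by (rule triple_lie_image[OF triple_lie_system_axioms, of L "\<lambda>x. N +> x"])
    (simp_all add: L_simps coset_zero[OF N_ideal])

end

section \<open>Nonsingularity at an ultrafilter\<close>

context closed_quotient
begin

text \<open>On each piece e one has e [q,a,y] = [q, e a, e y], where e a comes from \<open>I\<close>
  and e y from \<open>T\<close>; so the denominator property passes to orthogonal closures.\<close>

lemma orth_closure_quotient:
  assumes q: "q \<in> carrier Q" and I: "denom q I" and a: "a \<in> orth_closure (i ` I)" and y: "y \<in> orth_closure (i ` carrier T)"
  shows "\<lblot>q,a,y\<rblot>\<^bsub>Q\<^esub> \<in> orth_closure (i ` carrier T)" "\<lblot>q,y,a\<rblot>\<^bsub>Q\<^esub> \<in> orth_closure (i ` carrier T)"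
proof -
  obtain D where D: "dense_orthogonal K D" "\<And>e. e \<in> D \<Longrightarrow> e \<odot>\<^bsub>Q\<^esub> a \<in> i ` I \<and> e \<odot>\<^bsub>Q\<^esub> y \<in> i ` carrier T"
    using orth_closure_common[OF denomD(1)[OF I] a triple_ideal_carrier y] by blast
  have c: "a \<in> carrier Q" "y \<in> carrier Q" using a y by (auto simp: orth_closure_def)
  have *: "e \<odot>\<^bsub>Q\<^esub> \<lblot>q,a,y\<rblot>\<^bsub>Q\<^esub> \<in> i ` carrier T \<and> e \<odot>\<^bsub>Q\<^esub> \<lblot>q,y,a\<rblot>\<^bsub>Q\<^esub> \<in> i ` carrier T" if e: "e \<in> D" for e
  proof -
    note eK = R.dense_orthogonalD(2,3)[OF D(1) e]
    obtain b z where bz: "b \<in> I" "z \<in> carrier T" "e \<odot>\<^bsub>Q\<^esub> a = i b" "e \<odot>\<^bsub>Q\<^esub> y = i z" using D(2)[OF e] by blast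
    show ?thesis using idem_triple(2)[OF eK q c] idem_triple(2)[OF eK q c(2,1)] bz denomD(3,4)[OF I bz(1,2)] by simp
  qed
  show "\<lblot>q,a,y\<rblot>\<^bsub>Q\<^esub> \<in> orth_closure (i ` carrier T)" "\<lblot>q,y,a\<rblot>\<^bsub>Q\<^esub> \<in> orth_closure (i ` carrier T)"
    using * q c by (auto intro!: orth_closureI[OF _ D(1)])
qed

text \<open>Each product has its own witness in U, which says nothing about \<open>q\<close> as a
  whole. A pair a, y is therefore glued whose products [q,a,y] and [q,y,a] together see all of
  \<open>q\<close>; the witnesses of these two products already kill \<open>q\<close>.\<close>

lemma localised_nonsingular:
  assumes max: "maximal_quotient_system K T Q i" and U: "idem_ultrafilter K U"
    and q: "q \<in> carrier Q" and I: "triple_ideal K T I" "triple_ann T I = {\<zero>}"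
    and null: "\<And>a y. \<lbrakk>a \<in> orth_closure (i ` I); y \<in> orth_closure (i ` carrier T)\<rbrakk> \<Longrightarrow>
      \<lblot>q,a,y\<rblot>\<^bsub>Q\<^esub> \<in> null_part K Q U \<and> \<lblot>q,y,a\<rblot>\<^bsub>Q\<^esub> \<in> null_part K Q U"
  shows "q \<in> null_part K Q U"
proof -
  interpret QU: localisation K Q U by (intro localisation.intro localisation_axioms.intro Q.triple_lie_system_axioms U)
  note Ic = subsetD[OF triple_ideal_subset[OF I(1)]]
  have iI: "i ` I \<subseteq> carrier Q" "i ` carrier T \<subseteq> carrier Q" using Ic by auto
  \<comment> \<open>The support of r contains b, so a scalar killing a product that detects b also
    kills b q. Information about one product is carried to \<open>q\<close> in this way.\<close>
  define detects where "detects b r \<longleftrightarrow> (\<forall>c\<in>carrier K. c \<odot>\<^bsub>Q\<^esub> (b \<odot>\<^bsub>Q\<^esub> r) = \<zero>\<^bsub>Q\<^esub> \<longrightarrow> c \<otimes>\<^bsub>K\<^esub> b = \<zero>\<^bsub>K\<^esub>)" for b r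
  define Pr where "Pr b \<longleftrightarrow> b \<odot>\<^bsub>Q\<^esub> q = \<zero>\<^bsub>Q\<^esub> \<or>
    (\<exists>a\<in>i ` I. \<exists>y\<in>i ` carrier T. detects b \<lblot>q,a,y\<rblot>\<^bsub>Q\<^esub> \<or> detects b \<lblot>q,y,a\<rblot>\<^bsub>Q\<^esub>)" for b
  \<comment> \<open>The witness is c s with s the support of r; it is nonzero because c s r = c
    r.\<close>
  have refine: "\<exists>b\<in>idempotents K. b \<noteq> \<zero>\<^bsub>K\<^esub> \<and> b \<otimes>\<^bsub>K\<^esub> c = b \<and> detects b r"
    if c: "c \<in> idempotents K" and r: "r \<in> carrier Q" "c \<odot>\<^bsub>Q\<^esub> r \<noteq> \<zero>\<^bsub>Q\<^esub>" for c r
  proof -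
    have cK: "c \<in> carrier K" "c \<otimes>\<^bsub>K\<^esub> c = c" using c by (auto simp: idempotents_def)
    obtain s where s: "s \<in> idempotents K" "s \<odot>\<^bsub>Q\<^esub> r = r"
      "\<forall>b\<in>carrier K. b \<odot>\<^bsub>Q\<^esub> r = \<zero>\<^bsub>Q\<^esub> \<longrightarrow> b \<otimes>\<^bsub>K\<^esub> s = \<zero>\<^bsub>K\<^esub>"
      by (rule support[OF r(1)]) (rule that)
    have sK: "s \<in> carrier K" "s \<otimes>\<^bsub>K\<^esub> s = s" using s(1) by (auto simp: idempotents_def)
    have "c \<otimes>\<^bsub>K\<^esub> s \<noteq> \<zero>\<^bsub>K\<^esub>" using Q.smult_assoc1[OF cK(1) sK(1) r(1)] s(2) r by auto
    moreover have "c \<otimes>\<^bsub>K\<^esub> s \<otimes>\<^bsub>K\<^esub> c = c \<otimes>\<^bsub>K\<^esub> s"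
      using cK sK R.m_assoc[of c c s] R.m_assoc[of c s c] R.m_comm[of s c] by simp
    moreover have "detects (c \<otimes>\<^bsub>K\<^esub> s) r"
      unfolding detects_def
    proof (intro ballI impI)
      fix d assume d: "d \<in> carrier K" and z: "d \<odot>\<^bsub>Q\<^esub> (c \<otimes>\<^bsub>K\<^esub> s \<odot>\<^bsub>Q\<^esub> r) = \<zero>\<^bsub>Q\<^esub>"
      have "(d \<otimes>\<^bsub>K\<^esub> (c \<otimes>\<^bsub>K\<^esub> s)) \<otimes>\<^bsub>K\<^esub> s = \<zero>\<^bsub>K\<^esub>"
        using s(3) z Q.smult_assoc1[of d "c \<otimes>\<^bsub>K\<^esub> s" r] d cK sK r(1) by simp
      then show "d \<otimes>\<^bsub>K\<^esub> (c \<otimes>\<^bsub>K\<^esub> s) = \<zero>\<^bsub>K\<^esub>" using d cK sK by (simp add: R.m_assoc)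
    qed
    ultimately show ?thesis using R.idempotents_closed[OF c s(1)] by blast
  qed
  \<comment> \<open>Either c kills \<open>q\<close> and serves itself, or nonsingularity of
    \<open>Q\<close> provides a product of \<open>q\<close> not killed by c, which is then
    refined.\<close>
  have ex: "\<exists>b\<in>idempotents K. b \<noteq> \<zero>\<^bsub>K\<^esub> \<and> b \<otimes>\<^bsub>K\<^esub> c = b \<and> Pr b"
    if c: "c \<in> idempotents K" "c \<noteq> \<zero>\<^bsub>K\<^esub>" for c
  proof (cases "c \<odot>\<^bsub>Q\<^esub> q = \<zero>\<^bsub>Q\<^esub>")
    case True
    then show ?thesis using c by (auto simp: Pr_def idempotents_def)
  next
    case False
    have cK: "c \<in> carrier K" using c by (auto simp: idempotents_def)
    then obtain a y where ay: "a \<in> I" "y \<in> carrier T"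
      "\<lblot>c \<odot>\<^bsub>Q\<^esub> q,i a,i y\<rblot>\<^bsub>Q\<^esub> \<noteq> \<zero>\<^bsub>Q\<^esub> \<or> \<lblot>c \<odot>\<^bsub>Q\<^esub> q,i y,i a\<rblot>\<^bsub>Q\<^esub> \<noteq> \<zero>\<^bsub>Q\<^esub>"
      using quotient_nonsingular[OF I, of "c \<odot>\<^bsub>Q\<^esub> q"] q False unfolding kills_def by auto
    then have "c \<odot>\<^bsub>Q\<^esub> \<lblot>q,i a,i y\<rblot>\<^bsub>Q\<^esub> \<noteq> \<zero>\<^bsub>Q\<^esub> \<or> c \<odot>\<^bsub>Q\<^esub> \<lblot>q,i y,i a\<rblot>\<^bsub>Q\<^esub> \<noteq> \<zero>\<^bsub>Q\<^esub>"
      using cK q Ic by (simp add: Q.triple_smult)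
    moreover have "\<lblot>q,i a,i y\<rblot>\<^bsub>Q\<^esub> \<in> carrier Q" "\<lblot>q,i y,i a\<rblot>\<^bsub>Q\<^esub> \<in> carrier Q" using ay q Ic by auto
    ultimately have "\<exists>b\<in>idempotents K. b \<noteq> \<zero>\<^bsub>K\<^esub> \<and> b \<otimes>\<^bsub>K\<^esub> c = b \<and> (detects b \<lblot>q,i a,i y\<rblot>\<^bsub>Q\<^esub> \<or> detects b \<lblot>q,i y,i a\<rblot>\<^bsub>Q\<^esub>)"
      using refine[OF c(1)] by meson
    moreover have "Pr b" if "detects b \<lblot>q,i a,i y\<rblot>\<^bsub>Q\<^esub> \<or> detects b \<lblot>q,i y,i a\<rblot>\<^bsub>Q\<^esub>" for b
      unfolding Pr_def using that ay(1,2) by blast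
    ultimately show ?thesis by blast
  qed
  obtain D where D: "dense_orthogonal K D" "\<And>b. b \<in> D \<Longrightarrow> Pr b"
    using R.exists_dense_orthogonal[of Pr] ex by blast
  note D' = R.dense_orthogonalD[OF D(1)]
  \<comment> \<open>On the pieces that kill \<open>q\<close> the chosen pair is irrelevant, and a
    pair of zeros is the default.\<close>
  have z: "i \<zero> \<in> i ` I" "i \<zero> \<in> i ` carrier T"
    by (rule imageI, rule triple_ideal_mem(1)[OF I(1)]) (rule imageI, rule M.zero_closed)
  have "\<forall>b\<in>D. \<exists>p. fst p \<in> i ` I \<and> snd p \<in> i ` carrier T \<and>
      (b \<odot>\<^bsub>Q\<^esub> q = \<zero>\<^bsub>Q\<^esub> \<or> detects b \<lblot>q,fst p,snd p\<rblot>\<^bsub>Q\<^esub> \<or> detects b \<lblot>q,snd p,fst p\<rblot>\<^bsub>Q\<^esub>)"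
  proof
    fix b assume "b \<in> D"
    then consider "b \<odot>\<^bsub>Q\<^esub> q = \<zero>\<^bsub>Q\<^esub>" | a y where "a \<in> i ` I" "y \<in> i ` carrier T"
      "detects b \<lblot>q,a,y\<rblot>\<^bsub>Q\<^esub> \<or> detects b \<lblot>q,y,a\<rblot>\<^bsub>Q\<^esub>"
      using D(2) unfolding Pr_def by blast
    then show "\<exists>p. fst p \<in> i ` I \<and> snd p \<in> i ` carrier T \<and>
      (b \<odot>\<^bsub>Q\<^esub> q = \<zero>\<^bsub>Q\<^esub> \<or> detects b \<lblot>q,fst p,snd p\<rblot>\<^bsub>Q\<^esub> \<or> detects b \<lblot>q,snd p,fst p\<rblot>\<^bsub>Q\<^esub>)"
    proof cases
      case 1
      then show ?thesis using z by (intro exI[of _ "(i \<zero>, i \<zero>)"]) (simp only: fst_conv snd_conv simp_thms)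
    next
      case (2 a y)
      then show ?thesis by (intro exI[of _ "(a, y)"]) (simp only: fst_conv snd_conv simp_thms)
    qed
  qed
  from bchoice[OF this] obtain p where p: "\<forall>b\<in>D. fst (p b) \<in> i ` I \<and> snd (p b) \<in> i ` carrier T \<and>
      (b \<odot>\<^bsub>Q\<^esub> q = \<zero>\<^bsub>Q\<^esub> \<or> detects b \<lblot>q,fst (p b),snd (p b)\<rblot>\<^bsub>Q\<^esub> \<or> detects b \<lblot>q,snd (p b),fst (p b)\<rblot>\<^bsub>Q\<^esub>)" by blast
  obtain a where a: "a \<in> orth_closure (i ` I)" "\<forall>b\<in>D. b \<odot>\<^bsub>Q\<^esub> a = b \<odot>\<^bsub>Q\<^esub> fst (p b)"
    using orth_closure_complete[OF max I(1) D(1), of "\<lambda>b. fst (p b)"] p orth_closure_subset[OF iI(1)] by blast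
  obtain y where y: "y \<in> orth_closure (i ` carrier T)" "\<forall>b\<in>D. b \<odot>\<^bsub>Q\<^esub> y = b \<odot>\<^bsub>Q\<^esub> snd (p b)"
    using orth_closure_complete[OF max triple_ideal_carrier D(1), of "\<lambda>b. snd (p b)"] p orth_closure_subset[OF iI(2)] by blast
  have ayQ: "a \<in> carrier Q" "y \<in> carrier Q" using a(1) y(1) by (auto simp: orth_closure_def)
  \<comment> \<open>Just two products remain, so their witnesses can be multiplied to a single
    member of \<open>U\<close>.\<close>
  obtain e where e: "e \<in> U" "e \<odot>\<^bsub>Q\<^esub> \<lblot>q,a,y\<rblot>\<^bsub>Q\<^esub> = \<zero>\<^bsub>Q\<^esub>"
    using null[OF a(1) y(1)] QU.null_iff by blast
  obtain d where d: "d \<in> U" "d \<odot>\<^bsub>Q\<^esub> \<lblot>q,y,a\<rblot>\<^bsub>Q\<^esub> = \<zero>\<^bsub>Q\<^esub>"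
    using null[OF a(1) y(1)] QU.null_iff by blast
  note eK = QU.U_mem(1)[OF e(1)] and dK = QU.U_mem(1)[OF d(1)]
  have edK: "e \<otimes>\<^bsub>K\<^esub> d \<in> carrier K" using eK dK by simp
  have ed: "(e \<otimes>\<^bsub>K\<^esub> d) \<odot>\<^bsub>Q\<^esub> \<lblot>q,a,y\<rblot>\<^bsub>Q\<^esub> = \<zero>\<^bsub>Q\<^esub>" "(e \<otimes>\<^bsub>K\<^esub> d) \<odot>\<^bsub>Q\<^esub> \<lblot>q,y,a\<rblot>\<^bsub>Q\<^esub> = \<zero>\<^bsub>Q\<^esub>"
    using e d eK dK q ayQ smult_swap[OF eK dK, of "\<lblot>q,a,y\<rblot>\<^bsub>Q\<^esub>"] by (simp_all add: Q.smult_assoc1)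
  \<comment> \<open>This is checked on the pieces b: there the glued pair agrees with the chosen
    one, so either b q = 0 or e d is orthogonal to b.\<close>
  have "(e \<otimes>\<^bsub>K\<^esub> d) \<odot>\<^bsub>Q\<^esub> q = \<zero>\<^bsub>Q\<^esub>"
  proof (rule dense_zero[OF D(1)])
    fix b assume b: "b \<in> D"
    note bK = D'(2,3)[OF b]
    have pQ: "fst (p b) \<in> carrier Q" "snd (p b) \<in> carrier Q" using p b iI by blast+
    have "b \<odot>\<^bsub>Q\<^esub> \<lblot>q,a,y\<rblot>\<^bsub>Q\<^esub> = b \<odot>\<^bsub>Q\<^esub> \<lblot>q,fst (p b),snd (p b)\<rblot>\<^bsub>Q\<^esub>"
      "b \<odot>\<^bsub>Q\<^esub> \<lblot>q,y,a\<rblot>\<^bsub>Q\<^esub> = b \<odot>\<^bsub>Q\<^esub> \<lblot>q,snd (p b),fst (p b)\<rblot>\<^bsub>Q\<^esub>"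
      using a(2) y(2) b by (simp_all add: idem_triple(2)[OF bK q] ayQ pQ)
    moreover have "(e \<otimes>\<^bsub>K\<^esub> d) \<odot>\<^bsub>Q\<^esub> (b \<odot>\<^bsub>Q\<^esub> \<lblot>q,a,y\<rblot>\<^bsub>Q\<^esub>) = \<zero>\<^bsub>Q\<^esub>" "(e \<otimes>\<^bsub>K\<^esub> d) \<odot>\<^bsub>Q\<^esub> (b \<odot>\<^bsub>Q\<^esub> \<lblot>q,y,a\<rblot>\<^bsub>Q\<^esub>) = \<zero>\<^bsub>Q\<^esub>"
      using ed smult_swap[OF edK bK(1)] bK(1) q ayQ by simp_all
    ultimately have "b \<odot>\<^bsub>Q\<^esub> q = \<zero>\<^bsub>Q\<^esub> \<or> (e \<otimes>\<^bsub>K\<^esub> d) \<otimes>\<^bsub>K\<^esub> b = \<zero>\<^bsub>K\<^esub>"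
      using p b edK unfolding detects_def by auto
    then have "(e \<otimes>\<^bsub>K\<^esub> d) \<odot>\<^bsub>Q\<^esub> (b \<odot>\<^bsub>Q\<^esub> q) = \<zero>\<^bsub>Q\<^esub>"
      using Q.smult_assoc1[OF edK bK(1) q] edK q by auto
    then show "b \<odot>\<^bsub>Q\<^esub> ((e \<otimes>\<^bsub>K\<^esub> d) \<odot>\<^bsub>Q\<^esub> q) = \<zero>\<^bsub>Q\<^esub>" using smult_swap[OF bK(1) edK q] by simp
  qed (use edK q in simp)
  then show ?thesis using QU.null_iff QU.U_mem(3)[OF e(1) d(1)] q by blast
qed

end

section \<open>The system of quotients at an ultrafilter\<close>

context maximal_quotient_in_hull
begin

text \<open>A denominator ideal of a representative q is replaced by its orthogonal closure, whose
  cosets form the denominator ideal of the coset of q. Its annihilator is zero and it detects the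
  coset, both by \<open>localised_nonsingular\<close>, applied to elements of the completion and to
  q respectively.\<close>

lemma localised_quotient_system:
  assumes U: "idem_ultrafilter K U"
  shows "quotient_system K (localised_system K Osys U) (localised_system K Q U) (localised_inclusion K Q U)"
proof -
  have Olie: "triple_lie_system K Osys" using Osys_subsystem by (simp add: triple_embedding_def)
  interpret QU: localisation K Q U by (intro localisation.intro localisation_axioms.intro Q.triple_lie_system_axioms U)
  interpret OU: localisation K Osys U by (intro localisation.intro localisation_axioms.intro Olie U)
  let ?\<iota> = "localised_inclusion K Q U"
  let ?q = "\<lambda>x. QU.N +>\<^bsub>Q\<^esub> x" and ?o = "\<lambda>x. OU.N +>\<^bsub>Osys\<^esub> x"
  \<comment> \<open>Both null parts consist of elements killed by a member of \<open>U\<close>, and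
    scalars act alike on the completion and on \<open>Q\<close>. The inclusion of cosets is
    injective for this reason.\<close>
  have N: "x \<in> OU.N \<longleftrightarrow> x \<in> QU.N" if "x \<in> OQ" for x
    using that OQ_subset QU.U_mem(1) by (auto simp: OU.null_iff QU.null_iff Osys_simps)
  have NO: "x \<in> OQ" if "x \<in> OU.N" for x using that by (simp add: OU.null_iff Osys_simps)
  have NQ: "x \<in> carrier Q" if "x \<in> QU.N" for x using that by (simp add: QU.null_iff)
  have incl: "?\<iota> (?o x) = ?q x" if x: "x \<in> OQ" for x
  proof (intro Set.set_eqI iffI)
    note xQ = OQ_subset[OF x]
    fix u
    show "u \<in> ?q x" if u: "u \<in> ?\<iota> (?o x)"
    proof -
      obtain n m where nm: "n \<in> OU.N" "m \<in> QU.N" "u = (n \<oplus>\<^bsub>Osys\<^esub> x) \<oplus>\<^bsub>Q\<^esub> m"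
        using u by (auto simp: localised_inclusion_def set_add_def' OU.coset_mem)
      have n: "n \<in> QU.N" using N NO nm(1) by blast
      have "u = (n \<oplus>\<^bsub>Q\<^esub> m) \<oplus>\<^bsub>Q\<^esub> x"
        using nm NO[OF nm(1)] x NQ[OF n] NQ[OF nm(2)] xQ by (simp add: Osys_simps Q.M.a_ac)
      then show ?thesis using Q.triple_ideal_mem(2)[OF QU.N_ideal n nm(2)] unfolding Q.coset_mem by blast
    qed
    show "u \<in> ?\<iota> (?o x)" if u: "u \<in> ?q x"
    proof -
      obtain m where m: "m \<in> QU.N" "u = m \<oplus>\<^bsub>Q\<^esub> x" using u unfolding Q.coset_mem by blast
      have "u = x \<oplus>\<^bsub>Q\<^esub> m" using m NQ[OF m(1)] xQ by (simp add: Q.M.a_comm)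
      moreover have "x \<in> ?o x" using OU.coset_self[OF OU.N_ideal, of x] x by (simp add: Osys_simps)
      ultimately show ?thesis using m(1) unfolding localised_inclusion_def set_add_def' by blast
    qed
  qed
  have LO: "carrier OU.L = ?o ` OQ" using OU.L_simps(1) by (simp add: Osys_simps)
  have inj: "?o x = ?o y" if "x \<in> OQ" "y \<in> OQ" "?q x = ?q y" for x y
  proof -
    have m: "\<ominus>\<^bsub>Osys\<^esub> y \<in> OQ" "\<ominus>\<^bsub>Osys\<^esub> y = \<ominus>\<^bsub>Q\<^esub> y"
    proof -
      show *: "\<ominus>\<^bsub>Osys\<^esub> y \<in> OQ" using OU.M.a_inv_closed[of y] that by (simp add: Osys_simps)
      have "\<ominus>\<^bsub>Osys\<^esub> y \<oplus>\<^bsub>Q\<^esub> y = \<zero>\<^bsub>Q\<^esub>"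
        using OU.M.l_neg[of y] Osys_simps(3)[OF * that(2)] that by (simp add: Osys_simps)
      then show "\<ominus>\<^bsub>Osys\<^esub> y = \<ominus>\<^bsub>Q\<^esub> y" using Q.M.minus_equality OQ_subset[OF *] OQ_subset[OF that(2)] by auto
    qed
    have "x \<oplus>\<^bsub>Q\<^esub> \<ominus>\<^bsub>Q\<^esub> y \<in> QU.N" using Q.coset_eq_iff[OF QU.N_ideal] OQ_subset that by blast
    moreover have "x \<oplus>\<^bsub>Osys\<^esub> \<ominus>\<^bsub>Osys\<^esub> y = x \<oplus>\<^bsub>Q\<^esub> \<ominus>\<^bsub>Q\<^esub> y" using Osys_simps(3)[OF that(1) m(1)] m(2) by simp
    moreover have "x \<oplus>\<^bsub>Osys\<^esub> \<ominus>\<^bsub>Osys\<^esub> y \<in> OQ" using OU.M.a_closed[of x "\<ominus>\<^bsub>Osys\<^esub> y"] that m(1) by (simp add: Osys_simps)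
    ultimately have "x \<oplus>\<^bsub>Osys\<^esub> \<ominus>\<^bsub>Osys\<^esub> y \<in> OU.N" using N by simp
    then show ?thesis using OU.coset_eq_iff[OF OU.N_ideal, of x y] that by (simp add: Osys_simps)
  qed
  have Oops: "?o x \<oplus>\<^bsub>OU.L\<^esub> ?o y = ?o (x \<oplus>\<^bsub>Q\<^esub> y)" "c \<in> carrier K \<Longrightarrow> c \<odot>\<^bsub>OU.L\<^esub> ?o x = ?o (c \<odot>\<^bsub>Q\<^esub> x)"
    "z \<in> OQ \<Longrightarrow> \<lblot>?o x,?o y,?o z\<rblot>\<^bsub>OU.L\<^esub> = ?o \<lblot>x,y,z\<rblot>\<^bsub>Q\<^esub>"
    if "x \<in> OQ" "y \<in> OQ" for x y z c
    using that OU.L_simps(3)[of x y] OU.L_simps(4)[of c x] OU.L_simps(5)[of x y z] by (simp_all add: Osys_simps)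
  have Qops: "?q x \<oplus>\<^bsub>QU.L\<^esub> ?q y = ?q (x \<oplus>\<^bsub>Q\<^esub> y)" "c \<in> carrier K \<Longrightarrow> c \<odot>\<^bsub>QU.L\<^esub> ?q x = ?q (c \<odot>\<^bsub>Q\<^esub> x)"
    "z \<in> carrier Q \<Longrightarrow> \<lblot>?q x,?q y,?q z\<rblot>\<^bsub>QU.L\<^esub> = ?q \<lblot>x,y,z\<rblot>\<^bsub>Q\<^esub>"
    if "x \<in> carrier Q" "y \<in> carrier Q" for x y z c
    using that by (simp_all add: QU.L_simps)
  note Ocl = orth_closure_add[OF triple_ideal_carrier] orth_closure_smult[OF triple_ideal_carrier]
    orth_closure_triple[OF triple_ideal_carrier]
  have "triple_embedding K OU.L QU.L ?\<iota>"
    unfolding triple_embedding_def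
  proof (intro conjI OU.L_triple_lie_system QU.L_triple_lie_system ballI)
    show "?\<iota> \<in> carrier OU.L \<rightarrow> carrier QU.L"
    proof
      fix A assume "A \<in> carrier OU.L"
      then obtain x where x: "x \<in> OQ" "A = ?o x" unfolding LO by blast
      then show "?\<iota> A \<in> carrier QU.L" using imageI[OF OQ_subset[OF x(1)], of ?q] by (simp add: incl QU.L_simps(1))
    qed
    show "inj_on ?\<iota> (carrier OU.L)"
    proof (rule inj_onI)
      fix A B assume "A \<in> carrier OU.L" "B \<in> carrier OU.L" and eq: "?\<iota> A = ?\<iota> B"
      then obtain x y where xy: "x \<in> OQ" "A = ?o x" "y \<in> OQ" "B = ?o y" unfolding LO by blast
      then have "?q x = ?q y" using eq by (simp add: incl)
      then show "A = B" using inj[OF xy(1,3)] xy(2,4) by simp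
    qed
    fix A assume "A \<in> carrier OU.L"
    then obtain x where x: "x \<in> OQ" "A = ?o x" using LO by auto
    show "?\<iota> (c \<odot>\<^bsub>OU.L\<^esub> A) = c \<odot>\<^bsub>QU.L\<^esub> ?\<iota> A" if "c \<in> carrier K" for c
      using x that Oops(2)[OF x(1) x(1) that] Qops(2)[OF OQ_subset OQ_subset that, OF x(1) x(1)]
        incl[OF Ocl(2)[OF x(1) that]] by (simp add: incl)
    fix B assume "B \<in> carrier OU.L"
    then obtain y where y: "y \<in> OQ" "B = ?o y" using LO by auto
    show "?\<iota> (A \<oplus>\<^bsub>OU.L\<^esub> B) = ?\<iota> A \<oplus>\<^bsub>QU.L\<^esub> ?\<iota> B"
      using x y OQ_subset Ocl by (simp add: Oops incl Qops)
    fix C assume "C \<in> carrier OU.L"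
    then obtain z where z: "z \<in> OQ" "C = ?o z" using LO by auto
    show "?\<iota> \<lblot>A,B,C\<rblot>\<^bsub>OU.L\<^esub> = \<lblot>?\<iota> A,?\<iota> B,?\<iota> C\<rblot>\<^bsub>QU.L\<^esub>"
      using x y z OQ_subset Ocl by (simp add: Oops incl Qops)
  qed
  then interpret L: embedded_system K OU.L QU.L ?\<iota> by (rule embedded_systemI)
  show ?thesis
    unfolding L.quotient_system_iff
  proof (intro ballI impI)
    fix A assume "A \<in> carrier QU.L" and A0: "A \<noteq> \<zero>\<^bsub>QU.L\<^esub>"
    then obtain q where q: "q \<in> carrier Q" "A = ?q q" by (auto simp: QU.L_simps(1))
    have qN: "q \<notin> QU.N" using A0 q Q.coset_zero_iff[OF QU.N_ideal q(1)] by (simp add: QU.L_simps(2))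
    obtain I where dI: "denom q I" by (rule quotient_ideal_any[OF q(1)])
    note I = denomD(1,2)[OF dI]
    define J where "J = orth_closure (k ` I)"
    have JO: "a \<in> OQ" if "a \<in> J" for a
      using that triple_ideal_subset[OF I(1)] unfolding J_def orth_closure_def by blast
    have J0: "\<zero>\<^bsub>Q\<^esub> \<in> J" unfolding J_def by (rule orth_closure_zero[OF I(1)])
    have Iid: "triple_ideal K OU.L (?o ` J)"
    proof (rule L.T.triple_idealI)
      show "?o ` J \<subseteq> carrier OU.L" using JO LO by blast
      show "\<zero>\<^bsub>OU.L\<^esub> \<in> ?o ` J"
        using imageI[OF J0, of ?o] OU.coset_zero[OF OU.N_ideal] by (simp add: Osys_simps(2) OU.L_simps(2))
      fix X assume "X \<in> ?o ` J"
      then obtain x where x: "x \<in> J" "X = ?o x" by blast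
      show "X \<oplus>\<^bsub>OU.L\<^esub> Y \<in> ?o ` J" if Y: "Y \<in> ?o ` J" for Y
      proof -
        obtain y where y: "y \<in> J" "Y = ?o y" using Y by blast
        show ?thesis using x y JO Oops(1) orth_closure_add[OF I(1), of x y] by (simp add: J_def)
      qed
      show "c \<odot>\<^bsub>OU.L\<^esub> X \<in> ?o ` J" if "c \<in> carrier K" for c
        using x JO[OF x(1)] Oops(2)[of x x c] orth_closure_smult[OF I(1), of x c] that by (simp add: J_def)
      show "\<lblot>X,Y,Z\<rblot>\<^bsub>OU.L\<^esub> \<in> ?o ` J" if YZ: "Y \<in> carrier OU.L" "Z \<in> carrier OU.L" for Y Z
      proof -
        obtain y z where "y \<in> OQ" "Y = ?o y" "z \<in> OQ" "Z = ?o z" using YZ LO by auto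
        then show ?thesis using x JO[OF x(1)] Oops(3)[of x y z] orth_closure_triple[OF I(1), of x y z] by (simp add: J_def)
      qed
    qed
    \<comment> \<open>For r = q this is the denominator property of \<open>I\<close> passed to
      closures; for r in the completion it is closure under the composition. The two cases serve the
      detection of q and the annihilator.\<close>
    have prod: "\<lblot>r,a,y\<rblot>\<^bsub>Q\<^esub> \<in> OQ" "\<lblot>r,y,a\<rblot>\<^bsub>Q\<^esub> \<in> OQ"
      if "r \<in> carrier Q" "r = q \<or> r \<in> OQ" "a \<in> J" "y \<in> OQ" for r a y
      using that orth_closure_quotient[OF q(1) dI, of a y] Ocl(3)[of r a y] Ocl(3)[of r y a] JO[of a]
      unfolding J_def by blast+
    have ann: "triple_ann OU.L (?o ` J) = {\<zero>\<^bsub>OU.L\<^esub>}"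
    proof -
      have "X = \<zero>\<^bsub>OU.L\<^esub>" if X: "X \<in> triple_ann OU.L (?o ` J)" for X
      proof -
        obtain x where x: "x \<in> OQ" "X = ?o x" using X LO by (auto simp: triple_ann_def)
        note xQ = OQ_subset[OF x(1)]
        have "x \<in> QU.N"
        proof (rule localised_nonsingular[OF maximal U xQ I])
          fix a y assume a: "a \<in> orth_closure (k ` I)" and y: "y \<in> OQ"
          then have aJ: "a \<in> J" by (simp add: J_def)
          have "?o y \<in> carrier OU.L" "?o a \<in> ?o ` J" using LO y aJ by blast+
          then have "\<lblot>X,?o a,?o y\<rblot>\<^bsub>OU.L\<^esub> = OU.N" "\<lblot>X,?o y,?o a\<rblot>\<^bsub>OU.L\<^esub> = OU.N"
            using X unfolding triple_ann_def OU.L_simps(2) by blast+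
          then have "?o \<lblot>x,a,y\<rblot>\<^bsub>Q\<^esub> = OU.N" "?o \<lblot>x,y,a\<rblot>\<^bsub>Q\<^esub> = OU.N"
            using x Oops(3)[OF x(1) JO[OF aJ] y] Oops(3)[OF x(1) y JO[OF aJ]] by simp_all
          moreover have pr: "\<lblot>x,a,y\<rblot>\<^bsub>Q\<^esub> \<in> OQ" "\<lblot>x,y,a\<rblot>\<^bsub>Q\<^esub> \<in> OQ" using prod[OF xQ _ aJ y] x(1) by blast+
          ultimately show "\<lblot>x,a,y\<rblot>\<^bsub>Q\<^esub> \<in> QU.N \<and> \<lblot>x,y,a\<rblot>\<^bsub>Q\<^esub> \<in> QU.N"
            using OU.coset_zero_iff[OF OU.N_ideal] N[OF pr(1)] N[OF pr(2)] by (simp add: Osys_simps(1))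
        qed
        then have "x \<in> OU.N" using N x(1) by simp
        then show ?thesis using x OU.coset_zero_iff[OF OU.N_ideal, of x] by (simp add: Osys_simps(1) OU.L_simps(2))
      qed
      moreover have "\<zero>\<^bsub>OU.L\<^esub> \<in> triple_ann OU.L (?o ` J)"
        using L.T.triple_ideal_mem(1)[OF L.T.triple_ideal_ann[OF Iid]] .
      ultimately show ?thesis by blast
    qed
    have val: "\<lblot>A,?\<iota> (?o x),?\<iota> (?o y)\<rblot>\<^bsub>QU.L\<^esub> = ?q \<lblot>q,x,y\<rblot>\<^bsub>Q\<^esub>" if "x \<in> OQ" "y \<in> OQ" for x y
      using that q OQ_subset by (simp add: incl Qops)
    have "L.denom A (?o ` J)"
      unfolding denominator_ideal_def
    proof (intro conjI ballI Iid ann)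
      fix X Y assume XY: "X \<in> ?o ` J" "Y \<in> carrier OU.L"
      obtain a y where ay: "a \<in> J" "X = ?o a" "y \<in> OQ" "Y = ?o y" using XY LO by auto
      note pr = prod[OF q(1) _ ay(1,3)]
      have "?\<iota> (?o \<lblot>q,a,y\<rblot>\<^bsub>Q\<^esub>) \<in> ?\<iota> ` carrier OU.L" "?\<iota> (?o \<lblot>q,y,a\<rblot>\<^bsub>Q\<^esub>) \<in> ?\<iota> ` carrier OU.L"
        using pr LO by blast+
      then show "\<lblot>A,?\<iota> X,?\<iota> Y\<rblot>\<^bsub>QU.L\<^esub> \<in> ?\<iota> ` carrier OU.L" "\<lblot>A,?\<iota> Y,?\<iota> X\<rblot>\<^bsub>QU.L\<^esub> \<in> ?\<iota> ` carrier OU.L"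
        using ay pr val[OF JO[OF ay(1)] ay(3)] val[OF ay(3) JO[OF ay(1)]] by (simp_all add: incl)
    qed
    moreover have "\<not> kills OU.L QU.L ?\<iota> A (?o ` J)"
    proof
      assume neg: "kills OU.L QU.L ?\<iota> A (?o ` J)"
      have "q \<in> QU.N"
      proof (rule localised_nonsingular[OF maximal U q(1) I])
        fix a y assume a: "a \<in> orth_closure (k ` I)" and y: "y \<in> OQ"
        then have aJ: "a \<in> J" by (simp add: J_def)
        have "?o y \<in> carrier OU.L" "?o a \<in> ?o ` J" using LO y aJ by blast+
        then have "\<lblot>A,?\<iota> (?o a),?\<iota> (?o y)\<rblot>\<^bsub>QU.L\<^esub> = QU.N" "\<lblot>A,?\<iota> (?o y),?\<iota> (?o a)\<rblot>\<^bsub>QU.L\<^esub> = QU.N"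
          using neg unfolding kills_def QU.L_simps(2) by blast+
        then show "\<lblot>q,a,y\<rblot>\<^bsub>Q\<^esub> \<in> QU.N \<and> \<lblot>q,y,a\<rblot>\<^bsub>Q\<^esub> \<in> QU.N"
          using val[OF JO[OF aJ] y] val[OF y JO[OF aJ]] Q.coset_zero_iff[OF QU.N_ideal] q(1) OQ_subset[OF y]
            OQ_subset[OF JO[OF aJ]] by simp
      qed
      then show False using qN by simp
    qed
    ultimately show "\<exists>I. L.denom A I \<and> \<not> kills OU.L QU.L ?\<iota> A I" by blast
  qed
qed

end

theorem proposition3p9:
  fixes F :: "('f, 'z) ring_scheme"
    and R :: "('f, 'r) triple_system"
    and E :: "('r \<Rightarrow> 'r, 'e) module"
    and j :: "'r \<Rightarrow> 'e"
    and K :: "('e \<Rightarrow> 'e) ring"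
    and P :: "('e \<Rightarrow> 'e, 'e) triple_system"
  assumes "triple_lie_system F R"
    and "carrier R \<noteq> {\<zero>\<^bsub>R\<^esub>}"
    and "triple_semiprime F R"
    and "injective_hull (mult_ring F R) (op_module R) E j"
    and K_def: "K = CM F R E j"
    and P_def: "P = P_system F R E j"
  shows "quotient_system F R (P_system_base F R E j) j \<and>
    (\<forall>(Q :: ('f, 'q) triple_system) i. maximal_quotient_system F R Q i \<longrightarrow>
      (\<exists>f. triple_embedding F (P_system_base F R E j) Q f \<and> (\<forall>x\<in>carrier R. f (j x) = i x))) \<and>
    (\<forall>(H :: ('e \<Rightarrow> 'e, 'h) module) k (Q :: ('e \<Rightarrow> 'e, 'h) triple_system).
      injective_hull (mult_ring K P) (op_module P) H k \<and> maximal_quotient_system_in K P H k Q \<longrightarrow>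
      triple_subsystem K (O_system K P H k) Q \<and>
      carrier Q = orth_completion K (scalar_module P H) (carrier Q) \<and>
      (\<forall>U. idem_ultrafilter K U \<longrightarrow>
        quotient_system K (localised_system K (O_system K P H k) U) (localised_system K Q U)
          (localised_inclusion K Q U)))"
proof (intro conjI allI impI)
  interpret R: triple_lie_system F R by fact
  interpret R: hull_system F R E j
    using R.semiprime_systemI[OF assms(3)] assms(4) by (simp add: hull_system_def hull_system_axioms_def)
  show quot: "quotient_system F R (P_system_base F R E j) j"
    by (rule R.Pbase_quotient_system)
  show "\<exists>f. triple_embedding F (P_system_base F R E j) Q f \<and> (\<forall>x\<in>carrier R. f (j x) = i x)"
    if "maximal_quotient_system F R Q i" for Q :: "('f, 'q) triple_system" and i
    using maximal_quotient_system_embeds[OF that quot] .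
  fix H :: "('e \<Rightarrow> 'e, 'h) module" and k and Q :: "('e \<Rightarrow> 'e, 'h) triple_system"
  assume "injective_hull (mult_ring K P) (op_module P) H k \<and> maximal_quotient_system_in K P H k Q"
  \<comment> \<open>The hull of R has done its work in showing that P(R) is a closed system over
    CM(R); the hull \<open>H\<close> of P(R) is a different module, over the multiplication ring of
    P(R).\<close>
  then interpret P: maximal_quotient_in_hull K P H k Q
    using R.P_closed_system
    by (simp add: maximal_quotient_in_hull_def maximal_quotient_in_hull_axioms_def K_def P_def)
  show "triple_subsystem K (O_system K P H k) Q"
    by (rule P.Osys_subsystem)
  show "carrier Q = orth_completion K (scalar_module P H) (carrier Q)"
    by (rule P.Q_orth_completion)
  show "quotient_system K (localised_system K (O_system K P H k) U) (localised_system K Q U)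
      (localised_inclusion K Q U)" if "idem_ultrafilter K U" for U
    using that by (rule P.localised_quotient_system)
qed

end
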